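(* Let $p\ge 3$ be prime, $n\ge 1$, and let $G\le S_{p^n}$ be a $5/2$-closed group that contains a regular cyclic subgroup. If $P$ is a Sylow $p$-subgroup of $G$, then $P$ is permutation isomorphic to $\Pi(\mathbf{k})$ for some primary key $\mathbf{k}=(k_1,\ldots,k_n)\in\mathbf{K}_{p^n}$. Further, $P$ is $5/2$-closed.
   Context: $S_{p^n}$ is the symmetric group on $\mathbb{Z}_{p^n}$. A permutation group is regular if it is transitive with trivial point stabilizers. Primary keys: $\mathbf{K}_{p^n}$ is the set of vectors $(k_1,\ldots,k_n)$ of nonnegative integers with $k_i<i$ for $1\le i\le n$ and $k_{i-1}\le k_i$ for $2\le i\le n$ (so $k_1=0$); its elements are called primary keys. Let $\tau_n:\mathbb{Z}_{p^n}\to\mathbb{Z}_{p^n}$, $\tau_n(x)=x+1$. For $0\le i\le n$ let $\mathcal{B}_i$ be the set of orbits of $\langle\tau_n^{p^{n-i}}\rangle$, i.e. the set of the $p^{n-i}$ cosets of the subgroup of order $p^i$ in $\mathbb{Z}_{p^n}$. For $g\in S_X$ and $Y\subseteq X$ with $g(Y)=Y$, $g|_Y\in S_X$ is the permutation equal to $g$ on $Y$ and to the identity off $Y$. For a primary key $\mathbf{k}$ put $P_{i,k_i}=\langle\tau_n^{p^{i-1}}|_{B}: B\in\mathcal{B}_{n-k_i}\rangle$ (well defined since $n-i+1\le n-k_i$) and $\Pi(\mathbf{k})=\langle P_{i,k_i}:1\le i\le n\rangle\le S_{p^n}$. Block systems: let $G\le S_X$ be transitive, $X$ finite. A block of $G$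 is a subset $B\subseteq X$ such that $g(B)\cap B\in\{\emptyset,B\}$ for all $g\in G$; the set $\{g(B):g\in G\}$ for a (nonempty) block $B$ is a block system of $G$ (trivial cases, singletons and $\{X\}$, are allowed). A block system is normal if it is the set of orbits of some normal subgroup of $G$. For a block system $\mathcal{B}$, $\mathrm{fix}_G(\mathcal{B})=\{g\in G: g(B)=B \text{ for all } B\in\mathcal{B}\}$. If $K\le S_X$ leaves $Y\subseteq X$ invariant, $K^Y$ is the permutation group induced by $K$ on $Y$. Wreath stabilizer: for $\mathcal{B}$ a normal block system of $G$ and $B\in\mathcal{B}$, $\mathrm{WStab}_G(B)$ is the largest subgroup $K\le\mathrm{fix}_G(\mathcal{B})$ such that $K^B=1$ and, for every $B'\in\mathcal{B}$, $K^{B'}$ is trivial or transitive on $B'$ (it is the group generated by all subgroups with this property). Define $B\equiv B'$ on $\mathcal{B}$ iff $\mathrm{WStab}_G(B)=\mathrm{WStab}_G(B')$. The $\mathcal{B}$-fixer block system of $G$ is the set of subsets of $X$ that are unions of the blocks in an equivalence class of $\equiv$; it is a block system of $G$. A transitive group $G\le S_X$ is $5/2$-closed if for every transitive subgroup $H\le G$, every normal block system $\mathcal{B}_H$ of $H$, every block $E$ of the $\mathcal{B}_H$-fixer block system of $H$, and every $g\in G$ that fixes setwise each block of $\mathcal{B}_H$ contained in $E$, one has $g|_E\in G$. *)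

theory Defs
  imports "HOL-Algebra.Group_Action" "HOL-Algebra.Elementary_Groups" "HOL-Computational_Algebra.Primes"
begin

text \<open>
  A permutation group on \<open>X\<close> is given by its set of elements, a subgroup of \<^term>\<open>BijGroup X\<close>.
  Permutations are therefore extensional functions on \<open>X\<close>.
\<close>

abbreviation perm_grp :: "'a set \<Rightarrow> ('a \<Rightarrow> 'a) set \<Rightarrow> ('a \<Rightarrow> 'a) monoid" where
  "perm_grp X G \<equiv> (BijGroup X)\<lparr>carrier := G\<rparr>"

definition transitive_perm_grp :: "'a set \<Rightarrow> ('a \<Rightarrow> 'a) set \<Rightarrow> bool" where
  "transitive_perm_grp X G \<longleftrightarrow>
     subgroup G (BijGroup X) \<and> transitive_action (perm_grp X G) X (\<lambda>g. g)"

definition regular_perm_grp :: "'a set \<Rightarrow> ('a \<Rightarrow> 'a) set \<Rightarrow> bool" where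
  "regular_perm_grp X G \<longleftrightarrow> transitive_perm_grp X G \<and>
     (\<forall>x\<in>X. stabilizer (perm_grp X G) (\<lambda>g. g) x = {\<one>\<^bsub>BijGroup X\<^esub>})"

definition perm_orbits :: "'a set \<Rightarrow> ('a \<Rightarrow> 'a) set \<Rightarrow> 'a set set" where
  "perm_orbits X G = orbits (perm_grp X G) X (\<lambda>g. g)"

definition perm_isomorphic ::
  "'a set \<Rightarrow> ('a \<Rightarrow> 'a) set \<Rightarrow> 'b set \<Rightarrow> ('b \<Rightarrow> 'b) set \<Rightarrow> bool" where
  "perm_isomorphic X G Y H \<longleftrightarrow>
     (\<exists>l \<phi>. bij_betw l X Y \<and> \<phi> \<in> iso (perm_grp X G) (perm_grp Y H) \<and>
        (\<forall>g\<in>G. \<forall>x\<in>X. l (g x) = \<phi> g (l x)))"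

definition sylow_subgroup :: "nat \<Rightarrow> 'a set \<Rightarrow> ('a, 'b) monoid_scheme \<Rightarrow> bool" where
  "sylow_subgroup p P G \<longleftrightarrow> subgroup P G \<and> card P = p ^ multiplicity p (order G)"

text \<open>\<open>g|\<^sub>Y\<close>, extended by the identity to all of \<open>X\<close>; only meaningful if \<open>g ` Y = Y\<close>.\<close>

definition perm_restrict :: "'a set \<Rightarrow> ('a \<Rightarrow> 'a) \<Rightarrow> 'a set \<Rightarrow> 'a \<Rightarrow> 'a" where
  "perm_restrict X g Y = (\<lambda>x\<in>X. if x \<in> Y then g x else x)"

text \<open>\<open>K\<^sup>Y\<close>, a permutation group on \<open>Y\<close> rather than on \<open>X\<close>.\<close>

definition induced_grp :: "('a \<Rightarrow> 'a) set \<Rightarrow> 'a set \<Rightarrow> ('a \<Rightarrow> 'a) set" where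
  "induced_grp K Y = (\<lambda>g. restrict g Y) ` K"


subsection \<open>Primary keys\<close>

text \<open>
  A key \<open>(k\<^sub>1, \<dots>, k\<^sub>n)\<close> is a function extensional on \<open>{1..n}\<close>. In \<open>P_key p n i j\<close> the argument
  \<open>j\<close> stands for \<open>k\<^sub>i\<close>; for \<open>j < i \<le> n\<close> the permutation being restricted leaves each \<open>B\<close> invariant.
\<close>

definition primary_keys :: "nat \<Rightarrow> (nat \<Rightarrow> nat) set" where
  "primary_keys n = {k \<in> extensional {1..n}.
     (\<forall>i\<in>{1..n}. k i < i) \<and> (\<forall>i\<in>{2..n}. k (i - 1) \<le> k i)}"

abbreviation Zmod :: "nat \<Rightarrow> int set" where
  "Zmod m \<equiv> carrier (integer_mod_group m)"

definition tau :: "nat \<Rightarrow> int \<Rightarrow> int" where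
  "tau m = (\<lambda>x\<in>Zmod m. (x + 1) mod int m)"

definition coset_blocks :: "nat \<Rightarrow> nat \<Rightarrow> nat \<Rightarrow> int set set" where
  "coset_blocks p n i = perm_orbits (Zmod (p ^ n))
     (generate (BijGroup (Zmod (p ^ n)))
        {tau (p ^ n) [^]\<^bsub>BijGroup (Zmod (p ^ n))\<^esub> (p ^ (n - i))})"

definition P_key :: "nat \<Rightarrow> nat \<Rightarrow> nat \<Rightarrow> nat \<Rightarrow> (int \<Rightarrow> int) set" where
  "P_key p n i j = generate (BijGroup (Zmod (p ^ n)))
     {perm_restrict (Zmod (p ^ n))
        (tau (p ^ n) [^]\<^bsub>BijGroup (Zmod (p ^ n))\<^esub> (p ^ (i - 1))) B | B.
        B \<in> coset_blocks p n (n - j)}"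

definition Pi_key :: "nat \<Rightarrow> nat \<Rightarrow> (nat \<Rightarrow> nat) \<Rightarrow> (int \<Rightarrow> int) set" where
  "Pi_key p n k = generate (BijGroup (Zmod (p ^ n))) (\<Union>i\<in>{1..n}. P_key p n i (k i))"


subsection \<open>Block systems and the wreath stabilizer\<close>

definition is_block :: "'a set \<Rightarrow> ('a \<Rightarrow> 'a) set \<Rightarrow> 'a set \<Rightarrow> bool" where
  "is_block X G B \<longleftrightarrow> B \<subseteq> X \<and> (\<forall>g\<in>G. g ` B \<inter> B \<in> {{}, B})"

definition is_block_system :: "'a set \<Rightarrow> ('a \<Rightarrow> 'a) set \<Rightarrow> 'a set set \<Rightarrow> bool" where
  "is_block_system X G \<B> \<longleftrightarrow>
     (\<exists>B. B \<noteq> {} \<and> is_block X G B \<and> \<B> = {g ` B | g. g \<in> G})"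

definition normal_block_system :: "'a set \<Rightarrow> ('a \<Rightarrow> 'a) set \<Rightarrow> 'a set set \<Rightarrow> bool" where
  "normal_block_system X G \<B> \<longleftrightarrow> is_block_system X G \<B> \<and>
     (\<exists>N. N \<lhd> perm_grp X G \<and> \<B> = perm_orbits X N)"

definition fixer :: "('a \<Rightarrow> 'a) set \<Rightarrow> 'a set set \<Rightarrow> ('a \<Rightarrow> 'a) set" where
  "fixer G \<B> = {g \<in> G. \<forall>B\<in>\<B>. g ` B = B}"

text \<open>
  The join of all subgroups satisfying \<open>wstab_cond\<close> again satisfies it, so \<open>WStab\<close> is the
  largest such subgroup.
\<close>

definition wstab_cond ::
  "'a set \<Rightarrow> ('a \<Rightarrow> 'a) set \<Rightarrow> 'a set set \<Rightarrow> 'a set \<Rightarrow> ('a \<Rightarrow> 'a) set \<Rightarrow> bool" where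
  "wstab_cond X G \<B> B K \<longleftrightarrow>
     subgroup K (BijGroup X) \<and> K \<subseteq> fixer G \<B> \<and>
     induced_grp K B = {\<one>\<^bsub>BijGroup B\<^esub>} \<and>
     (\<forall>B'\<in>\<B>. induced_grp K B' = {\<one>\<^bsub>BijGroup B'\<^esub>} \<or> transitive_perm_grp B' (induced_grp K B'))"

definition WStab ::
  "'a set \<Rightarrow> ('a \<Rightarrow> 'a) set \<Rightarrow> 'a set set \<Rightarrow> 'a set \<Rightarrow> ('a \<Rightarrow> 'a) set" where
  "WStab X G \<B> B = generate (BijGroup X) (\<Union>{K. wstab_cond X G \<B> B K})"

definition fixer_block_system ::
  "'a set \<Rightarrow> ('a \<Rightarrow> 'a) set \<Rightarrow> 'a set set \<Rightarrow> 'a set set" where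
  "fixer_block_system X G \<B> =
     {\<Union>{B' \<in> \<B>. WStab X G \<B> B = WStab X G \<B> B'} | B. B \<in> \<B>}"

definition five_halves_closed :: "'a set \<Rightarrow> ('a \<Rightarrow> 'a) set \<Rightarrow> bool" where
  "five_halves_closed X G \<longleftrightarrow> transitive_perm_grp X G \<and>
     (\<forall>H \<B> E g. H \<subseteq> G \<and> transitive_perm_grp X H \<and> normal_block_system X H \<B> \<and>
        E \<in> fixer_block_system X H \<B> \<and> g \<in> G \<and> (\<forall>B\<in>\<B>. B \<subseteq> E \<longrightarrow> g ` B = B) \<longrightarrow>
        perm_restrict X g E \<in> G)"

end

theory Submission
  imports Defs "HOL-Algebra.Sylow" "HOL-Number_Theory.Residues"
begin

text \<open>
  The points are labelled by \<open>\<int>/p\<^sup>n\<close>. For a primary key \<open>k\<close>, the group \<open>\<Pi>(k)\<close> consists of the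
  permutations \<open>f\<close> such that for each \<open>i\<close> the displacement \<open>f x - x\<close> modulo \<open>p\<^sup>i\<close> only depends on \<open>x\<close>
  modulo \<open>p\<^bsup>k i\<^esup>\<close> (\<open>generate_restricted_shifts\<close>). The argument works with this description, called
  \<open>key_perms k\<close>, throughout.

  Let \<open>P\<close> be a Sylow \<open>p\<close>-subgroup of \<open>G\<close>. A cyclic \<open>p\<close>-subgroup of \<open>G\<close> has a conjugate in \<open>P\<close>
  (\<open>conj_in_of_index_coprime\<close>), so for a suitable labelling \<open>P\<close> contains the shift by one. A
  \<open>p\<close>-group with this property preserves the congruences modulo all \<open>p\<^sup>j\<close>, and it lies in the group
  \<open>key_perms full_key\<close> with the largest possible key (\<open>p_group_full_key\<close>). As the latter is itself a
  \<open>p\<close>-group, \<open>P = G \<inter> key_perms full_key\<close> (\<open>sylow_eq_Int\<close>), which makes the closure property of \<open>G\<close>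
  available for \<open>P\<close>.

  Let \<open>k i\<close> be least such that the displacements of all elements of \<open>P\<close> modulo \<open>p\<^sup>i\<close> only depend on
  the point modulo \<open>p\<^bsup>k i\<^esup>\<close>, so that \<open>P\<close> is contained in \<open>key_perms k\<close>. Equality follows once \<open>P\<close>
  contains, for each \<open>i\<close>, the restriction of the shift by \<open>p\<^bsup>i-1\<^esup>\<close> to each residue class modulo
  \<open>p\<^bsup>k i\<^esup>\<close>. This is shown for \<open>i = n, n-1, \<dots>, 1\<close> (\<open>level_residue_shift\<close>). Consider the residue classes
  modulo \<open>p\<^bsup>i-1\<^esup>\<close> as a block system of \<open>P\<close>. The block of \<open>0\<close> in its fixer block system consists of the
  multiples of some \<open>p\<^sup>e\<close>, and \<open>5/2\<close>-closedness gives the restriction of the shift by \<open>p\<^bsup>i-1\<^esup>\<close> to this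
  block; so \<open>e \<ge> k i\<close> is what is needed. Assume \<open>e < k i\<close>. By minimality of \<open>k i\<close>, the group that \<open>P\<close>
  induces on the multiples of \<open>p\<^sup>e\<close> modulo \<open>p\<^sup>i\<close> is larger than the cyclic group of translations.
  Normalizers grow in \<open>p\<close>-groups, so it contains a nontrivial multiplication, and since \<open>p\<close> is odd
  also the multiplication by \<open>1 + u p\<^bsup>i-1-e\<^esup>\<close> with a unit \<open>u\<close> (\<open>level_multiplier\<close>). This fixes all blocks
  inside the multiples of \<open>p\<^sup>e\<close>, hence its restriction to them lies in \<open>P\<close>. After a correction modulo
  higher powers of \<open>p\<close>, possible by the earlier levels, it translates each block by a multiple of
  \<open>p\<^bsup>i-1\<^esup>\<close> that is zero on the block of \<open>0\<close> and \<open>u p\<^bsup>i-1\<^esup>\<close> on the block of \<open>p\<^sup>e\<close>. Its powers then separate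
  the wreath stabilizers of these two blocks, a contradiction.

  Conversely, every \<open>key_perms k\<close> with \<open>k i < i\<close> is \<open>5/2\<close>-closed, for any prime \<open>p\<close>
  (\<open>five_halves_closed_key_perms\<close>): if \<open>x\<close> and \<open>y\<close> agree modulo \<open>p\<^bsup>k i\<^esup>\<close> but lie in different blocks of the
  fixer block system of a block system, then the block of \<open>x\<close> in the latter lies in a single residue class modulo \<open>p\<^sup>i\<close>, so that a
  permutation that fixes this block does not change \<open>x\<close> modulo \<open>p\<^sup>i\<close>. Hence restricting it disturbs
  no displacement.
\<close>

section \<open>Fixed points of maps of prime power order\<close>

lemma card_nonfixed_prime_order:
  assumes "finite S" and p: "prime (p::nat)" and f: "\<And>x. x \<in> S \<Longrightarrow> f x \<in> S"
    and fp: "\<And>x. x \<in> S \<Longrightarrow> (f ^^ p) x = x"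
  shows "p dvd card {x \<in> S. f x \<noteq> x}"
proof -
  define orb where "orb x = (\<lambda>i. (f ^^ i) x) ` {..<p}" for x
  have p0: "p > 0" using p prime_gt_0_nat by blast
  have fin: "(f ^^ i) x \<in> S" if "x \<in> S" for i x
    using that by (induction i) (auto intro: f)
  have fpm: "(f ^^ (p * m)) x = x" if "x \<in> S" for m x
    by (induction m) (use fp that in \<open>simp_all add: funpow_add\<close>)
  have fmod: "(f ^^ i) x = (f ^^ (i mod p)) x" if "x \<in> S" for i x
  proof -
    have "(f ^^ (i mod p + p * (i div p))) x = (f ^^ (i mod p)) x"
      unfolding funpow_add by (simp add: fpm that)
    then show ?thesis by simp
  qed
  have orb: "orb x = range (\<lambda>i. (f ^^ i) x)" if "x \<in> S" for x
    unfolding orb_def using fmod[OF that] p0 by (auto intro!: image_eqI[where x="_ mod p"])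
  have orbD: "orb y = orb x" if "x \<in> S" "y \<in> orb x" for x y
  proof -
    have "y \<in> range (\<lambda>i. (f ^^ i) x)" using that orb[OF that(1)] by simp
    then obtain i where i: "y = (f ^^ i) x" by blast
    have y: "y \<in> S" using i that fin by simp
    have "i \<le> p * i" using p0 by simp
    then have x: "x = (f ^^ (p * i - i)) y"
      using fpm[OF that(1), of i] by (simp add: i flip: funpow_add[THEN fun_cong, unfolded o_apply])
    have "(f ^^ j) y = (f ^^ (j + i)) x" for j by (simp add: i funpow_add)
    moreover have "(f ^^ j) x = (f ^^ (j + (p * i - i))) y" for j
      by (subst x) (simp add: funpow_add)
    ultimately show ?thesis unfolding orb[OF y] orb[OF that(1)] by blast
  qed
  have fixall: "f x = x" if x: "x \<in> S" and "i < j" "j < p" and eq: "(f ^^ i) x = (f ^^ j) x" for x i j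
  proof -
    define d where "d = j - i"
    have d: "0 < d" "d < p" using that by (auto simp: d_def)
    have "(f ^^ (p - i + i)) x = x"
      using fp[OF x] that by simp
    moreover have "p - i + j = d + p" using that by (simp add: d_def)
    then have "(f ^^ (p - i + j)) x = (f ^^ (d + p)) x" by simp
    ultimately have fd: "(f ^^ d) x = x" using eq fp[OF x] by (simp add: funpow_add)
    have fdm: "(f ^^ (d * m)) x = x" for m
      by (induction m) (use fd in \<open>simp_all add: funpow_add\<close>)
    have "coprime d p"
      using p d by (metis coprime_commute prime_imp_coprime nat_dvd_not_less)
    then obtain a b where "d * a = p * b + 1"
      using bezout_nat[of d p] d by auto
    with fdm[of a] fpm[OF x, of b] show "f x = x" by simp
  qed
  have card_orb: "card (orb x) = p" if "x \<in> S" "f x \<noteq> x" for x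
  proof -
    have "inj_on (\<lambda>i. (f ^^ i) x) {..<p}"
    proof (rule inj_onI)
      fix i j assume ij: "i \<in> {..<p}" "j \<in> {..<p}" "(f ^^ i) x = (f ^^ j) x"
      show "i = j"
      proof (rule linorder_cases[of i j])
        show "i < j \<Longrightarrow> i = j" using fixall[of x i j] ij that by simp
        show "j < i \<Longrightarrow> i = j" using fixall[of x j i] ij that by simp
      qed
    qed
    then show ?thesis unfolding orb_def by (simp add: card_image)
  qed
  let ?T = "{x \<in> S. f x \<noteq> x}"
  have orbT: "orb x \<subseteq> ?T" if x: "x \<in> ?T" for x
  proof
    fix y assume y: "y \<in> orb x"
    have yS: "y \<in> S" using y x fin orb by auto
    have "f y \<noteq> y"
    proof
      assume fy: "f y = y"
      have "(f ^^ i) y = y" for i by (induction i) (simp_all add: fy)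
      then have "orb y = {y}" using orb[OF yS] by auto
      then have "orb x = {y}" using orbD[of x y] x y by simp
      moreover have "x \<in> orb x" "f x \<in> orb x"
        using orb x range_eqI[of x "\<lambda>i. (f ^^ i) x" 0] range_eqI[of "f x" "\<lambda>i. (f ^^ i) x" 1] by auto
      ultimately show False using x by auto
    qed
    then show "y \<in> ?T" using yS by simp
  qed
  have xorb: "x \<in> orb x" if "x \<in> S" for x
    using orb[OF that] range_eqI[of x "\<lambda>i. (f ^^ i) x" 0] by simp
  have U: "\<Union>(orb ` ?T) = ?T" using orbT xorb by blast
  have "p dvd card (\<Union>(orb ` ?T))"
  proof (rule dvd_partition)
    show "finite (\<Union>(orb ` ?T))" unfolding U using \<open>finite S\<close> by simp
    show "\<forall>c\<in>orb ` ?T. p dvd card c" using card_orb by auto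
    show "\<forall>c1\<in>orb ` ?T. \<forall>c2\<in>orb ` ?T. c1 \<noteq> c2 \<longrightarrow> c1 \<inter> c2 = {}"
      using orbD by (smt (verit, best) disjoint_iff image_iff mem_Collect_eq)
  qed
  then show ?thesis unfolding U .
qed

lemma card_nonfixed_prime_power_order:
  assumes "finite S" and p: "prime (p::nat)" and f: "\<And>x. x \<in> S \<Longrightarrow> f x \<in> S"
    and fp: "\<And>x. x \<in> S \<Longrightarrow> (f ^^ (p ^ r)) x = x"
  shows "p dvd card {x \<in> S. f x \<noteq> x}"
  using assms
proof (induction r arbitrary: S)
  case 0
  then have "{x \<in> S. f x \<noteq> x} = {}" by auto
  then show ?case by (metis card.empty dvd_0_right)
next
  case (Suc r)
  define g where "g = f ^^ (p ^ r)"
  have fin: "(f ^^ i) x \<in> S" if "x \<in> S" for i x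
    using that by (induction i) (auto intro: Suc.prems)
  have gS: "g x \<in> S" if "x \<in> S" for x using fin that by (simp add: g_def)
  have gp: "(g ^^ p) x = x" if "x \<in> S" for x
    using Suc.prems(4)[OF that] by (simp add: g_def funpow_mult mult.commute)
  have fg: "g (f x) = f (g x)" for x
    unfolding g_def by (metis funpow_swap1)
  define T where "T = {x \<in> S. g x = x}"
  have 1: "p dvd card {x \<in> S. g x \<noteq> x}"
    by (rule card_nonfixed_prime_order[OF Suc.prems(1) p gS gp])
  have 2: "p dvd card {x \<in> T. f x \<noteq> x}"
    by (rule Suc.IH) (use Suc.prems fg in \<open>auto simp: T_def g_def\<close>)
  have "(f ^^ i) x = x" if "f x = x" for i x by (induction i) (simp_all add: that)
  then have eq: "{x \<in> S. f x \<noteq> x} = {x \<in> S. g x \<noteq> x} \<union> {x \<in> T. f x \<noteq> x}"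
    by (auto simp: T_def g_def)
  have "card {x \<in> S. f x \<noteq> x} = card {x \<in> S. g x \<noteq> x} + card {x \<in> T. f x \<noteq> x}"
    unfolding eq by (rule card_Un_disjoint) (use Suc.prems(1) in \<open>auto simp: T_def\<close>)
  then show ?case using 1 2 by simp
qed

context group
begin

text \<open>
  A \<open>p\<close>-element \<open>c\<close> acts on the right cosets of a subgroup by right multiplication; the fixed cosets
  correspond to the elements that conjugate \<open>c\<close> into the subgroup.
\<close>

lemma rcos_mult_fixed_iff:
  assumes "subgroup H G" "g \<in> carrier G" "c \<in> carrier G"
  shows "(H #> g) #> c = H #> g \<longleftrightarrow> g \<otimes> c \<otimes> inv g \<in> H"
proof -
  have H: "H \<subseteq> carrier G" by (rule subgroup.subset[OF assms(1)])
  have 1: "(H #> g) #> c = H #> (g \<otimes> c)" by (simp add: coset_mult_assoc H assms)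
  show ?thesis
  proof
    assume "(H #> g) #> c = H #> g"
    then have "H #> (g \<otimes> c \<otimes> inv g) = H"
      using 1 assms H by (metis coset_mult_assoc coset_mult_one inv_closed m_closed r_inv)
    then show "g \<otimes> c \<otimes> inv g \<in> H" using coset_join1 assms by simp
  next
    assume "g \<otimes> c \<otimes> inv g \<in> H"
    then have "H #> (g \<otimes> c \<otimes> inv g) = H" using coset_join2 assms by simp
    then have "H #> (g \<otimes> c \<otimes> inv g \<otimes> g) = H #> g"
      using coset_mult_assoc[OF H, of "g \<otimes> c \<otimes> inv g" g] assms by simp
    then show "(H #> g) #> c = H #> g" using 1 assms by (simp add: m_assoc)
  qed
qed

lemma card_nonfixed_rcosets:
  assumes fin: "finite (carrier G)" and p: "prime (p::nat)" and H: "subgroup H G"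
    and c: "c \<in> carrier G" "c [^] (p ^ r) = \<one>"
  shows "p dvd card {R \<in> rcosets H. R #> c \<noteq> R}"
proof (rule card_nonfixed_prime_power_order[OF _ p])
  have HG: "H \<subseteq> carrier G" by (rule subgroup.subset[OF H])
  show "finite (rcosets H)"
    using fin by (simp add: RCOSETS_def)
  show "R #> c \<in> rcosets H" if "R \<in> rcosets H" for R
    using that c HG unfolding RCOSETS_def by (auto simp: coset_mult_assoc)
  fix R assume "R \<in> rcosets H"
  then obtain g where g: "g \<in> carrier G" "R = H #> g" unfolding RCOSETS_def by auto
  have "((\<lambda>R. R #> c) ^^ m) R = H #> (g \<otimes> c [^] m)" for m
    by (induction m) (use g c HG in \<open>simp_all add: coset_mult_assoc m_assoc\<close>)
  then show "((\<lambda>R. R #> c) ^^ (p ^ r)) R = R" using c g by simp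
qed

text \<open>The part of Sylow's conjugacy theorem that concerns cyclic \<open>p\<close>-subgroups.\<close>

lemma conj_in_of_index_coprime:
  assumes "finite (carrier G)" "prime (p::nat)" "subgroup H G" "\<not> p dvd card (rcosets H)"
    and c: "c \<in> carrier G" "c [^] (p ^ r) = \<one>"
  obtains g where "g \<in> carrier G" "g \<otimes> c \<otimes> inv g \<in> H"
proof -
  have "\<exists>R\<in>rcosets H. R #> c = R"
  proof (rule ccontr)
    assume "\<not> ?thesis"
    then have "{R \<in> rcosets H. R #> c \<noteq> R} = rcosets H" by blast
    then show False using card_nonfixed_rcosets[OF assms(1-3) c] assms(4) by simp
  qed
  then show thesis using that rcos_mult_fixed_iff[OF assms(3) _ c(1)] unfolding RCOSETS_def by auto
qed

text \<open>
  An analogue of the growth of normalizers in finite \<open>p\<close>-groups: the coset \<open>H\<close> is fixed by \<open>c\<close>, and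
  the number of fixed cosets is divisible by \<open>p\<close>, so that there is another one.
\<close>

lemma conj_in_proper_subgroup:
  assumes ord: "order G = p ^ s" and p: "prime (p::nat)" and H: "subgroup H G" "H \<noteq> carrier G"
    and c: "c \<in> H"
  obtains g where "g \<in> carrier G" "g \<notin> H" "g \<otimes> c \<otimes> inv g \<in> H"
proof -
  have fin: "finite (carrier G)"
  proof (rule ccontr)
    assume "infinite (carrier G)"
    then have "p ^ s = 0" using ord by (simp add: order_def)
    then show False using p by (simp add: prime_gt_0_nat)
  qed
  have cG: "c \<in> carrier G" by (rule subgroup.mem_carrier[OF H(1) c])
  have c1: "c [^] (p ^ s) = \<one>" using pow_order_eq_1[OF cG] ord by simp
  have lag: "card (rcosets H) * card H = p ^ s" using lagrange[OF H(1)] ord by simp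
  have "card H < p ^ s"
    using psubset_card_mono[OF fin, of H] H(2) subgroup.subset[OF H(1)] ord
    unfolding order_def by auto
  then have ne1: "card (rcosets H) \<noteq> 1" using lag by auto
  have "card (rcosets H) dvd p ^ s" by (rule dvdI[of _ _ "card H"]) (simp add: lag)
  then obtain m where m: "card (rcosets H) = p ^ m"
    using divides_primepow_nat[OF p] by blast
  with ne1 have "m \<noteq> 0" by (metis power_0)
  then have pd: "p dvd card (rcosets H)" using m by (simp add: dvd_power)
  let ?F = "{R \<in> rcosets H. R #> c = R}"
  have finR: "finite (rcosets H)" using fin by (simp add: RCOSETS_def)
  have "?F \<union> {R \<in> rcosets H. R #> c \<noteq> R} = rcosets H" by blast
  moreover have "card (?F \<union> {R \<in> rcosets H. R #> c \<noteq> R})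
      = card ?F + card {R \<in> rcosets H. R #> c \<noteq> R}"
    by (rule card_Un_disjoint) (use finR in auto)
  ultimately have "card (rcosets H) = card ?F + card {R \<in> rcosets H. R #> c \<noteq> R}" by simp
  then have "p dvd card ?F + card {R \<in> rcosets H. R #> c \<noteq> R}" using pd by (simp only:)
  then have pF: "p dvd card ?F"
    using dvd_add_left_iff[OF card_nonfixed_rcosets[OF fin p H(1) cG c1]] by (simp only:)
  have "H \<in> ?F"
    using subgroup.subgroup_in_rcosets[OF H(1) is_group] coset_join2[OF cG H(1) c] by simp
  moreover have "?F \<noteq> {H}"
  proof
    assume "?F = {H}"
    then have "card ?F = card {H}" by (rule arg_cong)
    then have "p dvd 1" using pF by (simp only: card.insert finite.emptyI card.empty empty_iff One_nat_def not_False_eq_True)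
    then show False using p by simp
  qed
  ultimately obtain R where R: "R \<in> rcosets H" "R #> c = R" "R \<noteq> H" by blast
  then obtain g where g: "g \<in> carrier G" "R = H #> g" unfolding RCOSETS_def by auto
  then have "g \<notin> H" using R(3) coset_join2[OF _ H(1)] by auto
  then show thesis using that g R(2) rcos_mult_fixed_iff[OF H(1) g(1) cG] by auto
qed

end

section \<open>Permutation groups on a finite set\<close>

lemma carrier_BijGroup [simp]: "carrier (BijGroup X) = Bij X"
  by (simp add: BijGroup_def)

lemma BijGroup_mult_apply:
  "f \<in> Bij X \<Longrightarrow> g \<in> Bij X \<Longrightarrow> x \<in> X \<Longrightarrow> (f \<otimes>\<^bsub>BijGroup X\<^esub> g) x = f (g x)"
  by (simp add: BijGroup_def compose_eq)

lemma BijGroup_mult: "f \<in> Bij X \<Longrightarrow> g \<in> Bij X \<Longrightarrow> f \<otimes>\<^bsub>BijGroup X\<^esub> g = compose X f g"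
  by (simp add: BijGroup_def)

lemma BijGroup_one: "\<one>\<^bsub>BijGroup X\<^esub> = (\<lambda>x\<in>X. x)"
  by (simp add: BijGroup_def)

lemma Bij_app: "f \<in> Bij X \<Longrightarrow> x \<in> X \<Longrightarrow> f x \<in> X"
  using Bij_imp_funcset by blast

lemma Bij_inj: "f \<in> Bij X \<Longrightarrow> x \<in> X \<Longrightarrow> y \<in> X \<Longrightarrow> f x = f y \<Longrightarrow> x = y"
  by (auto simp: Bij_def bij_betw_def inj_on_def)

lemma Bij_image: "f \<in> Bij X \<Longrightarrow> f ` X = X"
  by (auto simp: Bij_def bij_betw_def)

lemma Bij_eqI: "f \<in> Bij X \<Longrightarrow> g \<in> Bij X \<Longrightarrow> (\<And>x. x \<in> X \<Longrightarrow> f x = g x) \<Longrightarrow> f = g"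
  by (auto simp: Bij_def intro: extensionalityI)

lemma BijI_finite:
  assumes "finite X" "f \<in> extensional X" "\<And>x. x \<in> X \<Longrightarrow> f x \<in> X" "inj_on f X"
  shows "f \<in> Bij X"
proof -
  have "f ` X = X" using assms by (intro endo_inj_surj) auto
  then show ?thesis using assms by (simp add: Bij_def bij_betw_def)
qed

lemma finite_Bij: "finite X \<Longrightarrow> finite (Bij X)"
proof (rule finite_subset)
  show "Bij X \<subseteq> X \<rightarrow>\<^sub>E X" by (auto simp: Bij_def bij_betw_def PiE_def)
qed (simp add: finite_PiE)

lemma BijGroup_inv_apply:
  assumes "f \<in> Bij X" "x \<in> X"
  shows "(inv\<^bsub>BijGroup X\<^esub> f) (f x) = x" "f ((inv\<^bsub>BijGroup X\<^esub> f) x) = x"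
proof -
  interpret group "BijGroup X" by (rule group_BijGroup)
  have i: "inv\<^bsub>BijGroup X\<^esub> f \<in> Bij X" using assms inv_closed[of f] by simp
  show "(inv\<^bsub>BijGroup X\<^esub> f) (f x) = x"
    using BijGroup_mult_apply[OF i assms] l_inv[of f] assms by (simp add: BijGroup_one)
  show "f ((inv\<^bsub>BijGroup X\<^esub> f) x) = x"
    using BijGroup_mult_apply[OF assms(1) i assms(2)] r_inv[of f] assms by (simp add: BijGroup_one)
qed

lemma BijGroup_inv_Bij: "f \<in> Bij X \<Longrightarrow> inv\<^bsub>BijGroup X\<^esub> f \<in> Bij X"
  using group.inv_closed[OF group_BijGroup, of f X] by simp

lemma BijGroup_pow_apply:
  assumes "f \<in> Bij X"
  shows "x \<in> X \<Longrightarrow> (f [^]\<^bsub>BijGroup X\<^esub> (m::nat)) x = (f ^^ m) x"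
proof (induction m arbitrary: x)
  interpret group "BijGroup X" by (rule group_BijGroup)
  case 0
  then show ?case by (simp add: BijGroup_one)
next
  interpret group "BijGroup X" by (rule group_BijGroup)
  case (Suc m)
  have "f [^]\<^bsub>BijGroup X\<^esub> m \<in> Bij X" using nat_pow_closed[of f m] assms by simp
  then have "(f [^]\<^bsub>BijGroup X\<^esub> Suc m) x = (f [^]\<^bsub>BijGroup X\<^esub> m) (f x)"
    using BijGroup_mult_apply assms Suc.prems by simp
  also have "\<dots> = (f ^^ m) (f x)" using Suc Bij_app[OF assms] by blast
  finally show ?case by (simp add: funpow_swap1)
qed

lemma perm_subgroup_mem: "subgroup P (BijGroup X) \<Longrightarrow> f \<in> P \<Longrightarrow> f \<in> Bij X"
  using subgroup.mem_carrier by force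

lemma perm_subgroup_app: "subgroup P (BijGroup X) \<Longrightarrow> f \<in> P \<Longrightarrow> x \<in> X \<Longrightarrow> f x \<in> X"
  by (rule Bij_app[OF perm_subgroup_mem])

lemma perm_subgroup_compose:
  "subgroup P (BijGroup X) \<Longrightarrow> f \<in> P \<Longrightarrow> g \<in> P \<Longrightarrow> compose X f g \<in> P"
  using subgroup.m_closed[of P "BijGroup X" f g] perm_subgroup_mem BijGroup_mult by metis

lemma perm_subgroup_id: "subgroup P (BijGroup X) \<Longrightarrow> (\<lambda>x\<in>X. x) \<in> P"
  using subgroup.one_closed by (metis BijGroup_one)

lemma perm_subgroup_inv: "subgroup P (BijGroup X) \<Longrightarrow> f \<in> P \<Longrightarrow> inv\<^bsub>BijGroup X\<^esub> f \<in> P"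
  by (rule subgroup.m_inv_closed)

lemma perm_subgroupI_finite:
  assumes "finite X" "P \<subseteq> Bij X" and id: "(\<lambda>x\<in>X. x) \<in> P"
    and comp: "\<And>f g. f \<in> P \<Longrightarrow> g \<in> P \<Longrightarrow> compose X f g \<in> P"
  shows "subgroup P (BijGroup X)"
proof -
  interpret group "BijGroup X" by (rule group_BijGroup)
  have finP: "finite P" using assms(1,2) finite_Bij finite_subset by blast
  show ?thesis
  proof (rule subgroupI)
    show "P \<subseteq> carrier (BijGroup X)" using assms by simp
    show "P \<noteq> {}" using id by blast
    show m: "f \<otimes>\<^bsub>BijGroup X\<^esub> g \<in> P" if "f \<in> P" "g \<in> P" for f g
      using that comp assms(2) BijGroup_mult by (metis subsetD)
    show "inv\<^bsub>BijGroup X\<^esub> f \<in> P" if f: "f \<in> P" for f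
    proof -
      have fB: "f \<in> carrier (BijGroup X)" using f assms(2) by auto
      have "inj_on (\<lambda>g. f \<otimes>\<^bsub>BijGroup X\<^esub> g) P"
        using inj_on_cmult[OF fB] assms(2) by (simp add: inj_on_def subset_iff)
      then have "(\<lambda>g. f \<otimes>\<^bsub>BijGroup X\<^esub> g) ` P = P"
        using m f finP by (intro endo_inj_surj) auto
      then have "\<one>\<^bsub>BijGroup X\<^esub> \<in> (\<lambda>g. f \<otimes>\<^bsub>BijGroup X\<^esub> g) ` P" using id by (simp add: BijGroup_one)
      then obtain g where g: "g \<in> P" "f \<otimes>\<^bsub>BijGroup X\<^esub> g = \<one>\<^bsub>BijGroup X\<^esub>" by force
      have gB: "g \<in> carrier (BijGroup X)" using g(1) assms(2) by auto
      have "inv\<^bsub>BijGroup X\<^esub> f = g"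
        by (rule inv_equality[OF inv_comm[OF g(2) fB gB] fB gB])
      then show ?thesis using g by simp
    qed
  qed
qed

lemma perm_subgroup_group: "subgroup P (BijGroup X) \<Longrightarrow> group (perm_grp X P)"
  by (rule subgroup.subgroup_is_group[OF _ group_BijGroup])

lemma perm_grp_inv: "subgroup P (BijGroup X) \<Longrightarrow> f \<in> P \<Longrightarrow> inv\<^bsub>perm_grp X P\<^esub> f = inv\<^bsub>BijGroup X\<^esub> f"
  using group.m_inv_consistent[OF group_BijGroup] by metis

lemma perm_grp_pow: "f [^]\<^bsub>perm_grp X P\<^esub> (m::nat) = f [^]\<^bsub>BijGroup X\<^esub> m"
  by (induction m) (simp_all add: nat_pow_def)

lemma perm_subgroup_pow:
  "subgroup P (BijGroup X) \<Longrightarrow> f \<in> P \<Longrightarrow> f [^]\<^bsub>BijGroup X\<^esub> (m::nat) \<in> P"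
  using monoid.nat_pow_closed[of "perm_grp X P" f m] perm_subgroup_group[THEN group.is_monoid] 
  by (metis partial_object.select_convs(1) partial_object.simps(3) perm_grp_pow partial_object.surjective partial_object.update_convs(1))

lemma perm_subgroup_mono:
  "subgroup P (BijGroup X) \<Longrightarrow> subgroup Q (BijGroup X) \<Longrightarrow> P \<subseteq> Q \<Longrightarrow> subgroup P (perm_grp X Q)"
  using group.subgroup_incl[OF group_BijGroup] by metis

lemma subgroup_of_perm_grp:
  "subgroup Q (BijGroup X) \<Longrightarrow> subgroup P (perm_grp X Q) \<Longrightarrow> subgroup P (BijGroup X)"
  using group.incl_subgroup[OF group_BijGroup] by metis

text \<open>By Cauchy's theorem, a finite group in which all elements have \<open>p\<close>-power order is a
  \<open>p\<close>-group.\<close>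

lemma (in group) card_eq_prime_power:
  assumes fin: "finite (carrier G)" and p: "prime (p::nat)"
    and pow: "\<And>g. g \<in> carrier G \<Longrightarrow> g [^] (p ^ r) = \<one>"
  shows "\<exists>s. order G = p ^ s"
proof -
  have ord: "order G > 0" using fin order_gt_0_iff_finite by blast
  have "q = p" if q: "prime q" "q dvd order G" for q
  proof (rule ccontr)
    assume "q \<noteq> p"
    have "order G = q ^ 1 * (order G div q)" using q by simp
    from sylow_thm[OF q(1) is_group this fin] obtain H where H: "subgroup H G" "card H = q"
      by auto
    have "H \<noteq> {\<one>}" using H(2) q(1) by auto
    then obtain h where h: "h \<in> H" "h \<noteq> \<one>" using subgroup.one_closed[OF H(1)] by blast
    have hG: "h \<in> carrier G" by (rule subgroup.mem_carrier[OF H(1) h(1)])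
    interpret H: group "G\<lparr>carrier := H\<rparr>" by (rule subgroup.subgroup_is_group[OF H(1) is_group])
    have "h [^]\<^bsub>G\<lparr>carrier := H\<rparr>\<^esub> order (G\<lparr>carrier := H\<rparr>) = \<one>"
      using H.pow_order_eq_1[of h] h by simp
    then have "h [^] q = \<one>" using H(2) by (simp add: order_def flip: nat_pow_consistent)
    then have "ord h dvd q" using pow_eq_id[OF hG] by blast
    moreover have "ord h dvd p ^ r" using pow[OF hG] pow_eq_id[OF hG] by blast
    moreover have "coprime q (p ^ r)"
      using \<open>q \<noteq> p\<close> q(1) p by (simp add: primes_coprime)
    ultimately have "ord h = 1" by (metis coprime_common_divisor_nat)
    then show False using h hG ord_eq_1 by blast
  qed
  then have "prime_factors (order G) \<subseteq> {p}" by auto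
  then show ?thesis
    using prime_factorization_nat ord
    by (metis (no_types, lifting) One_nat_def empty_iff finite.emptyI not_gr_zero prod.empty prod.insert mult.right_neutral
        power_0 subset_singletonD)
qed

section \<open>Labelled cyclic sets\<close>

text \<open>
  A set \<open>X\<close> of size \<open>p\<^sup>n\<close> is identified with \<open>\<int>/p\<^sup>n\<close> by a bijection \<open>l\<close>; the point with label
  \<open>a mod p\<^sup>n\<close> is \<open>pt a\<close>. The labelling need not be the identity even when \<open>X\<close> is the set
  of residues itself.
\<close>

locale cyclic_labelling =
  fixes p n :: nat and X :: "'a set" and l :: "'a \<Rightarrow> int"
  assumes prime_p: "prime p" and bij_l: "bij_betw l X {0..<int p ^ n}"
begin

definition pt :: "int \<Rightarrow> 'a" where "pt a = the_inv_into X l (a mod int p ^ n)"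

lemma p_pos: "int p > 0" using prime_p prime_gt_0_nat by simp

lemma pow_pos: "int p ^ j > 0" using p_pos by simp

lemma finite_X: "finite X" using bij_l bij_betw_finite by blast

lemma pt_in [simp]: "pt a \<in> X"
  unfolding pt_def by (rule bij_betwE[OF bij_betw_the_inv_into[OF bij_l], rule_format])
    (use pow_pos in simp)

lemma l_pt: "l (pt a) = a mod int p ^ n"
  unfolding pt_def using f_the_inv_into_f_bij_betw[OF bij_l, of "a mod int p ^ n"] pow_pos by simp

lemma l_range: "x \<in> X \<Longrightarrow> 0 \<le> l x \<and> l x < int p ^ n"
  using bij_betwE[OF bij_l] by auto

lemma pt_l [simp]: "x \<in> X \<Longrightarrow> pt (l x) = x"
  unfolding pt_def using bij_l l_range by (simp add: bij_betw_def the_inv_into_f_f)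

lemma cong_le: "[a = b] (mod int p ^ j) \<Longrightarrow> i \<le> j \<Longrightarrow> [a = b] (mod int p ^ i)"
  using cong_dvd_modulus le_imp_power_dvd by blast

lemma cong_l_pt: "j \<le> n \<Longrightarrow> [l (pt a) = a] (mod int p ^ j)"
  by (rule cong_le[of _ _ n]) (simp_all add: l_pt)

lemma cong_eq: "x \<in> X \<Longrightarrow> y \<in> X \<Longrightarrow> [l x = l y] (mod int p ^ n) \<Longrightarrow> x = y"
  using l_range[of x] l_range[of y] pt_l unfolding cong_def by (metis mod_pos_pos_trivial)

lemma pt_eq_iff: "pt a = pt b \<longleftrightarrow> [a = b] (mod int p ^ n)"
  by (metis cong_def l_pt pt_def)

text \<open>\<open>disp d\<close> moves each point \<open>x\<close> by \<open>d x\<close>; it may fail to be a permutation.\<close>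

definition disp :: "('a \<Rightarrow> int) \<Rightarrow> 'a \<Rightarrow> 'a" where
  "disp d = (\<lambda>x\<in>X. pt (l x + d x))"

text \<open>The translation by \<open>a\<close>; in the standard labelling, \<open>shift 1\<close> is \<open>tau\<close>.\<close>

definition shift :: "int \<Rightarrow> 'a \<Rightarrow> 'a" where
  "shift a = disp (\<lambda>x. a)"

lemma disp_in [simp]: "x \<in> X \<Longrightarrow> disp d x \<in> X" by (simp add: disp_def)

lemma shift_in [simp]: "x \<in> X \<Longrightarrow> shift a x \<in> X" by (simp add: shift_def)

lemma l_disp: "x \<in> X \<Longrightarrow> j \<le> n \<Longrightarrow> [l (disp d x) = l x + d x] (mod int p ^ j)"
  by (simp add: disp_def cong_l_pt)

lemma l_shift: "x \<in> X \<Longrightarrow> j \<le> n \<Longrightarrow> [l (shift a x) = l x + a] (mod int p ^ j)"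
  unfolding shift_def by (rule l_disp)

lemma disp_eqI:
  assumes "f \<in> Bij X" "\<And>x. x \<in> X \<Longrightarrow> [l (f x) = l x + d x] (mod int p ^ n)"
  shows "f = disp d"
proof
  fix x
  show "f x = disp d x"
  proof (cases "x \<in> X")
    case True
    then show ?thesis
      using assms l_disp[of x n d] Bij_app[of f X x] by (intro cong_eq) (auto simp: cong_def)
  next
    case False
    then show ?thesis using assms(1) by (simp add: Bij_def extensional_def disp_def)
  qed
qed

text \<open>
  \<open>key_map k f\<close> says that \<open>f\<close> maps \<open>X\<close> to itself and that for each \<open>i\<close> the displacement \<open>f x - x\<close>
  modulo \<open>p\<^sup>i\<close> only depends on \<open>x\<close> modulo \<open>p\<^bsup>k i\<^esup>\<close>. It is stated through
  differences \<open>f x - f y\<close>, and without extensionality, so that it also applies to the iterates \<open>f ^^ m\<close>.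
\<close>

definition key_map :: "(nat \<Rightarrow> nat) \<Rightarrow> ('a \<Rightarrow> 'a) \<Rightarrow> bool" where
  "key_map k f \<longleftrightarrow> f ` X \<subseteq> X \<and> (\<forall>i\<in>{1..n}. \<forall>x\<in>X. \<forall>y\<in>X. [l x = l y] (mod int p ^ k i) \<longrightarrow>
      [l (f x) - l (f y) = l x - l y] (mod int p ^ i))"

text \<open>For a primary key \<open>k\<close> and the standard labelling, this is the group \<open>\<Pi>(k)\<close>.\<close>

definition key_perms :: "(nat \<Rightarrow> nat) \<Rightarrow> ('a \<Rightarrow> 'a) set" where
  "key_perms k = {f \<in> Bij X. key_map k f}"

lemma key_mapD:
  "key_map k f \<Longrightarrow> i \<in> {1..n} \<Longrightarrow> x \<in> X \<Longrightarrow> y \<in> X \<Longrightarrow> [l x = l y] (mod int p ^ k i) \<Longrightarrow>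
    [l (f x) - l (f y) = l x - l y] (mod int p ^ i)"
  unfolding key_map_def by blast

lemma key_map_in: "key_map k f \<Longrightarrow> x \<in> X \<Longrightarrow> f x \<in> X"
  unfolding key_map_def by blast

text \<open>
  The two conditions on a primary key are kept apart: \<open>valid_key\<close> suffices for \<open>key_perms k\<close> to be a
  group, while monotonicity (\<open>mono_key\<close> below) is needed to describe its generators.
\<close>

definition valid_key :: "(nat \<Rightarrow> nat) \<Rightarrow> bool" where
  "valid_key k \<longleftrightarrow> (\<forall>i\<in>{1..n}. k i < i)"

lemma valid_keyD: "valid_key k \<Longrightarrow> i \<in> {1..n} \<Longrightarrow> k i < i"
  unfolding valid_key_def by blast

lemma key_map_preserves:
  assumes "valid_key k" "key_map k f" "j \<le> n" "x \<in> X" "y \<in> X" "[l x = l y] (mod int p ^ j)"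
  shows "[l (f x) = l (f y)] (mod int p ^ j)"
proof (cases "j = 0")
  case False
  then have j: "j \<in> {1..n}" using assms by simp
  then have "k j < j" by (rule valid_keyD[OF assms(1)])
  then have "[l x = l y] (mod int p ^ k j)" using assms(6) cong_le by simp
  then have "[l (f x) - l (f y) = l x - l y] (mod int p ^ j)" using key_mapD assms j by blast
  moreover have "[l x - l y = 0] (mod int p ^ j)" using assms(6) by (simp add: cong_diff_iff_cong_0)
  ultimately show ?thesis using cong_diff_iff_cong_0 cong_trans by blast
qed simp

lemma key_map_reflects:
  assumes k: "valid_key k" "key_map k f" and x: "x \<in> X" "y \<in> X"
  shows "j \<le> n \<Longrightarrow> [l (f x) = l (f y)] (mod int p ^ j) \<Longrightarrow> [l x = l y] (mod int p ^ j)"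
proof (induction j)
  case (Suc j)
  then have j: "Suc j \<in> {1..n}" by simp
  have "k (Suc j) \<le> j" using valid_keyD[OF k(1) j] by simp
  moreover have "[l x = l y] (mod int p ^ j)" using Suc cong_le[of _ _ "Suc j" j] by simp
  ultimately have "[l x = l y] (mod int p ^ k (Suc j))" using cong_le by blast
  then have "[l (f x) - l (f y) = l x - l y] (mod int p ^ Suc j)" by (rule key_mapD[OF k(2) j x])
  then have "[l x - l y = l (f x) - l (f y)] (mod int p ^ Suc j)" by (rule cong_sym)
  moreover have "[l (f x) - l (f y) = 0] (mod int p ^ Suc j)"
    using Suc.prems by (simp add: cong_diff_iff_cong_0)
  ultimately have "[l x - l y = 0] (mod int p ^ Suc j)" by (rule cong_trans)
  then show ?case by (simp only: cong_diff_iff_cong_0)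
qed simp

lemma key_map_Bij:
  assumes "valid_key k" "key_map k f" "f \<in> extensional X"
  shows "f \<in> key_perms k"
proof -
  have "inj_on f X"
    using key_map_reflects[OF assms(1,2), of _ _ n] by (intro inj_onI cong_eq) auto
  then show ?thesis
    unfolding key_perms_def using assms key_map_in by (simp add: BijI_finite finite_X)
qed

lemma key_map_comp:
  assumes "valid_key k" "key_map k f" "key_map k g"
  shows "key_map k (\<lambda>x. f (g x))"
  unfolding key_map_def
proof (intro conjI ballI impI)
  show "(\<lambda>x. f (g x)) ` X \<subseteq> X" using assms key_map_in by auto
  fix i x y assume i: "i \<in> {1..n}" and x: "x \<in> X" "y \<in> X" and c: "[l x = l y] (mod int p ^ k i)"
  have gx: "g x \<in> X" "g y \<in> X" using assms x key_map_in by auto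
  have "k i \<le> n" using i valid_keyD[OF assms(1) i] by simp
  then have "[l (g x) = l (g y)] (mod int p ^ k i)"
    using key_map_preserves[OF assms(1,3)] x c by blast
  then have "[l (f (g x)) - l (f (g y)) = l (g x) - l (g y)] (mod int p ^ i)"
    using key_mapD[OF assms(2) i gx] by blast
  also have "[l (g x) - l (g y) = l x - l y] (mod int p ^ i)"
    using key_mapD[OF assms(3) i x c] by blast
  finally show "[l (f (g x)) - l (f (g y)) = l x - l y] (mod int p ^ i)" .
qed

lemma key_map_cong: "(\<And>x. x \<in> X \<Longrightarrow> f x = g x) \<Longrightarrow> key_map k f \<Longrightarrow> key_map k g"
  unfolding key_map_def by (auto simp: image_subset_iff)

lemma key_map_id: "key_map k (\<lambda>x. x)" unfolding key_map_def by simp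

lemma subgroup_key_perms:
  assumes "valid_key k"
  shows "subgroup (key_perms k) (BijGroup X)"
proof (rule perm_subgroupI_finite[OF finite_X])
  show "key_perms k \<subseteq> Bij X" by (auto simp: key_perms_def)
  show "(\<lambda>x\<in>X. x) \<in> key_perms k"
    using key_map_cong[OF _ key_map_id, of "\<lambda>x\<in>X. x"] by (simp add: key_perms_def id_Bij)
  fix f g assume fg: "f \<in> key_perms k" "g \<in> key_perms k"
  have "key_map k (compose X f g)"
    by (rule key_map_cong[OF _ key_map_comp[OF assms, of f g]])
      (use fg in \<open>auto simp: key_perms_def compose_eq\<close>)
  then show "compose X f g \<in> key_perms k" using fg by (simp add: key_perms_def compose_Bij)
qed

lemma disp_key_map:
  assumes "\<And>i x y. i \<in> {1..n} \<Longrightarrow> x \<in> X \<Longrightarrow> y \<in> X \<Longrightarrow> [l x = l y] (mod int p ^ k i) \<Longrightarrow>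
      [d x = d y] (mod int p ^ i)"
  shows "key_map k (disp d)"
  unfolding key_map_def
proof (intro conjI ballI impI)
  fix i x y assume i: "i \<in> {1..n}" and x: "x \<in> X" "y \<in> X" and c: "[l x = l y] (mod int p ^ k i)"
  have "[l (disp d x) - l (disp d y) = (l x + d x) - (l y + d y)] (mod int p ^ i)"
    using i x l_disp by (intro cong_diff) auto
  also have "[(l x + d x) - (l y + d y) = (l x - l y) + (d x - d y)] (mod int p ^ i)"
    by (simp add: algebra_simps)
  also have "[(l x - l y) + (d x - d y) = (l x - l y) + 0] (mod int p ^ i)"
    using assms[OF i x c] by (intro cong_add) (auto simp: cong_diff_iff_cong_0)
  finally show "[l (disp d x) - l (disp d y) = l x - l y] (mod int p ^ i)" by simp
qed (auto simp: disp_def)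

lemma disp_key_perms:
  assumes "valid_key k"
   and "\<And>i x y. i \<in> {1..n} \<Longrightarrow> x \<in> X \<Longrightarrow> y \<in> X \<Longrightarrow> [l x = l y] (mod int p ^ k i) \<Longrightarrow>
      [d x = d y] (mod int p ^ i)"
  shows "disp d \<in> key_perms k"
  by (rule key_map_Bij[OF assms(1) disp_key_map[OF assms(2)]]) (auto simp: disp_def)

lemma shift_key_perms: "valid_key k \<Longrightarrow> shift a \<in> key_perms k"
  unfolding shift_def by (rule disp_key_perms) auto

text \<open>
  Restricting an element to \<open>E\<close> can only violate the condition on pairs of points of which exactly
  one lies in \<open>E\<close>. The set \<open>E\<close> need not be invariant: the third assumption replaces this.
\<close>

lemma perm_restrict_key_perms:
  assumes k: "valid_key k" and g: "g \<in> key_perms k"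
    and key: "\<And>i x y. i \<in> {1..n} \<Longrightarrow> x \<in> X \<Longrightarrow> x \<in> E \<Longrightarrow> y \<in> X \<Longrightarrow> y \<notin> E \<Longrightarrow>
      [l x = l y] (mod int p ^ k i) \<Longrightarrow> [l (g x) = l x] (mod int p ^ i)"
  shows "perm_restrict X g E \<in> key_perms k"
proof (rule key_map_Bij[OF k])
  have gk: "key_map k g" using g by (simp add: key_perms_def)
  show "perm_restrict X g E \<in> extensional X" by (simp add: perm_restrict_def)
  show "key_map k (perm_restrict X g E)"
    unfolding key_map_def
  proof (intro conjI ballI impI)
    show "perm_restrict X g E ` X \<subseteq> X" using key_map_in[OF gk] by (auto simp: perm_restrict_def)
    fix i x y assume i: "i \<in> {1..n}" and x: "x \<in> X" and y: "y \<in> X"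
      and c: "[l x = l y] (mod int p ^ k i)"
    consider "x \<in> E \<longleftrightarrow> y \<in> E" | "x \<in> E" "y \<notin> E" | "x \<notin> E" "y \<in> E" by blast
    then show "[l (perm_restrict X g E x) - l (perm_restrict X g E y) = l x - l y] (mod int p ^ i)"
    proof cases
      case 1
      then show ?thesis using key_mapD[OF gk i x y c] x y by (auto simp: perm_restrict_def)
    next
      case 2
      then show ?thesis
        using cong_diff[OF key[OF i x 2(1) y 2(2) c] cong_refl[of "l y"]] x y
        by (simp add: perm_restrict_def)
    next
      case 3
      then show ?thesis
        using cong_diff[OF cong_refl[of "l x"] key[OF i y 3(2) x 3(1) cong_sym[OF c]]] x y
        by (simp add: perm_restrict_def)
    qed
  qed
qed

text \<open>
  The largest primary key \<open>(0, 1, \<dots>, n-1)\<close>. The group \<open>key_perms full_key\<close> is a Sylow \<open>p\<close>-subgroup of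
  the symmetric group on \<open>X\<close>; below it is only shown to be a \<open>p\<close>-group that contains every \<open>p\<close>-group
  with \<open>shift 1\<close> as an element.
\<close>

definition full_key :: "nat \<Rightarrow> nat" where "full_key i = i - 1"

lemma valid_full_key: "valid_key full_key" by (auto simp: valid_key_def full_key_def)

lemma key_map_funpow: "valid_key k \<Longrightarrow> key_map k f \<Longrightarrow> key_map k (f ^^ m)"
proof (induction m)
  case 0
  then show ?case using key_map_id by (simp add: id_def)
next
  case (Suc m)
  then show ?case using key_map_comp[of k f "f ^^ m"] by (simp add: o_def)
qed

text \<open>
  An element of \<open>key_perms full_key\<close> acts on the classes modulo \<open>p\<^bsup>j+1\<^esup>\<close> inside one class modulo \<open>p\<^sup>j\<close>
  as a translation, if it fixes that class; hence its order divides \<open>p\<^sup>n\<close>.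
\<close>

lemma full_key_torsion:
  assumes f: "key_map full_key f" and x: "x \<in> X"
  shows "j \<le> n \<Longrightarrow> [l ((f ^^ (p ^ j)) x) = l x] (mod int p ^ j)"
proof (induction j)
  case (Suc j)
  define g where "g = f ^^ (p ^ j)"
  have g: "key_map full_key g" unfolding g_def by (rule key_map_funpow[OF valid_full_key f])
  define c where "c = l (g x) - l x"
  have gx: "[l (g x) = l x] (mod int p ^ j)" using Suc by (simp add: g_def)
  then have "int p ^ j dvd c" by (simp add: c_def cong_iff_dvd_diff)
  then have pc: "[int p * c = 0] (mod int p ^ Suc j)" by (simp add: cong_0_iff)
  have gm: "(g ^^ m) x \<in> X" for m
    using key_map_in[OF key_map_funpow[OF valid_full_key g] x] .
  have "[l ((g ^^ m) x) = l x + int m * c] (mod int p ^ Suc j)" for m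
  proof (induction m)
    case (Suc m)
    have "[l x + int m * c = l x + int m * 0] (mod int p ^ j)"
      using \<open>int p ^ j dvd c\<close> by (intro cong_add cong_mult) (auto simp: cong_0_iff)
    then have "[l ((g ^^ m) x) = l x] (mod int p ^ j)"
      using Suc cong_le[of _ _ "Suc j" j] by (metis add.right_neutral cong_trans le_add2 mult_zero_right plus_1_eq_Suc)
    then have "[l (g ((g ^^ m) x)) - l (g x) = l ((g ^^ m) x) - l x] (mod int p ^ Suc j)"
      using key_mapD[OF g, of "Suc j" "(g ^^ m) x" x] gm x \<open>Suc j \<le> n\<close> by (simp add: full_key_def)
    from cong_add[OF this Suc] show ?case
      by (simp add: c_def cong_iff_dvd_diff algebra_simps)
  qed simp
  from this[of p] have "[l ((g ^^ p) x) = l x + int p * c] (mod int p ^ Suc j)" .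
  also have "[l x + int p * c = l x + 0] (mod int p ^ Suc j)" by (rule cong_add[OF cong_refl pc])
  finally show ?case by (simp add: g_def funpow_mult mult.commute)
qed simp

lemma subgroup_full_key_prime_power:
  assumes Q: "subgroup Q (BijGroup X)" "Q \<subseteq> key_perms full_key"
  shows "\<exists>s. card Q = p ^ s"
proof -
  interpret Q: group "perm_grp X Q" by (rule perm_subgroup_group[OF Q(1)])
  have "finite Q" using Q(2) finite_Bij[OF finite_X] by (auto simp: key_perms_def intro: finite_subset)
  moreover have "g [^]\<^bsub>perm_grp X Q\<^esub> (p ^ n) = \<one>\<^bsub>perm_grp X Q\<^esub>" if g: "g \<in> Q" for g
  proof -
    have gB: "g \<in> Bij X" "key_map full_key g" using g Q by (auto simp: key_perms_def)
    have "g [^]\<^bsub>BijGroup X\<^esub> (p ^ n) = \<one>\<^bsub>BijGroup X\<^esub>"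
    proof (rule Bij_eqI)
      show "g [^]\<^bsub>BijGroup X\<^esub> (p ^ n) \<in> Bij X"
        using monoid.nat_pow_closed[OF group.is_monoid[OF group_BijGroup]] gB by force
      show "\<one>\<^bsub>BijGroup X\<^esub> \<in> Bij X" by (simp add: BijGroup_one id_Bij)
      fix x assume x: "x \<in> X"
      have "(g ^^ (p ^ n)) x = x"
        using full_key_torsion[OF gB(2) x, of n] key_map_in[OF key_map_funpow[OF valid_full_key gB(2)] x] x
        by (intro cong_eq) auto
      then show "(g [^]\<^bsub>BijGroup X\<^esub> (p ^ n)) x = \<one>\<^bsub>BijGroup X\<^esub> x"
        using x gB by (simp add: BijGroup_pow_apply BijGroup_one)
    qed
    then show ?thesis by (simp add: perm_grp_pow)
  qed
  ultimately show ?thesis using Q.card_eq_prime_power[of p n] prime_p by (simp add: order_def)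
qed

end

section \<open>Two congruences modulo prime powers\<close>

lemma fermat_power_cong:
  assumes "prime (p::nat)"
  shows "[(a::int) ^ (p ^ s) = a] (mod int p)"
proof (induction s)
  case (Suc s)
  have fermat: "[b ^ p = b] (mod int p)" for b :: int
  proof -
    define c where "c = nat (b mod int p)"
    have p0: "int p > 0" using assms prime_gt_0_nat by simp
    then have bc: "[b = int c] (mod int p)" by (simp add: c_def cong_def)
    have "[c ^ p = c] (mod p)"
    proof (cases "p dvd c")
      case True
      then have "p dvd c ^ p" using p0 dvd_trans[OF True dvd_power[of p c]] by simp
      then show ?thesis using True by (simp add: cong_def dvd_eq_mod_eq_0)
    next
      case False
      have "[c ^ (p - 1) * c = 1 * c] (mod p)"
        by (rule cong_mult[OF fermat_theorem[OF assms False] cong_refl])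
      moreover have "c ^ (p - 1) * c = c ^ p" using p0 by (simp flip: power_Suc2)
      ultimately show ?thesis by simp
    qed
    then have "[int c ^ p = int c] (mod int p)" by (metis cong_int_iff of_nat_power)
    then show ?thesis using bc cong_pow[OF bc, of p] by (metis cong_sym cong_trans)
  qed
  have "a ^ (p ^ Suc s) = (a ^ (p ^ s)) ^ p" by (simp add: mult.commute flip: power_mult)
  then show ?case using fermat[of "a ^ (p ^ s)"] Suc cong_trans by metis
qed simp

text \<open>
  For \<open>b \<equiv> 1\<close> modulo an odd prime \<open>p\<close>, the sum \<open>1 + b + \<dots> + b\<^bsup>p-1\<^esup>\<close> is divisible by \<open>p\<close> exactly once,
  so that \<open>b\<^sup>p - 1\<close> contains only one more factor \<open>p\<close> than \<open>b - 1\<close>.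
\<close>

lemma cong_one_of_power_cong_one:
  assumes p: "prime (p::nat)" "p \<ge> 3" and b: "[b = 1] (mod int p)"
    and bp: "[b ^ p = 1] (mod int p ^ Suc m)"
  shows "[b = 1] (mod int p ^ m)"
proof -
  obtain c where c: "b = 1 + int p * c"
    using b by (metis cong_iff_lin cong_sym)
  have pw: "\<exists>w. b ^ j = 1 + int j * int p * c + (int p)\<^sup>2 * w" for j
  proof (induction j)
    case 0
    show ?case by (rule exI[of _ 0]) simp
  next
    case (Suc j)
    then obtain w where "b ^ j = 1 + int j * int p * c + (int p)\<^sup>2 * w" by blast
    then have "b ^ Suc j = 1 + int (Suc j) * int p * c + (int p)\<^sup>2 * (w * b + int j * c\<^sup>2)"
      by (simp add: c algebra_simps power2_eq_square)
    then show ?case by blast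
  qed
  then obtain w where w: "\<And>j. b ^ j = 1 + int j * int p * c + (int p)\<^sup>2 * w j" by metis
  have "odd p" using p prime_odd_nat by simp
  then obtain k where k: "p = 2 * k + 1" by (elim oddE)
  have "2 * (\<Sum>j<p. int j) = int p * (int p - 1)"
  proof -
    have "2 * (\<Sum>j<m. int j) = int m * (int m - 1)" for m
      by (induction m) (simp_all add: algebra_simps)
    then show ?thesis .
  qed
  then have sj: "(\<Sum>j<p. int j) = int p * int k" using k by simp
  have "(\<Sum>j<p. b ^ j) = int p + (\<Sum>j<p. int j) * (int p * c) + (int p)\<^sup>2 * (\<Sum>j<p. w j)"
    unfolding w by (simp add: sum.distrib sum_distrib_left sum_distrib_right mult.assoc)
  also have "\<dots> = int p * (1 + int p * (int k * c + (\<Sum>j<p. w j)))"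
    unfolding sj by (simp add: algebra_simps power2_eq_square)
  finally obtain v where v: "(\<Sum>j<p. b ^ j) = int p * (1 + int p * v)" by blast
  have "b ^ p - 1 = int p * ((b - 1) * (1 + int p * v))"
    unfolding power_diff_1_eq v by (simp only: mult.left_commute)
  then have "int p ^ Suc m dvd int p * ((b - 1) * (1 + int p * v))"
    using bp by (simp only: cong_iff_dvd_diff)
  then have "int p ^ m dvd (b - 1) * (1 + int p * v)"
    using p by (simp add: prime_gt_0_nat)
  moreover have "gcd (int p) (1 + int p * v) = 1"
    using gcd_add_mult[of "int p" v 1] by (simp add: ac_simps)
  then have "coprime (int p ^ m) (1 + int p * v)"
    by (intro coprime_power_left_iff[THEN iffD2] disjI1) (simp only: coprime_iff_gcd_eq_1)
  ultimately have "int p ^ m dvd b - 1" by (simp add: coprime_dvd_mult_left_iff)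
  then show ?thesis by (simp add: cong_iff_dvd_diff)
qed

context cyclic_labelling
begin

section \<open>The \<open>p\<close>-groups that contain the cyclic shift\<close>

lemma shift_mult_mem:
  assumes "subgroup P (BijGroup X)" "shift 1 \<in> P"
  shows "shift a \<in> P"
proof -
  have nat: "shift (int m) \<in> P" for m
  proof (induction m)
    case 0
    have "shift 0 = (\<lambda>x\<in>X. x)" by (auto simp: shift_def disp_def)
    then show ?case using perm_subgroup_id[OF assms(1)] by (simp only: of_nat_0)
  next
    case (Suc m)
    have "compose X (shift 1) (shift (int m)) = shift (int (Suc m))"
      unfolding shift_def
    proof (rule disp_eqI)
      show "compose X (disp (\<lambda>x. 1)) (disp (\<lambda>x. int m)) \<in> Bij X"
        using assms Suc perm_subgroup_mem compose_Bij shift_def by metis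
      fix x assume x: "x \<in> X"
      have "[l (disp (\<lambda>x. 1) (disp (\<lambda>x. int m) x)) = l (disp (\<lambda>x. int m) x) + 1] (mod int p ^ n)"
        using x by (intro l_disp) auto
      also have "[l (disp (\<lambda>x. int m) x) + 1 = (l x + int m) + 1] (mod int p ^ n)"
        using x by (intro cong_add l_disp) auto
      finally show "[l (compose X (disp (\<lambda>x. 1)) (disp (\<lambda>x. int m)) x) = l x + int (Suc m)] (mod int p ^ n)"
        using x by (simp add: compose_eq algebra_simps)
    qed
    then show ?case using perm_subgroup_compose[OF assms Suc] by simp
  qed
  have "shift a = shift (int (nat (a mod int p ^ n)))"
    unfolding shift_def disp_def using pow_pos
    by (intro restrict_ext) (auto simp: pt_eq_iff cong_def mod_add_right_eq)
  then show ?thesis using nat by metis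
qed

text \<open>
  If \<open>g (x + b) = g x + b'\<close> modulo \<open>p\<^sup>j\<close> for the multiples \<open>x\<close> of \<open>p\<^sup>e\<close>, then
  \<open>g (y + m b) = g y + m b'\<close>. The case \<open>e = 0\<close> concerns all points.
\<close>

lemma equivariant_iterate:
  assumes R: "\<And>x y. x \<in> X \<Longrightarrow> y \<in> X \<Longrightarrow> [l x = l y] (mod int p ^ j) \<Longrightarrow>
      [l (g x) = l (g y)] (mod int p ^ j)"
    and je: "j \<le> n" "e \<le> n" and b: "int p ^ e dvd b"
    and eq: "\<And>x. x \<in> X \<Longrightarrow> int p ^ e dvd l x \<Longrightarrow> [l (g (shift b x)) = l (g x) + b'] (mod int p ^ j)"
    and y: "y \<in> X" "int p ^ e dvd l y"
  shows "x \<in> X \<Longrightarrow> [l x = l y + int m * b] (mod int p ^ j) \<Longrightarrow>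
    [l (g x) = l (g y) + int m * b'] (mod int p ^ j)"
proof (induction m arbitrary: x)
  case 0
  then show ?case using R y by simp
next
  case (Suc m)
  define z where "z = pt (l y + int m * b)"
  have z: "z \<in> X" by (simp add: z_def)
  have lz: "[l z = l y + int m * b] (mod int p ^ j)" unfolding z_def by (rule cong_l_pt[OF je(1)])
  have "[l z = l y + int m * b] (mod int p ^ e)" unfolding z_def by (rule cong_l_pt[OF je(2)])
  then have ze: "int p ^ e dvd l z" using y(2) b by (simp add: cong_dvd_iff)
  have "[l (shift b z) = l z + b] (mod int p ^ j)" by (rule l_shift[OF z je(1)])
  also have "[l z + b = (l y + int m * b) + b] (mod int p ^ j)" by (rule cong_add[OF lz cong_refl])
  also have "(l y + int m * b) + b = l y + int (Suc m) * b" by (simp add: algebra_simps)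
  also have "[l y + int (Suc m) * b = l x] (mod int p ^ j)" using Suc.prems cong_sym by blast
  finally have "[l (g x) = l (g (shift b z))] (mod int p ^ j)"
    using R Suc.prems z by (intro R) (auto intro: cong_sym)
  also have "[l (g (shift b z)) = l (g z) + b'] (mod int p ^ j)" by (rule eq[OF z ze])
  also have "[l (g z) + b' = (l (g y) + int m * b') + b'] (mod int p ^ j)"
    by (rule cong_add[OF Suc.IH[OF z lz] cong_refl])
  finally show ?case by (simp add: algebra_simps)
qed

text \<open>
  Assume that \<open>P\<close> acts on the residue classes modulo \<open>p\<^sup>j\<close>. The shift \<open>t\<close> by \<open>p\<^bsup>j-1\<^esup>\<close> commutes with this
  action. Otherwise some \<open>g\<close> outside of the centralizer \<open>D\<close> of \<open>t\<close> in \<open>P\<close> conjugates \<open>shift 1\<close> into \<open>D\<close>;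
  the conjugate of \<open>t\<close> under the inverse \<open>h\<close> of \<open>g\<close> then commutes with \<open>shift 1\<close>, hence is a translation
  of order dividing \<open>p\<close>, that is, a power \<open>t\<^sup>a\<close>. As the order of \<open>h\<close> is a power of \<open>p\<close>, Fermat's theorem
  gives \<open>a \<equiv> 1\<close> modulo \<open>p\<close>, so that \<open>h\<close> and therefore \<open>g\<close> do centralize \<open>t\<close>.
\<close>

lemma p_group_level:
  assumes P: "subgroup P (BijGroup X)" "shift 1 \<in> P" "card P = p ^ s" and j: "j \<in> {1..n}"
    and R: "\<And>g x y. g \<in> P \<Longrightarrow> x \<in> X \<Longrightarrow> y \<in> X \<Longrightarrow> [l x = l y] (mod int p ^ j) \<Longrightarrow>
      [l (g x) = l (g y)] (mod int p ^ j)"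
    and f: "f \<in> P" "x \<in> X" "y \<in> X" "[l x = l y] (mod int p ^ (j - 1))"
  shows "[l (f x) - l (f y) = l x - l y] (mod int p ^ j)"
proof -
  define q where "q = int p ^ (j - 1)"
  have jn: "j \<le> n" using j by simp
  have pq: "int p ^ j = int p * q" using j by (simp add: q_def flip: power_Suc)
  have q0: "q > 0" unfolding q_def by (rule pow_pos)
  define t where "t = shift q"
  have t: "x \<in> X \<Longrightarrow> t x \<in> X" "x \<in> X \<Longrightarrow> [l (t x) = l x + q] (mod int p ^ j)" for x
    unfolding t_def using l_shift[OF _ jn] by auto
  have PX: "g x \<in> X" if "g \<in> P" "x \<in> X" for g x
    by (rule perm_subgroup_app[OF P(1) that])
  define D where "D = {g \<in> P. \<forall>x\<in>X. [l (g (t x)) = l (g x) + q] (mod int p ^ j)}"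
  have D: "subgroup D (BijGroup X)"
  proof (rule perm_subgroupI_finite[OF finite_X])
    show "D \<subseteq> Bij X" using P(1) perm_subgroup_mem by (auto simp: D_def)
    show "(\<lambda>x\<in>X. x) \<in> D" using perm_subgroup_id[OF P(1)] t by (simp add: D_def)
    fix g h assume gh: "g \<in> D" "h \<in> D"
    have "[l (g (h (t x))) = l (g (h x)) + q] (mod int p ^ j)" if x: "x \<in> X" for x
    proof -
      have hP: "h \<in> P" "g \<in> P" using gh by (auto simp: D_def)
      have "[l (h (t x)) = l (h x) + q] (mod int p ^ j)" using gh x by (auto simp: D_def)
      also have "[l (h x) + q = l (t (h x))] (mod int p ^ j)"
        using t(2)[OF PX[OF hP(1) x]] cong_sym by blast
      finally have "[l (g (h (t x))) = l (g (t (h x)))] (mod int p ^ j)"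
        by (rule R[OF hP(2) PX[OF hP(1) t(1)[OF x]] t(1)[OF PX[OF hP(1) x]]])
      also have "[l (g (t (h x))) = l (g (h x)) + q] (mod int p ^ j)"
        using gh PX[OF hP(1) x] by (auto simp: D_def)
      finally show ?thesis .
    qed
    moreover have "compose X g h \<in> P"
      using gh by (intro perm_subgroup_compose[OF P(1)]) (auto simp: D_def)
    ultimately show "compose X g h \<in> D" using t by (simp add: D_def compose_eq)
  qed
  have sD: "shift 1 \<in> D"
  proof -
    have "[l (shift 1 (t x)) = l (shift 1 x) + q] (mod int p ^ j)" if x: "x \<in> X" for x
    proof -
      have "[l (shift 1 (t x)) = l (t x) + 1] (mod int p ^ j)" by (rule l_shift[OF t(1)[OF x] jn])
      also have "[l (t x) + 1 = (l x + q) + 1] (mod int p ^ j)"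
        by (rule cong_add[OF t(2)[OF x] cong_refl])
      also have "(l x + q) + 1 = (l x + 1) + q" by simp
      also have "[(l x + 1) + q = l (shift 1 x) + q] (mod int p ^ j)"
        by (rule cong_add[OF cong_sym[OF l_shift[OF x jn]] cong_refl])
      finally show ?thesis .
    qed
    then show ?thesis using P(2) by (simp add: D_def)
  qed
  have "D = P"
  proof (rule ccontr)
    assume "D \<noteq> P"
    interpret P: group "perm_grp X P" by (rule perm_subgroup_group[OF P(1)])
    have DP: "subgroup D (perm_grp X P)"
      by (rule perm_subgroup_mono[OF D P(1)]) (auto simp: D_def)
    obtain g where g: "g \<in> P" "g \<notin> D"
      and conj: "g \<otimes>\<^bsub>perm_grp X P\<^esub> shift 1 \<otimes>\<^bsub>perm_grp X P\<^esub> inv\<^bsub>perm_grp X P\<^esub> g \<in> D"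
      by (rule P.conj_in_proper_subgroup[OF _ prime_p DP _ sD, of s])
        (use P(3) \<open>D \<noteq> P\<close> in \<open>auto simp: order_def\<close>)
    define h where "h = inv\<^bsub>BijGroup X\<^esub> g"
    define u where "u = g \<otimes>\<^bsub>BijGroup X\<^esub> shift 1 \<otimes>\<^bsub>BijGroup X\<^esub> h"
    have gB: "g \<in> Bij X" "shift 1 \<in> Bij X" using g P perm_subgroup_mem by auto
    have hP: "h \<in> P" unfolding h_def by (rule perm_subgroup_inv[OF P(1) g(1)])
    have hB: "h \<in> Bij X" using hP P perm_subgroup_mem by auto
    have uD: "u \<in> D"
      using conj perm_grp_inv[OF P(1) g(1)] by (simp add: u_def h_def)
    have hg: "h (g x) = x" "g (h x) = x" if "x \<in> X" for x
      unfolding h_def using BijGroup_inv_apply[OF gB(1) that] by auto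
    have "g \<otimes>\<^bsub>BijGroup X\<^esub> shift 1 \<in> Bij X"
      using gB by (simp add: BijGroup_mult compose_Bij)
    then have u: "u x = g (shift 1 (h x))" if "x \<in> X" for x
      unfolding u_def using that gB hB by (simp add: BijGroup_mult_apply Bij_app)
    \<comment> \<open>The displacement of \<open>h y\<close> under the conjugate of \<open>t\<close>; it does not depend on \<open>y\<close>.\<close>
    define c where "c y = l (h (t y)) - l (h y)" for y
    have cstep: "[c (g (shift 1 z)) = c (g z)] (mod int p ^ j)" if z: "z \<in> X" for z
    proof -
      define y where "y = g z"
      have y: "y \<in> X" "h y = z" using PX[OF g(1) z] hg z by (auto simp: y_def)
      have uy: "u y = g (shift 1 z)" using u y by simp
      have "u \<in> P" using uD by (simp add: D_def)
      then have uX: "u x \<in> X" if "x \<in> X" for x by (rule PX[OF _ that])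
      have "[l (u (t y)) = l (u y) + q] (mod int p ^ j)" using uD y by (auto simp: D_def)
      also have "[l (u y) + q = l (t (u y))] (mod int p ^ j)" using t(2) uX y cong_sym by blast
      finally have "[l (h (t (u y))) = l (h (u (t y)))] (mod int p ^ j)"
        by (rule R[OF hP t(1)[OF uX[OF y(1)]] uX[OF t(1)[OF y(1)]] cong_sym])
      also have "h (u (t y)) = shift 1 (h (t y))"
        using u[OF t(1)[OF y(1)]] hg(1) PX[OF hP t(1)[OF y(1)]] by simp
      also have "[l (shift 1 (h (t y))) = l (h (t y)) + 1] (mod int p ^ j)"
        by (rule l_shift[OF PX[OF hP t(1)[OF y(1)]] jn])
      finally have 1: "[l (h (t (u y))) = l (h (t y)) + 1] (mod int p ^ j)" .
      have 2: "[l (h (u y)) = l (h y) + 1] (mod int p ^ j)"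
        unfolding uy y(2) using l_shift[OF z jn] hg(1)[of "shift 1 z"] z by simp
      from cong_diff[OF 1 2] show ?thesis unfolding c_def uy[symmetric] y_def[symmetric] by simp
    qed
    define b where "b = c (g (pt 0))"
    have cm: "[c (g (pt (int m))) = b] (mod int p ^ j)" for m
    proof (induction m)
      case (Suc m)
      have "shift 1 (pt (int m)) = pt (int (Suc m))"
        by (simp add: shift_def disp_def pt_eq_iff l_pt cong_def mod_simps algebra_simps)
      then show ?case using cstep[of "pt (int m)"] Suc cong_trans by fastforce
    qed (simp add: b_def)
    have cy: "[c y = b] (mod int p ^ j)" if y: "y \<in> X" for y
    proof -
      have "pt (int (nat (l (h y)))) = h y"
        using l_range[OF PX[OF hP y]] PX[OF hP y] by simp
      then show ?thesis using cm[of "nat (l (h y))"] hg(2)[OF y] by simp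
    qed
    have hb: "[l (h (t y)) = l (h y) + b] (mod int p ^ j)" if "y \<in> X" for y
      using cong_add[OF cong_refl[of "l (h y)"] cy[OF that]] by (simp add: c_def)
    have "[l (h (pt 0)) = l (h (pt 0)) + int p * b] (mod int p ^ j)"
    proof (rule equivariant_iterate[where g=h and e=0 and b=q])
      show "[l (h (shift q x)) = l (h x) + b] (mod int p ^ j)" if "x \<in> X" for x
        using hb[OF that] by (simp add: t_def)
    qed (use R[OF hP] jn in \<open>auto simp: cong_iff_dvd_diff pq\<close>)
    then have "int p * q dvd int p * b" unfolding pq by (simp add: cong_iff_dvd_diff)
    then have "q dvd b" using p_pos by simp
    then obtain a0 where a0: "b = q * a0" by blast
    define a where "a = nat (a0 mod int p)"
    have a: "int a = a0 mod int p" unfolding a_def using p_pos by simp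
    have "[int a * q = b] (mod int p ^ j)"
      unfolding a0 pq a by (simp add: cong_def mod_mult_mult2 mult.commute flip: mult_mod_right)
    then have ha: "[l (h (t y)) = l (h y) + int a * q] (mod int p ^ j)" if "y \<in> X" for y
      using hb[OF that] by (metis cong_add_lcancel cong_sym cong_trans)
    have hiter: "[l (h x) = l (h y) + int m * (int a * q)] (mod int p ^ j)"
      if "x \<in> X" "y \<in> X" "[l x = l y + int m * q] (mod int p ^ j)" for x y m
    proof (rule equivariant_iterate[where g=h and e=0 and b=q])
      show "[l (h (shift q x)) = l (h x) + int a * q] (mod int p ^ j)" if "x \<in> X" for x
        using ha[OF that] by (simp add: t_def)
    qed (use R[OF hP] jn that in auto)
    have hr: "(h ^^ r) y \<in> X" if "y \<in> X" for r y
      using that by (induction r) (auto intro: PX[OF hP])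
    have har: "[l ((h ^^ r) (t y)) = l ((h ^^ r) y) + int (a ^ r) * q] (mod int p ^ j)"
      if y: "y \<in> X" for y r
    proof (induction r)
      case 0
      then show ?case using t(2)[OF y] by simp
    next
      case (Suc r)
      have "[l (h ((h ^^ r) (t y))) = l (h ((h ^^ r) y)) + int (a ^ r) * (int a * q)] (mod int p ^ j)"
        by (rule hiter[OF hr[OF t(1)[OF y]] hr[OF y] Suc])
      then show ?case by (simp add: algebra_simps)
    qed
    have "h [^]\<^bsub>perm_grp X P\<^esub> order (perm_grp X P) = \<one>\<^bsub>perm_grp X P\<^esub>"
      using P.pow_order_eq_1[of h] hP by simp
    then have "h [^]\<^bsub>BijGroup X\<^esub> (p ^ s) = \<one>\<^bsub>BijGroup X\<^esub>"
      using P(3) by (simp add: order_def perm_grp_pow)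
    then have hid: "(h ^^ (p ^ s)) y = y" if "y \<in> X" for y
      using BijGroup_pow_apply[OF hB that, of "p ^ s"] that by (simp add: BijGroup_one)
    have "[l (t (pt 0)) = l (pt 0) + int (a ^ (p ^ s)) * q] (mod int p ^ j)"
      using har[of "pt 0" "p ^ s"] t(1) by (simp add: hid)
    with cong_sym[OF t(2)[OF pt_in]]
    have "[l (pt 0) + q = l (pt 0) + int (a ^ (p ^ s)) * q] (mod int p ^ j)"
      by (rule cong_trans)
    then have "int p * q dvd (1 - int (a ^ (p ^ s))) * q"
      unfolding pq by (simp add: cong_iff_dvd_diff algebra_simps)
    then have "[1 = int a ^ (p ^ s)] (mod int p)"
      using q0 by (simp add: cong_iff_dvd_diff)
    from cong_trans[OF this fermat_power_cong[OF prime_p]] have "[int a = 1] (mod int p)"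
      by (rule cong_sym)
    then have "[int a * q = q] (mod int p ^ j)"
      unfolding pq by (auto simp: cong_iff_dvd_diff dvd_def algebra_simps)
    then have "[l (h y) + int a * q = l (h y) + q] (mod int p ^ j)" for y
      by (rule cong_add[OF cong_refl])
    from cong_trans[OF ha this] have "h \<in> D" using hP by (simp add: D_def)
    then have "inv\<^bsub>BijGroup X\<^esub> h \<in> D" by (rule perm_subgroup_inv[OF D])
    then show False
      using g(2) group.inv_inv[OF group_BijGroup, of g X] gB by (simp add: h_def)
  qed
  then have "f \<in> D" using f(1) by simp
  then have fD: "[l (f (shift q x)) = l (f x) + q] (mod int p ^ j)" if "x \<in> X" for x
    using that unfolding t_def[symmetric] by (simp add: D_def)
  obtain m0 where m0: "l x - l y = q * m0" using f(4) unfolding q_def by (auto simp: cong_iff_dvd_diff)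
  define m where "m = nat (m0 mod int p)"
  have "int m = m0 mod int p" unfolding m_def using p_pos by simp
  then have m: "[int m * q = l x - l y] (mod int p ^ j)"
    unfolding m0 pq by (simp add: cong_def mod_mult_mult2 mult.commute flip: mult_mod_right)
  have "[l x = l y + int m * q] (mod int p ^ j)"
    using cong_add[OF cong_refl[of "l y"] cong_sym[OF m]] by simp
  then have "[l (f x) = l (f y) + int m * q] (mod int p ^ j)"
    by (intro equivariant_iterate[where g=f and e=0 and b=q]) (use f fD jn R[OF f(1)] in auto)
  then have "[l (f x) - l (f y) = int m * q] (mod int p ^ j)"
    by (simp add: cong_iff_dvd_diff algebra_simps)
  then show ?thesis using m cong_trans by blast
qed

text \<open>
  The action on the residue classes modulo \<open>p\<^sup>j\<close> is established for \<open>j = n, n-1, \<dots>\<close>: once the shift by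
  \<open>p\<^bsup>j-1\<^esup>\<close> is central modulo \<open>p\<^sup>j\<close>, its orbits, the classes modulo \<open>p\<^bsup>j-1\<^esup>\<close>, are permuted.
\<close>

theorem p_group_full_key:
  assumes P: "subgroup P (BijGroup X)" "shift 1 \<in> P" "card P = p ^ s"
  shows "P \<subseteq> key_perms full_key"
proof -
  have R: "j \<le> n \<Longrightarrow> \<forall>g\<in>P. \<forall>x\<in>X. \<forall>y\<in>X. [l x = l y] (mod int p ^ j) \<longrightarrow>
      [l (g x) = l (g y)] (mod int p ^ j)" for j
  proof (induction rule: inc_induct)
    case base
    then show ?case using cong_eq by (metis cong_refl)
  next
    case (step j)
    show ?case
    proof (intro ballI impI)
      fix g x y assume g: "g \<in> P" "x \<in> X" "y \<in> X" "[l x = l y] (mod int p ^ j)"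
      have "[l (g x) - l (g y) = l x - l y] (mod int p ^ Suc j)"
        by (rule p_group_level[OF P]) (use step g in auto)
      then have "[l (g x) - l (g y) = l x - l y] (mod int p ^ j)" using cong_le by (metis le_add2 plus_1_eq_Suc)
      moreover have "[l x - l y = 0] (mod int p ^ j)" using g by (simp add: cong_diff_iff_cong_0)
      ultimately show "[l (g x) = l (g y)] (mod int p ^ j)"
        using cong_diff_iff_cong_0 cong_trans by blast
    qed
  qed
  show ?thesis
  proof
    fix f assume f: "f \<in> P"
    have fB: "f \<in> Bij X" using f P perm_subgroup_mem by blast
    have "key_map full_key f"
      unfolding key_map_def full_key_def
    proof (intro conjI ballI impI)
      show "f ` X \<subseteq> X" using fB Bij_image by blast
      fix i x y assume i: "i \<in> {1..n}" "x \<in> X" "y \<in> X" "[l x = l y] (mod int p ^ (i - 1))"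
      show "[l (f x) - l (f y) = l x - l y] (mod int p ^ i)"
        by (rule p_group_level[OF P i(1) _ f i(2-4)]) (use R i in auto)
    qed
    then show "f \<in> key_perms full_key" using fB by (simp add: key_perms_def)
  qed
qed


lemma full_key_preserves:
  "g \<in> key_perms full_key \<Longrightarrow> j \<le> n \<Longrightarrow> x \<in> X \<Longrightarrow> y \<in> X \<Longrightarrow> [l x = l y] (mod int p ^ j) \<Longrightarrow>
    [l (g x) = l (g y)] (mod int p ^ j)"
  by (rule key_map_preserves[OF valid_full_key]) (auto simp: key_perms_def)

lemma shift_pt: "shift a (pt b) = pt (b + a)"
  by (simp add: shift_def disp_def pt_eq_iff l_pt cong_def mod_simps)

text \<open>
  If \<open>f0\<close> moves two points that agree modulo \<open>p\<^sup>e\<close> by different amounts modulo \<open>p\<^sup>i\<close>, then the group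
  contains an element that acts on the multiples of \<open>p\<^sup>e\<close>, modulo \<open>p\<^sup>i\<close>, as the multiplication by
  \<open>1 + u p\<^bsup>i-1-e\<^esup>\<close>. To see this, compare the setwise stabilizer \<open>Q\<close> of the multiples of \<open>p\<^sup>e\<close> with the
  subgroup \<open>A\<close> of elements that act on them as translations. An element of \<open>Q\<close> outside of \<open>A\<close> that
  conjugates the shift by \<open>p\<^sup>e\<close> into \<open>A\<close> acts as an affine map, with a factor \<open>\<beta>\<close> of \<open>p\<close>-power order, and
  the last nontrivial power \<open>B\<close> among the \<open>\<beta>\<close> to the \<open>p\<^sup>r\<close> is as claimed. This fails for \<open>p = 2\<close>, where
  \<open>\<beta> = -1\<close> is possible.
\<close>

lemma level_multiplier:
  assumes p3: "p \<ge> 3" and P: "subgroup P (BijGroup X)" "P \<subseteq> key_perms full_key" "shift 1 \<in> P"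
    and i: "i \<in> {1..n}" "e < i"
    and f0: "f0 \<in> P" "x0 \<in> X" "y0 \<in> X" "[l x0 = l y0] (mod int p ^ e)"
      "\<not> [l (f0 x0) - l (f0 y0) = l x0 - l y0] (mod int p ^ i)"
  shows "\<exists>f\<in>P. \<exists>u. \<not> int p dvd u \<and> (\<forall>x\<in>X. int p ^ e dvd l x \<longrightarrow>
    [l (f x) = l x + int p ^ (i - 1) * u * (l x div int p ^ e)] (mod int p ^ i))"
proof -
  have en: "e \<le> n" and i_le: "i \<le> n" using i by auto
  define E where "E x \<longleftrightarrow> x \<in> X \<and> int p ^ e dvd l x" for x
  have PX: "g x \<in> X" if "g \<in> P" "x \<in> X" for g x by (rule perm_subgroup_app[OF P(1) that])
  have Ppres: "[l (g x) = l (g y)] (mod int p ^ j)"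
    if "g \<in> P" "j \<le> n" "x \<in> X" "y \<in> X" "[l x = l y] (mod int p ^ j)" for g x y j
    by (rule full_key_preserves[OF subsetD[OF P(2) that(1)] that(2-)])
  have sP: "shift a \<in> P" for a by (rule shift_mult_mem[OF P(1,3)])
  have E0: "E (pt 0)" by (simp add: E_def l_pt)
  have EX: "x \<in> X" if "E x" for x using that by (simp add: E_def)
  define Q where "Q = {g \<in> P. \<forall>x. E x \<longrightarrow> E (g x)}"
  have QI: "g \<in> Q" if "g \<in> P" "E (g (pt 0))" for g
  proof -
    have "E (g x)" if "E x" for x
    proof -
      have "[l x = l (pt 0)] (mod int p ^ e)" using \<open>E x\<close> E0 by (auto simp: E_def cong_iff_dvd_diff)
      then have "[l (g x) = l (g (pt 0))] (mod int p ^ e)"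
        by (rule Ppres[OF \<open>g \<in> P\<close> en EX[OF \<open>E x\<close>] pt_in])
      then show ?thesis using \<open>E (g (pt 0))\<close> PX[OF \<open>g \<in> P\<close> EX[OF \<open>E x\<close>]]
        by (simp add: E_def cong_dvd_iff)
    qed
    then show ?thesis using that(1) by (simp add: Q_def)
  qed
  have comp: "compose X g h x = g (h x)" if "E x" for g h x using EX[OF that] by (simp add: compose_eq)
  have Q: "subgroup Q (BijGroup X)"
  proof (rule perm_subgroupI_finite[OF finite_X])
    show "Q \<subseteq> Bij X" using perm_subgroup_mem[OF P(1)] by (auto simp: Q_def)
    show "(\<lambda>x\<in>X. x) \<in> Q" using perm_subgroup_id[OF P(1)] EX by (simp add: Q_def)
    fix g h assume gh: "g \<in> Q" "h \<in> Q"
    then have "compose X g h \<in> P" by (intro perm_subgroup_compose[OF P(1)]) (auto simp: Q_def)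
    then show "compose X g h \<in> Q" using gh by (auto simp: Q_def comp)
  qed
  define A where "A = {g \<in> Q. \<exists>b. \<forall>x. E x \<longrightarrow> [l (g x) = l x + b] (mod int p ^ i)}"
  have A: "subgroup A (BijGroup X)"
  proof (rule perm_subgroupI_finite[OF finite_X])
    show "A \<subseteq> Bij X" using perm_subgroup_mem[OF Q] by (auto simp: A_def)
    show "(\<lambda>x\<in>X. x) \<in> A"
      using perm_subgroup_id[OF Q] EX by (auto simp: A_def intro!: exI[of _ 0])
    fix g h assume g: "g \<in> A" and h: "h \<in> A"
    from g obtain b where b: "\<And>x. E x \<Longrightarrow> [l (g x) = l x + b] (mod int p ^ i)" by (auto simp: A_def)
    from h obtain b' where b': "\<And>x. E x \<Longrightarrow> [l (h x) = l x + b'] (mod int p ^ i)" by (auto simp: A_def)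
    have "[l (compose X g h x) = l x + (b + b')] (mod int p ^ i)" if "E x" for x
    proof -
      have "E (h x)" using h that by (simp add: A_def Q_def)
      then have "[l (g (h x)) = l (h x) + b] (mod int p ^ i)" by (rule b)
      also have "[l (h x) + b = (l x + b') + b] (mod int p ^ i)"
        by (rule cong_add[OF b'[OF that] cong_refl])
      finally show ?thesis unfolding comp[OF that] by (simp add: algebra_simps)
    qed
    then show "compose X g h \<in> A"
      using g h perm_subgroup_compose[OF Q] unfolding A_def by blast
  qed
  have "A \<subseteq> Q" by (auto simp: A_def)
  have AQ: "A \<noteq> Q"
  proof
    assume "A = Q"
    \<comment> \<open>Normalize \<open>f0\<close> by translations such that \<open>y0\<close> and its image become the point \<open>0\<close>.\<close>
    define f1 where "f1 = compose X (shift (- l (f0 y0))) (compose X f0 (shift (l y0)))"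
    have f1: "f1 x = shift (- l (f0 y0)) (f0 (shift (l y0) x))" if "x \<in> X" for x
      using that by (simp add: f1_def compose_eq)
    have f1P: "f1 \<in> P" unfolding f1_def using sP f0 by (intro perm_subgroup_compose[OF P(1)]) auto
    have f10: "f1 (pt 0) = pt 0"
      using f0(3) PX[OF f0(1,3)] by (simp add: f1 shift_pt) (simp add: shift_def disp_def)
    then have "f1 \<in> A" using QI[OF f1P] E0 \<open>A = Q\<close> by simp
    then obtain b where b: "\<And>x. E x \<Longrightarrow> [l (f1 x) = l x + b] (mod int p ^ i)" by (auto simp: A_def)
    have "[l (pt 0) + 0 = l (pt 0) + b] (mod int p ^ i)" using b[OF E0] f10 by simp
    then have b0: "[b = 0] (mod int p ^ i)" unfolding cong_add_lcancel by (rule cong_sym)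
    define x where "x = pt (l x0 - l y0)"
    have "int p ^ e dvd l x0 - l y0" using f0(4) by (simp add: cong_iff_dvd_diff)
    then have "E x" unfolding E_def x_def using cong_dvd_iff[OF cong_l_pt[OF en]] by simp
    have "f1 x = shift (- l (f0 y0)) (f0 x0)" using f0(2) by (simp add: f1 x_def shift_pt)
    then have "[l (f0 x0) + - l (f0 y0) = l (f1 x)] (mod int p ^ i)"
      using l_shift[OF PX[OF f0(1,2)] i_le] cong_sym by metis
    also have "[l (f1 x) = l x + b] (mod int p ^ i)" by (rule b[OF \<open>E x\<close>])
    also have "[l x + b = (l x0 - l y0) + 0] (mod int p ^ i)"
      unfolding x_def by (rule cong_add[OF cong_l_pt[OF i_le] b0])
    finally show False using f0(5) by simp
  qed
  have qE: "shift (int p ^ e) \<in> Q" by (rule QI[OF sP]) (simp add: E_def shift_pt l_pt dvd_mod_iff le_imp_power_dvd en)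
  have qA: "shift (int p ^ e) \<in> A" using qE l_shift[OF EX i_le] by (auto simp: A_def)
  interpret Q: group "perm_grp X Q" by (rule perm_subgroup_group[OF Q])
  have "Q \<subseteq> key_perms full_key" using P(2) by (auto simp: Q_def)
  then obtain s where s: "card Q = p ^ s" using subgroup_full_key_prime_power[OF Q] by blast
  obtain g where g: "g \<in> Q" "g \<notin> A" and conj: "g \<otimes>\<^bsub>perm_grp X Q\<^esub> shift (int p ^ e)
      \<otimes>\<^bsub>perm_grp X Q\<^esub> inv\<^bsub>perm_grp X Q\<^esub> g \<in> A"
    by (rule Q.conj_in_proper_subgroup[OF _ prime_p perm_subgroup_mono[OF A Q \<open>A \<subseteq> Q\<close>] _ qA, of s])
      (use s AQ in \<open>auto simp: order_def\<close>)
  define v where "v = g \<otimes>\<^bsub>BijGroup X\<^esub> shift (int p ^ e) \<otimes>\<^bsub>BijGroup X\<^esub> inv\<^bsub>BijGroup X\<^esub> g"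
  have gP: "g \<in> P" using g(1) by (simp add: Q_def)
  have gB: "g \<in> Bij X" by (rule perm_subgroup_mem[OF P(1) gP])
  have sB: "shift (int p ^ e) \<in> Bij X" by (rule perm_subgroup_mem[OF P(1) sP])
  have vA: "v \<in> A" using conj perm_grp_inv[OF Q g(1)] by (simp add: v_def)
  have gsB: "g \<otimes>\<^bsub>BijGroup X\<^esub> shift (int p ^ e) \<in> Bij X"
    using gB sB by (simp add: BijGroup_mult compose_Bij)
  have v: "v (g x) = g (shift (int p ^ e) x)" if x: "x \<in> X" for x
    unfolding v_def
    using BijGroup_mult_apply[OF gsB BijGroup_inv_Bij[OF gB] Bij_app[OF gB x]]
      BijGroup_mult_apply[OF gB sB x] BijGroup_inv_apply(1)[OF gB x] by simp
  obtain b where b: "\<And>x. E x \<Longrightarrow> [l (v x) = l x + b] (mod int p ^ i)" using vA by (auto simp: A_def)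
  have pe: "int p ^ e dvd b"
  proof -
    have "E (v (pt 0))" using vA E0 by (simp add: A_def Q_def)
    moreover have "[l (v (pt 0)) = l (pt 0) + b] (mod int p ^ e)"
      using cong_le[OF b[OF E0]] i(2) by simp
    ultimately show ?thesis by (simp add: E_def cong_dvd_iff l_pt)
  qed
  then obtain \<beta> where \<beta>: "b = int p ^ e * \<beta>" by blast
  have gE: "E (g x)" if "E x" for x using g(1) that by (simp add: Q_def)
  have gl: "[l (g x) = l (g (pt 0)) + \<beta> * l x] (mod int p ^ i)" if x: "E x" for x
  proof -
    define m where "m = nat (l x div int p ^ e)"
    have m: "l x = int m * int p ^ e"
      using x l_range[of x] pow_pos[of e] by (auto simp: m_def E_def pos_imp_zdiv_nonneg_iff)
    have "[l (g x) = l (g (pt 0)) + int m * b] (mod int p ^ i)"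
    proof (rule equivariant_iterate[where g=g and e=e and b="int p ^ e"])
      show "[l (g (shift (int p ^ e) z)) = l (g z) + b] (mod int p ^ i)"
        if "z \<in> X" "int p ^ e dvd l z" for z
        using b[OF gE[of z]] v[OF that(1)] that by (simp add: E_def)
      show "[l x = l (pt 0) + int m * int p ^ e] (mod int p ^ i)" by (simp add: m l_pt)
      show "[l (g x) = l (g y)] (mod int p ^ i)"
        if "x \<in> X" "y \<in> X" "[l x = l y] (mod int p ^ i)" for x y
        by (rule Ppres[OF gP i_le that])
    qed (use i_le en E0 EX[OF x] in \<open>auto simp: E_def\<close>)
    then show ?thesis by (simp add: m \<beta> algebra_simps)
  qed
  define h where "h = compose X (shift (- l (g (pt 0)))) g"
  have hP: "h \<in> P" unfolding h_def by (rule perm_subgroup_compose[OF P(1) sP gP])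
  have hl: "[l (h x) = \<beta> * l x] (mod int p ^ i)" if x: "E x" for x
  proof -
    have "[l (h x) = l (g x) + - l (g (pt 0))] (mod int p ^ i)"
      using l_shift[OF PX[OF gP EX[OF x]] i_le, of "- l (g (pt 0))"]
      by (simp add: h_def compose_eq EX[OF x])
    also have "[l (g x) + - l (g (pt 0)) = (l (g (pt 0)) + \<beta> * l x) + - l (g (pt 0))] (mod int p ^ i)"
      by (rule cong_add[OF gl[OF x] cong_refl])
    finally show ?thesis by simp
  qed
  have hE: "E (h x)" if x: "E x" for x
    using cong_dvd_iff[OF cong_le[OF hl[OF x], of e]] x PX[OF hP EX[OF x]] i(2) by (simp add: E_def)
  have hr: "E ((h ^^ r) x) \<and> [l ((h ^^ r) x) = \<beta> ^ r * l x] (mod int p ^ i)" if x: "E x" for x r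
  proof (induction r)
    case (Suc r)
    then have "[l (h ((h ^^ r) x)) = \<beta> * l ((h ^^ r) x)] (mod int p ^ i)" using hl by blast
    also have "[\<beta> * l ((h ^^ r) x) = \<beta> * (\<beta> ^ r * l x)] (mod int p ^ i)"
      using Suc by (intro cong_mult) auto
    finally show ?case using Suc hE by (simp add: mult.assoc)
  qed (use x in simp)
  define w where "w = i - 1 - e"
  have ipow: "int p ^ i = int p ^ Suc w * int p ^ e" "int p ^ (i - 1) = int p ^ w * int p ^ e"
    using i(2) by (simp_all add: w_def flip: power_add power_Suc)
  have l1: "E (pt (int p ^ e))" "[l (pt (int p ^ e)) = int p ^ e] (mod int p ^ i)"
    by (simp_all add: E_def l_pt dvd_mod_iff le_imp_power_dvd en cong_l_pt[OF i_le, unfolded l_pt])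
  have "key_map full_key h" using hP P(2) by (auto simp: key_perms_def)
  from full_key_torsion[OF this pt_in[of "int p ^ e"], of n]
  have "(h ^^ (p ^ n)) (pt (int p ^ e)) = pt (int p ^ e)"
    using hr[OF l1(1)] EX by (intro cong_eq) auto
  then have "[l (pt (int p ^ e)) = \<beta> ^ (p ^ n) * l (pt (int p ^ e))] (mod int p ^ i)"
    using hr[OF l1(1), of "p ^ n"] by simp
  from cong_trans[OF cong_trans[OF cong_sym[OF l1(2)] this] cong_mult[OF cong_refl l1(2)]]
  have "int p ^ Suc w * int p ^ e dvd (1 - \<beta> ^ (p ^ n)) * int p ^ e"
    unfolding ipow by (simp add: cong_iff_dvd_diff algebra_simps)
  then have "[1 = \<beta> ^ (p ^ n)] (mod int p ^ Suc w)"
    using pow_pos[of e] unfolding cong_iff_dvd_diff by (subst (asm) dvd_mult_cancel_right) auto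
  then have \<beta>n: "[\<beta> ^ (p ^ n) = 1] (mod int p ^ Suc w)" by (rule cong_sym)
  have \<beta>1: "[\<beta> = 1] (mod int p)"
    using cong_le[OF \<beta>n, of 1] fermat_power_cong[OF prime_p, of \<beta> n] cong_sym cong_trans by fastforce
  have \<beta>0: "\<not> [\<beta> ^ (p ^ 0) = 1] (mod int p ^ Suc w)"
  proof
    assume "[\<beta> ^ (p ^ 0) = 1] (mod int p ^ Suc w)"
    then have d: "int p ^ Suc w dvd \<beta> - 1" by (simp add: cong_iff_dvd_diff)
    have "[l (g x) = l x + l (g (pt 0))] (mod int p ^ i)" if x: "E x" for x
    proof -
      have "int p ^ Suc w * int p ^ e dvd (\<beta> - 1) * l x"
        using d x by (intro mult_dvd_mono) (auto simp: E_def)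
      then have "[\<beta> * l x = l x] (mod int p ^ i)"
        unfolding ipow by (simp add: cong_iff_dvd_diff algebra_simps)
      from cong_trans[OF gl[OF x] cong_add[OF cong_refl this]] show ?thesis by (simp add: add.commute)
    qed
    then have "g \<in> A" using g(1) by (auto simp: A_def)
    then show False using g(2) by simp
  qed
  obtain r where r: "\<not> [\<beta> ^ (p ^ r) = 1] (mod int p ^ Suc w)" "[\<beta> ^ (p ^ Suc r) = 1] (mod int p ^ Suc w)"
    using ex_least_nat_less[of "\<lambda>r. [\<beta> ^ (p ^ r) = 1] (mod int p ^ Suc w)" n] \<beta>n \<beta>0 by blast
  define B where "B = \<beta> ^ (p ^ r)"
  have "[B = 1] (mod int p)" using cong_pow[OF \<beta>1, of "p ^ r"] by (simp add: B_def)
  moreover have "[B ^ p = 1] (mod int p ^ Suc w)"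
    using r(2) by (simp add: B_def mult.commute flip: power_mult)
  ultimately have "[B = 1] (mod int p ^ w)" by (rule cong_one_of_power_cong_one[OF prime_p p3])
  then obtain u where u: "B - 1 = int p ^ w * u" by (auto simp: cong_iff_dvd_diff)
  have pu: "\<not> int p dvd u"
  proof
    assume "int p dvd u"
    then have "int p ^ Suc w dvd B - 1" unfolding u by (simp add: mult.commute mult_dvd_mono)
    then show False using r(1) by (simp add: B_def cong_iff_dvd_diff)
  qed
  define f where "f = h [^]\<^bsub>BijGroup X\<^esub> (p ^ r)"
  have fP: "f \<in> P" unfolding f_def by (rule perm_subgroup_pow[OF P(1) hP])
  have "[l (f x) = l x + int p ^ (i - 1) * u * (l x div int p ^ e)] (mod int p ^ i)"
    if "x \<in> X" "int p ^ e dvd l x" for x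
  proof -
    have "[l (f x) = B * l x] (mod int p ^ i)"
      using hr[of x "p ^ r"] that BijGroup_pow_apply[OF perm_subgroup_mem[OF P(1) hP] that(1)]
      by (simp add: f_def B_def E_def)
    also have "B * l x = l x + (B - 1) * l x" by (simp add: algebra_simps)
    also have "(B - 1) * l x = int p ^ (i - 1) * u * (l x div int p ^ e)"
      unfolding u ipow using that(2) by (simp add: mult.assoc mult.left_commute)
    finally show ?thesis .
  qed
  then show ?thesis using fP pu by blast
qed

section \<open>Generators of the permutations with a given key\<close>

text \<open>The shift by \<open>p\<^bsup>i-1\<^esup>\<close>, restricted to the residue class of \<open>r\<close> modulo \<open>p\<^sup>k\<close>, where \<open>0 \<le> r < p\<^sup>k\<close>;
  for other \<open>r\<close> it is the identity.\<close>

definition residue_shift :: "nat \<Rightarrow> nat \<Rightarrow> int \<Rightarrow> 'a \<Rightarrow> 'a" where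
  "residue_shift i k r = disp (\<lambda>x. if l x mod int p ^ k = r then int p ^ (i - 1) else 0)"

lemma residue_shift_out_of_range:
  assumes "\<not> (0 \<le> r \<and> r < int p ^ k)"
  shows "residue_shift i k r = (\<lambda>x\<in>X. x)"
proof -
  have "l x mod int p ^ k \<noteq> r" for x using assms pow_pos[of k] by auto
  then show ?thesis by (auto simp: residue_shift_def disp_def fun_eq_iff)
qed

lemma compose_disp:
  assumes "k \<le> n" and d: "\<And>x y. x \<in> X \<Longrightarrow> y \<in> X \<Longrightarrow> [l x = l y] (mod int p ^ k) \<Longrightarrow> d x = d y"
    and d': "\<And>x. x \<in> X \<Longrightarrow> int p ^ k dvd d' x"
  shows "compose X (disp d) (disp d') = disp (\<lambda>x. d x + d' x)"
proof
  fix x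
  show "compose X (disp d) (disp d') x = disp (\<lambda>x. d x + d' x) x"
  proof (cases "x \<in> X")
    case True
    have "[l (disp d' x) = l x + d' x] (mod int p ^ k)" by (rule l_disp[OF True assms(1)])
    also have "[l x + d' x = l x + 0] (mod int p ^ k)"
      using d'[OF True] by (intro cong_add) (auto simp: cong_0_iff)
    finally have "[l (disp d' x) = l x] (mod int p ^ k)" by (simp only: add_0_right)
    then have "d (disp d' x) = d x" by (rule d[OF disp_in[OF True] True])
    moreover have "[l (disp d' x) = l x + d' x] (mod int p ^ n)" by (rule l_disp[OF True order_refl])
    then have "[l (disp d' x) + d x = (l x + d' x) + d x] (mod int p ^ n)"
      by (rule cong_add[OF _ cong_refl])
    ultimately show ?thesis using True
      by (simp add: compose_eq disp_def[of d] disp_def[of "\<lambda>x. d x + d' x"] pt_eq_iff algebra_simps)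
  qed (simp add: compose_def disp_def)
qed

lemma disp_zero: "disp (\<lambda>x. 0) = (\<lambda>x\<in>X. x)"
  by (auto simp: disp_def)

lemma residue_shifts_generate:
  assumes P: "subgroup P (BijGroup X)" and k: "k \<le> i - 1" "i \<le> n"
    and gen: "\<And>r. residue_shift i k r \<in> P"
  shows "disp (\<lambda>x. int p ^ (i - 1) * int (c (l x mod int p ^ k))) \<in> P"
proof -
  have kn: "k \<le> n" using k by simp
  have pk: "int p ^ k dvd int p ^ (i - 1) * z" for z
    using le_imp_power_dvd[OF k(1), of "int p"] by (rule dvd_mult2)
  have single: "disp (\<lambda>x. if l x mod int p ^ k = r then int p ^ (i - 1) * int m else 0) \<in> P" for r m
  proof (induction m)
    case 0
    show ?case using perm_subgroup_id[OF P] by (simp only: disp_zero of_nat_0 mult_zero_right if_cancel)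
  next
    case (Suc m)
    have "compose X (residue_shift i k r)
        (disp (\<lambda>x. if l x mod int p ^ k = r then int p ^ (i - 1) * int m else 0))
      = disp (\<lambda>x. (if l x mod int p ^ k = r then int p ^ (i - 1) else 0) +
          (if l x mod int p ^ k = r then int p ^ (i - 1) * int m else 0))"
      unfolding residue_shift_def by (rule compose_disp[OF kn]) (use pk in \<open>auto simp: cong_def simp del: One_nat_def\<close>)
    also have "\<dots> = disp (\<lambda>x. if l x mod int p ^ k = r then int p ^ (i - 1) * int (Suc m) else 0)"
      by (rule arg_cong[where f=disp]) (auto simp: algebra_simps)
    finally show ?case using perm_subgroup_compose[OF P gen[of r] Suc] by (simp only:)
  qed
  have "disp (\<lambda>x. if l x mod int p ^ k \<in> R then int p ^ (i - 1) * int (c (l x mod int p ^ k)) else 0) \<in> P"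
    if "finite R" for R
    using that
  proof induction
    case empty
    show ?case using perm_subgroup_id[OF P] by (simp only: disp_zero empty_iff if_False)
  next
    case (insert r R)
    have "compose X (disp (\<lambda>x. if l x mod int p ^ k = r then int p ^ (i - 1) * int (c r) else 0))
        (disp (\<lambda>x. if l x mod int p ^ k \<in> R then int p ^ (i - 1) * int (c (l x mod int p ^ k)) else 0))
      = disp (\<lambda>x. (if l x mod int p ^ k = r then int p ^ (i - 1) * int (c r) else 0) +
          (if l x mod int p ^ k \<in> R then int p ^ (i - 1) * int (c (l x mod int p ^ k)) else 0))"
      by (rule compose_disp[OF kn]) (use pk in \<open>auto simp: cong_def simp del: One_nat_def\<close>)
    also have "\<dots> = disp (\<lambda>x. if l x mod int p ^ k \<in> insert r R
        then int p ^ (i - 1) * int (c (l x mod int p ^ k)) else 0)"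
      by (rule arg_cong[where f=disp]) (use insert in auto)
    finally show ?case using perm_subgroup_compose[OF P single[of r "c r"] insert.IH] by (simp only:)
  qed
  from this[of "{0..<int p ^ k}"] show ?thesis using pow_pos[of k] by simp
qed

text \<open>Monotonicity of a key on \<open>{1..n}\<close>.\<close>

definition mono_key :: "(nat \<Rightarrow> nat) \<Rightarrow> bool" where
  "mono_key k \<longleftrightarrow> (\<forall>i\<in>{1..n}. \<forall>j\<in>{1..n}. i \<le> j \<longrightarrow> k i \<le> k j)"

lemma disp_level_key_perms:
  assumes k: "valid_key k" "mono_key k" and i: "i \<in> {1..n}"
    and d: "\<And>x. x \<in> X \<Longrightarrow> int p ^ (i - 1) dvd d x"
    and dc: "\<And>x y. x \<in> X \<Longrightarrow> y \<in> X \<Longrightarrow> [l x = l y] (mod int p ^ k i) \<Longrightarrow> d x = d y"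
  shows "disp d \<in> key_perms k"
proof (rule disp_key_perms[OF k(1)])
  fix j x y assume j: "j \<in> {1..n}" and x: "x \<in> X" "y \<in> X" and c: "[l x = l y] (mod int p ^ k j)"
  show "[d x = d y] (mod int p ^ j)"
  proof (cases "j < i")
    case True
    then have "int p ^ j dvd int p ^ (i - 1)" by (intro le_imp_power_dvd) simp
    then have "int p ^ j dvd d x" "int p ^ j dvd d y" using d x dvd_trans by blast+
    then show ?thesis by (simp add: cong_iff_dvd_diff)
  next
    case False
    then have "k i \<le> k j" using k(2) i j by (simp add: mono_key_def)
    then have "d x = d y" by (intro dc x cong_le[OF c])
    then show ?thesis by simp
  qed
qed

text \<open>
  An element of \<open>key_perms k\<close> that is trivial modulo \<open>p\<^sup>i\<close> is a product of the generators of the levels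
  above \<open>i\<close>: split off one digit of the displacement after the other. For \<open>i = 0\<close> the triviality
  condition is void.
\<close>

lemma key_perms_generated:
  assumes k: "valid_key k" "mono_key k" and P: "subgroup P (BijGroup X)"
  shows "i \<le> n \<Longrightarrow> (\<And>j r. i < j \<Longrightarrow> j \<le> n \<Longrightarrow> residue_shift j (k j) r \<in> P) \<Longrightarrow>
    h \<in> key_perms k \<Longrightarrow> (\<And>x. x \<in> X \<Longrightarrow> [l (h x) = l x] (mod int p ^ i)) \<Longrightarrow> h \<in> P"
proof (induction arbitrary: h rule: inc_induct)
  case base
  have "h = (\<lambda>x\<in>X. x)"
  proof (rule Bij_eqI)
    show "h \<in> Bij X" using base by (simp add: key_perms_def)
    then show "h x = (\<lambda>x\<in>X. x) x" if "x \<in> X" for x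
      using that base(3)[OF that] by (simp add: cong_eq Bij_app)
  qed (rule id_Bij)
  then show ?case using perm_subgroup_id[OF P] by (simp only:)
next
  case (step j)
  define K where "K = k (Suc j)"
  have j: "Suc j \<in> {1..n}" using step by simp
  have K: "K \<le> j" using valid_keyD[OF k(1) j] by (simp add: K_def)
  have hB: "h \<in> Bij X" and hk: "key_map k h" using step.prems(2) by (auto simp: key_perms_def)
  \<comment> \<open>The displacement \<open>v r\<close> of a representative of each class modulo \<open>p\<^sup>K\<close>, and its digit \<open>c r\<close>.\<close>
  define v where "v r = l (h (pt r)) - l (pt r)" for r
  have vj: "int p ^ j dvd v r" for r
    using step.prems(3)[OF pt_in[of r]] by (simp add: v_def cong_iff_dvd_diff)
  define c where "c r = nat ((v r div int p ^ j) mod int p)" for r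
  define d where "d x = int p ^ j * int (c (l x mod int p ^ K))" for x
  have dP: "disp d \<in> P"
    unfolding d_def using residue_shifts_generate[OF P, of K "Suc j" c] step.prems(1)[of "Suc j"] K j
    by (simp add: K_def)
  have dk: "disp d \<in> key_perms k"
    by (rule disp_level_key_perms[OF k j]) (auto simp: d_def cong_def K_def)
  have dl: "[l (disp d x) = l (h x)] (mod int p ^ Suc j)" if x: "x \<in> X" for x
  proof -
    define r where "r = l x mod int p ^ K"
    have "[l x = r] (mod int p ^ K)" by (simp add: r_def cong_def)
    moreover have "[l (pt r) = r] (mod int p ^ K)" using K j by (intro cong_l_pt) simp
    ultimately have "[l x = l (pt r)] (mod int p ^ k (Suc j))"
      using cong_sym cong_trans unfolding K_def by blast
    then have hx: "[l (h x) - l (h (pt r)) = l x - l (pt r)] (mod int p ^ Suc j)"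
      by (rule key_mapD[OF hk j x pt_in])
    have "int (c r) = (v r div int p ^ j) mod int p" using p_pos by (simp add: c_def)
    then have "[int (c r) = v r div int p ^ j] (mod int p)" by (simp add: cong_def)
    then have "int p ^ j * int p dvd int p ^ j * (int (c r) - v r div int p ^ j)"
      by (simp add: cong_iff_dvd_diff)
    also have "int p ^ j * (int (c r) - v r div int p ^ j) = d x - v r"
      using vj[of r] by (simp add: d_def r_def[symmetric] right_diff_distrib)
    finally have "[d x = v r] (mod int p ^ Suc j)" by (simp add: cong_iff_dvd_diff mult.commute)
    from cong_add[OF this cong_sym[OF hx]] have "[l x + d x = l (h x)] (mod int p ^ Suc j)"
      by (simp add: v_def cong_iff_dvd_diff algebra_simps)
    moreover have "[l (disp d x) = l x + d x] (mod int p ^ Suc j)" using x j by (intro l_disp) auto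
    ultimately show ?thesis using cong_trans by blast
  qed
  define q where "q = inv\<^bsub>BijGroup X\<^esub> (disp d)"
  have ddk: "key_map k (disp d)" using dk by (simp add: key_perms_def)
  have Sjn: "Suc j \<le> n" using j by simp
  have dB: "disp d \<in> Bij X" by (rule perm_subgroup_mem[OF P dP])
  have qk: "q \<in> key_perms k" unfolding q_def by (rule perm_subgroup_inv[OF subgroup_key_perms[OF k(1)] dk])
  have qB: "q \<in> Bij X" unfolding q_def by (rule BijGroup_inv_Bij[OF dB])
  define h' where "h' = compose X q h"
  have h'k: "h' \<in> key_perms k" unfolding h'_def
    by (rule perm_subgroup_compose[OF subgroup_key_perms[OF k(1)] qk step.prems(2)])
  have h'B: "h' \<in> Bij X" unfolding h'_def by (rule compose_Bij[OF qB hB])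
  have dh': "disp d (h' x) = h x" if "x \<in> X" for x
    using that BijGroup_inv_apply(2)[OF dB Bij_app[OF hB that]] by (simp add: h'_def q_def compose_eq)
  have "h' \<in> P"
  proof (rule step.IH[OF _ h'k])
    show "residue_shift i (k i) r \<in> P" if "Suc j < i" "i \<le> n" for i r using step.prems(1) that by simp
    fix x assume x: "x \<in> X"
    have "[l (disp d (h' x)) = l (disp d x)] (mod int p ^ Suc j)"
      unfolding dh'[OF x] using dl[OF x] by (rule cong_sym)
    then show "[l (h' x) = l x] (mod int p ^ Suc j)"
      by (rule key_map_reflects[OF k(1) ddk Bij_app[OF h'B x] x Sjn])
  qed
  then have "compose X (disp d) h' \<in> P" by (rule perm_subgroup_compose[OF P dP])
  moreover have "compose X (disp d) h' = h"
    by (rule Bij_eqI[OF compose_Bij[OF dB h'B] hB]) (simp add: compose_eq dh')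
  ultimately show ?case by simp
qed

end

section \<open>Wreath stabilizers and normal block systems\<close>

lemma transitive_perm_grp_iff:
  "transitive_perm_grp X G \<longleftrightarrow> subgroup G (BijGroup X) \<and> (\<forall>x\<in>X. \<forall>y\<in>X. \<exists>g\<in>G. g x = y)"
proof -
  have "group_action (perm_grp X G) X (\<lambda>g. g)" if G: "subgroup G (BijGroup X)"
  proof -
    have "(\<lambda>g. g) \<in> hom (perm_grp X G) (BijGroup X)"
      using perm_subgroup_mem[OF G] by (auto simp: hom_def)
    then show ?thesis
      using perm_subgroup_group[OF G] group_BijGroup
      by (simp add: group_action_def group_hom_def group_hom_axioms_def)
  qed
  then show ?thesis
    by (auto simp: transitive_perm_grp_def transitive_action_def transitive_action_axioms_def)
qed

lemma perm_orbits_alt: "perm_orbits X G = (\<lambda>x. (\<lambda>g. g x) ` G) ` X"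
  by (auto simp: perm_orbits_def orbits_def orbit_def)

lemma induced_grp_trivial_iff:
  assumes "K \<noteq> {}"
  shows "induced_grp K B = {\<one>\<^bsub>BijGroup B\<^esub>} \<longleftrightarrow> (\<forall>\<kappa>\<in>K. \<forall>x\<in>B. \<kappa> x = x)"
proof -
  have r: "restrict \<kappa> B = \<one>\<^bsub>BijGroup B\<^esub> \<longleftrightarrow> (\<forall>x\<in>B. \<kappa> x = x)" for \<kappa>
    by (auto simp: BijGroup_one restrict_def fun_eq_iff)
  have "induced_grp K B = {\<one>\<^bsub>BijGroup B\<^esub>} \<longleftrightarrow> (\<forall>\<kappa>\<in>K. restrict \<kappa> B = \<one>\<^bsub>BijGroup B\<^esub>)"
    unfolding induced_grp_def using assms
    by (metis (mono_tags, lifting) image_constant_conv image_cong image_eqI singletonD)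
  then show ?thesis by (simp only: r)
qed

lemma induced_grp_transitive_iff:
  assumes X: "finite X" "B \<subseteq> X" and K: "subgroup K (BijGroup X)" "\<And>\<kappa>. \<kappa> \<in> K \<Longrightarrow> \<kappa> ` B = B"
  shows "transitive_perm_grp B (induced_grp K B) \<longleftrightarrow> (\<forall>x\<in>B. \<forall>y\<in>B. \<exists>\<kappa>\<in>K. \<kappa> x = y)"
proof -
  have fB: "finite B" using X finite_subset by blast
  have "subgroup (induced_grp K B) (BijGroup B)"
  proof (rule perm_subgroupI_finite[OF fB])
    show "induced_grp K B \<subseteq> Bij B"
    proof
      fix f assume "f \<in> induced_grp K B"
      then obtain \<kappa> where \<kappa>: "\<kappa> \<in> K" "f = restrict \<kappa> B" by (auto simp: induced_grp_def)
      have "inj_on \<kappa> B"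
        using Bij_inj[OF perm_subgroup_mem[OF K(1) \<kappa>(1)]] X(2) by (intro inj_onI) blast
      then have "inj_on f B" using \<kappa>(2) by (simp add: inj_on_def)
      moreover have "f x \<in> B" if "x \<in> B" for x using K(2)[OF \<kappa>(1)] that \<kappa>(2) by auto
      ultimately show "f \<in> Bij B" using \<kappa>(2) by (intro BijI_finite fB) auto
    qed
    have "(\<lambda>x\<in>B. x) = restrict (\<lambda>x\<in>X. x) B" using X(2) by (auto simp: restrict_def fun_eq_iff)
    then show "(\<lambda>x\<in>B. x) \<in> induced_grp K B"
      using perm_subgroup_id[OF K(1)] unfolding induced_grp_def by blast
    fix f g assume "f \<in> induced_grp K B" "g \<in> induced_grp K B"
    then obtain \<kappa> \<mu> where k: "\<kappa> \<in> K" "f = restrict \<kappa> B" "\<mu> \<in> K" "g = restrict \<mu> B"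
      by (auto simp: induced_grp_def)
    have "\<mu> x \<in> B" if "x \<in> B" for x using K(2)[OF k(3)] that by auto
    then have "compose B f g = restrict (compose X \<kappa> \<mu>) B"
      using X(2) k by (auto simp: compose_def restrict_def fun_eq_iff)
    then show "compose B f g \<in> induced_grp K B"
      using perm_subgroup_compose[OF K(1) k(1,3)] unfolding induced_grp_def by blast
  qed
  then show ?thesis unfolding transitive_perm_grp_iff by (simp add: induced_grp_def)
qed

text \<open>The condition on the wreath stabilizer, in terms of points instead of induced groups.\<close>

lemma wstab_cond_iff:
  assumes "finite X" "\<Union>\<B> \<subseteq> X"
  shows "wstab_cond X H \<B> B K \<longleftrightarrow> subgroup K (BijGroup X) \<and> K \<subseteq> fixer H \<B> \<and>
     (\<forall>\<kappa>\<in>K. \<forall>x\<in>B. \<kappa> x = x) \<and>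
     (\<forall>B'\<in>\<B>. (\<forall>\<kappa>\<in>K. \<forall>x\<in>B'. \<kappa> x = x) \<or> (\<forall>x\<in>B'. \<forall>y\<in>B'. \<exists>\<kappa>\<in>K. \<kappa> x = y))"
proof (cases "subgroup K (BijGroup X) \<and> K \<subseteq> fixer H \<B>")
  case True
  then have K: "subgroup K (BijGroup X)" "K \<noteq> {}" using perm_subgroup_id by blast+
  have t: "transitive_perm_grp B' (induced_grp K B') \<longleftrightarrow> (\<forall>x\<in>B'. \<forall>y\<in>B'. \<exists>\<kappa>\<in>K. \<kappa> x = y)"
    if "B' \<in> \<B>" for B'
  proof (rule induced_grp_transitive_iff[OF assms(1) _ K(1)])
    show "B' \<subseteq> X" using that assms(2) by blast
    show "\<kappa> ` B' = B'" if "\<kappa> \<in> K" for \<kappa>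
      using that \<open>B' \<in> \<B>\<close> True unfolding fixer_def by blast
  qed
  show ?thesis
    unfolding wstab_cond_def induced_grp_trivial_iff[OF K(2)] by (simp add: True t cong: ball_cong)
qed (auto simp: wstab_cond_def)

lemma WStab_trivial:
  assumes X: "finite X" "\<Union>\<B> \<subseteq> X" "B \<in> \<B>" and \<kappa>: "\<kappa> \<in> WStab X H \<B> B"
  shows "\<kappa> \<in> Bij X \<and> (\<forall>x\<in>B. \<kappa> x = x)"
  using \<kappa> unfolding WStab_def
proof (induction rule: generate.induct)
  case one
  have "B \<subseteq> X" using X by blast
  then have "\<forall>x\<in>B. (\<lambda>x\<in>X. x) x = x" by auto
  then show ?case unfolding BijGroup_one by (intro conjI id_Bij)
next
  case (incl h)
  then obtain K where "wstab_cond X H \<B> B K" "h \<in> K" by blast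
  then show ?case unfolding wstab_cond_iff[OF X(1,2)] using perm_subgroup_mem[of K X h] by simp
next
  case (inv h)
  then obtain K where K: "wstab_cond X H \<B> B K" "h \<in> K" by blast
  then have KB: "subgroup K (BijGroup X)" by (simp add: wstab_cond_def)
  have "inv\<^bsub>BijGroup X\<^esub> h \<in> K" by (rule perm_subgroup_inv[OF KB K(2)])
  then show ?case using K(1) perm_subgroup_mem[OF KB] unfolding wstab_cond_iff[OF X(1,2)] by simp
next
  case (eng f g)
  then have "f \<in> Bij X" "g \<in> Bij X" by auto
  moreover have "compose X f g x = x" if "x \<in> B" for x
  proof -
    have "x \<in> X" using that X by blast
    then show ?thesis using eng that by (simp add: compose_eq)
  qed
  ultimately show ?case by (simp add: BijGroup_mult compose_Bij)
qed

text \<open>Hence the wreath stabilizers of two blocks agree if and only if the same groups qualify for both.\<close>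

lemma WStab_eq_iff:
  assumes X: "finite X" "\<Union>\<B> \<subseteq> X" "B \<in> \<B>" "B' \<in> \<B>"
  shows "WStab X H \<B> B = WStab X H \<B> B' \<longleftrightarrow>
    (\<forall>K. wstab_cond X H \<B> B K \<longleftrightarrow> wstab_cond X H \<B> B' K)"
proof
  have *: "wstab_cond X H \<B> B2 K"
    if "WStab X H \<B> B1 = WStab X H \<B> B2" "B2 \<in> \<B>" "wstab_cond X H \<B> B1 K" for B1 B2 K
  proof -
    have "K \<subseteq> WStab X H \<B> B1"
      unfolding WStab_def using that(3) by (auto intro: generate.incl)
    then have "K \<subseteq> WStab X H \<B> B2" using that(1) by simp
    then have "\<forall>\<kappa>\<in>K. \<forall>x\<in>B2. \<kappa> x = x" using WStab_trivial[OF X(1,2) that(2)] by blast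
    then show ?thesis using that(3) unfolding wstab_cond_iff[OF X(1,2)] by blast
  qed
  show "WStab X H \<B> B = WStab X H \<B> B' \<Longrightarrow>
    \<forall>K. wstab_cond X H \<B> B K \<longleftrightarrow> wstab_cond X H \<B> B' K" using * X(3,4) by metis
qed (simp add: WStab_def)

text \<open>
  If \<open>K\<close> qualifies for the wreath stabilizer of \<open>h ` B\<close>, then its conjugate under the inverse of \<open>h\<close>
  qualifies for that of \<open>B\<close>.
\<close>

lemma wstab_cond_conj:
  assumes X: "finite X" "\<Union>\<B> \<subseteq> X" and H: "subgroup H (BijGroup X)" "h \<in> H"
    and inv: "\<And>B. B \<in> \<B> \<Longrightarrow> h ` B \<in> \<B>" and w: "wstab_cond X H \<B> (h ` B) K"
    and B: "B \<in> \<B>"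
  shows "wstab_cond X H \<B> B ((\<lambda>\<kappa>. compose X (inv\<^bsub>BijGroup X\<^esub> h) (compose X \<kappa> h)) ` K)"
proof -
  define h' where "h' = inv\<^bsub>BijGroup X\<^esub> h"
  define c where "c \<kappa> = compose X h' (compose X \<kappa> h)" for \<kappa>
  from w have K: "subgroup K (BijGroup X)" "K \<subseteq> fixer H \<B>" "\<And>\<kappa> x. \<kappa> \<in> K \<Longrightarrow> x \<in> B \<Longrightarrow> \<kappa> (h x) = h x"
    "\<And>B'. B' \<in> \<B> \<Longrightarrow> (\<forall>\<kappa>\<in>K. \<forall>x\<in>B'. \<kappa> x = x) \<or> (\<forall>x\<in>B'. \<forall>y\<in>B'. \<exists>\<kappa>\<in>K. \<kappa> x = y)"
    unfolding wstab_cond_iff[OF X] by blast+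
  have hB: "h \<in> Bij X" by (rule perm_subgroup_mem[OF H])
  have h'H: "h' \<in> H" unfolding h'_def by (rule perm_subgroup_inv[OF H])
  have h'B: "h' \<in> Bij X" by (rule perm_subgroup_mem[OF H(1) h'H])
  have hh: "h' (h x) = x" "h (h' x) = x" "h x \<in> X" "h' x \<in> X" if "x \<in> X" for x
    unfolding h'_def using BijGroup_inv_apply[OF hB that] Bij_app[OF hB that]
      Bij_app[OF h'B[unfolded h'_def] that] by auto
  have KH: "\<kappa> \<in> H" "\<kappa> ` B' = B'" if "\<kappa> \<in> K" "B' \<in> \<B>" for \<kappa> B'
    using K(2) that by (auto simp: fixer_def)
  have KB: "\<kappa> \<in> Bij X" if "\<kappa> \<in> K" for \<kappa> by (rule perm_subgroup_mem[OF K(1) that])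
  have c: "c \<kappa> x = h' (\<kappa> (h x))" if "x \<in> X" for \<kappa> x using that by (simp add: c_def compose_eq)
  have cH: "c \<kappa> \<in> H" if "\<kappa> \<in> K" for \<kappa>
    unfolding c_def using KH(1)[OF that B] H h'H by (intro perm_subgroup_compose[OF H(1)])
  have BX: "B' \<subseteq> X" if "B' \<in> \<B>" for B' using that X(2) by blast
  have 1: "subgroup (c ` K) (BijGroup X)"
  proof (rule perm_subgroupI_finite[OF X(1)])
    show "c ` K \<subseteq> Bij X" using cH perm_subgroup_mem[OF H(1)] by auto
    have "c (\<lambda>x\<in>X. x) = (\<lambda>x\<in>X. x)"
      by (auto simp: c hh fun_eq_iff) (simp add: c_def compose_def)
    then show "(\<lambda>x\<in>X. x) \<in> c ` K" using perm_subgroup_id[OF K(1)] by (metis imageI)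
    fix f g assume "f \<in> c ` K" "g \<in> c ` K"
    then obtain \<kappa> \<mu> where k: "\<kappa> \<in> K" "\<mu> \<in> K" "f = c \<kappa>" "g = c \<mu>" by blast
    have "compose X f g = c (compose X \<kappa> \<mu>)"
    proof (rule Bij_eqI[of _ X])
      have kB: "c \<kappa> \<in> Bij X" "c \<mu> \<in> Bij X" "c (compose X \<kappa> \<mu>) \<in> Bij X"
        by (rule perm_subgroup_mem[OF H(1) cH[OF k(1)]], rule perm_subgroup_mem[OF H(1) cH[OF k(2)]],
            rule perm_subgroup_mem[OF H(1) cH[OF perm_subgroup_compose[OF K(1) k(1,2)]]])
      then show "compose X f g \<in> Bij X" "c (compose X \<kappa> \<mu>) \<in> Bij X" using k by (auto intro: compose_Bij)
      fix x assume x: "x \<in> X"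
      show "compose X f g x = c (compose X \<kappa> \<mu>) x"
        using x k Bij_app[OF kB(2) x] Bij_app[OF KB[OF k(2)] hh(3)[OF x]]
        by (simp add: compose_eq c hh)
    qed
    then show "compose X f g \<in> c ` K" using perm_subgroup_compose[OF K(1) k(1,2)] by blast
  qed
  have 2: "c ` K \<subseteq> fixer H \<B>"
  proof
    fix f assume "f \<in> c ` K"
    then obtain \<kappa> where k: "\<kappa> \<in> K" "f = c \<kappa>" by blast
    have "f ` B' = B'" if B': "B' \<in> \<B>" for B'
    proof -
      have "f ` B' = h' ` \<kappa> ` h ` B'" using BX[OF B'] by (force simp: k c image_iff)
      also have "\<dots> = h' ` h ` B'" using KH(2)[OF k(1) inv[OF B']] by simp
      also have "\<dots> = B'" using BX[OF B'] hh(1) by (force simp: image_iff)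
      finally show ?thesis .
    qed
    then show "f \<in> fixer H \<B>" using cH k by (simp add: fixer_def)
  qed
  have 3: "f x = x" if fx: "f \<in> c ` K" "x \<in> B" for f x
  proof -
    obtain \<kappa> where \<kappa>: "\<kappa> \<in> K" "f = c \<kappa>" using fx(1) by blast
    have "x \<in> X" using fx(2) BX[OF B] by blast
    then show ?thesis using K(3)[OF \<kappa>(1) fx(2)] \<kappa>(2) hh(1) by (simp add: c)
  qed
  have 4: "(\<forall>f\<in>c ` K. \<forall>x\<in>B'. f x = x) \<or> (\<forall>x\<in>B'. \<forall>y\<in>B'. \<exists>f\<in>c ` K. f x = y)"
    if B': "B' \<in> \<B>" for B'
    using K(4)[OF inv[OF B']]
  proof
    assume "\<forall>\<kappa>\<in>K. \<forall>x\<in>h ` B'. \<kappa> x = x"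
    then show ?thesis using BX[OF B'] hh by (auto simp: c subset_iff)
  next
    assume t: "\<forall>x\<in>h ` B'. \<forall>y\<in>h ` B'. \<exists>\<kappa>\<in>K. \<kappa> x = y"
    have "\<exists>f\<in>c ` K. f x = y" if xy: "x \<in> B'" "y \<in> B'" for x y
    proof -
      obtain \<kappa> where k: "\<kappa> \<in> K" "\<kappa> (h x) = h y" using t xy by blast
      have "c \<kappa> x = y" using k(2) xy BX[OF B'] hh by (simp add: c subset_iff)
      then show ?thesis using k(1) by blast
    qed
    then show ?thesis by blast
  qed
  show ?thesis
    unfolding h'_def[symmetric] c_def[symmetric] wstab_cond_iff[OF X] using 1 2 3 4 by blast
qed

lemma WStab_eq_image:
  assumes X: "finite X" "\<Union>\<B> \<subseteq> X" and H: "subgroup H (BijGroup X)" "h \<in> H"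
    and inv: "\<And>B. B \<in> \<B> \<Longrightarrow> h ` B \<in> \<B>"
    and B: "B \<in> \<B>" "B' \<in> \<B>" and eq: "WStab X H \<B> B = WStab X H \<B> B'"
  shows "WStab X H \<B> (h ` B) = WStab X H \<B> (h ` B')"
proof -
  have hB: "h \<in> Bij X" by (rule perm_subgroup_mem[OF H])
  have *: "wstab_cond X H \<B> (h ` B2) K"
    if B: "B1 \<in> \<B>" "B2 \<in> \<B>" and eq: "WStab X H \<B> B1 = WStab X H \<B> B2"
      and w: "wstab_cond X H \<B> (h ` B1) K" for B1 B2 K
  proof -
    have "wstab_cond X H \<B> B2 ((\<lambda>\<kappa>. compose X (inv\<^bsub>BijGroup X\<^esub> h) (compose X \<kappa> h)) ` K)"
      using wstab_cond_conj[OF X H inv w B(1)] WStab_eq_iff[OF X B] eq by blast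
    then have t: "compose X (inv\<^bsub>BijGroup X\<^esub> h) (compose X \<kappa> h) x = x" if "\<kappa> \<in> K" "x \<in> B2" for \<kappa> x
      using that unfolding wstab_cond_iff[OF X] by blast
    have KB: "subgroup K (BijGroup X)" using w by (simp add: wstab_cond_def)
    have "\<kappa> (h x) = h x" if k: "\<kappa> \<in> K" "x \<in> B2" for \<kappa> x
    proof -
      have x: "x \<in> X" using k B X by blast
      have "\<kappa> (h x) \<in> X" by (rule perm_subgroup_app[OF KB k(1) Bij_app[OF hB x]])
      then have "h ((inv\<^bsub>BijGroup X\<^esub> h) (\<kappa> (h x))) = \<kappa> (h x)" by (rule BijGroup_inv_apply(2)[OF hB])
      then show ?thesis using t[OF k] x by (simp add: compose_eq)
    qed
    then show ?thesis using w by (simp add: wstab_cond_iff[OF X])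
  qed
  show ?thesis
    unfolding WStab_eq_iff[OF X inv[OF B(1)] inv[OF B(2)]]
    using *[OF B eq] *[OF B(2,1) eq[symmetric]] by blast
qed

text \<open>A normal block system is a partition that the group permutes.\<close>

lemma normal_block_systemD:
  assumes H: "subgroup H (BijGroup X)" and \<B>: "normal_block_system X H \<B>"
  shows "\<Union>\<B> = X" and "\<And>B B' x. B \<in> \<B> \<Longrightarrow> B' \<in> \<B> \<Longrightarrow> x \<in> B \<Longrightarrow> x \<in> B' \<Longrightarrow> B = B'"
    and "\<And>h B. h \<in> H \<Longrightarrow> B \<in> \<B> \<Longrightarrow> h ` B \<in> \<B>"
proof -
  obtain N where N: "N \<lhd> perm_grp X H" "\<B> = perm_orbits X N"
    using \<B> by (auto simp: normal_block_system_def)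
  have NB: "subgroup N (BijGroup X)"
    by (rule subgroup_of_perm_grp[OF H normal_imp_subgroup[OF N(1)]])
  have orb: "\<B> = (\<lambda>x. (\<lambda>g. g x) ` N) ` X" by (simp add: N perm_orbits_alt)
  have self: "x \<in> (\<lambda>g. g x) ` N" if "x \<in> X" for x
    using that by (intro image_eqI[OF _ perm_subgroup_id[OF NB]]) simp
  show "\<Union>\<B> = X" unfolding orb using self perm_subgroup_app[OF NB] by blast
  have eq: "(\<lambda>g. g x) ` N = (\<lambda>g. g y) ` N" if xy: "x \<in> X" "y \<in> X" "x \<in> (\<lambda>g. g y) ` N" for x y
  proof -
    obtain g where g: "g \<in> N" "x = g y" using xy by blast
    have gB: "g \<in> Bij X" by (rule perm_subgroup_mem[OF NB g(1)])
    show ?thesis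
    proof (intro equalityI subsetI)
      fix z assume "z \<in> (\<lambda>g. g x) ` N"
      then obtain h where h: "h \<in> N" "z = h x" by blast
      then have "z = compose X h g y" using g xy by (simp add: compose_eq)
      then show "z \<in> (\<lambda>g. g y) ` N" using perm_subgroup_compose[OF NB h(1) g(1)] by blast
    next
      fix z assume "z \<in> (\<lambda>g. g y) ` N"
      then obtain h where h: "h \<in> N" "z = h y" by blast
      have "y = (inv\<^bsub>BijGroup X\<^esub> g) x" using g(2) BijGroup_inv_apply(1)[OF gB xy(2)] by simp
      then have "z = compose X h (inv\<^bsub>BijGroup X\<^esub> g) x" using h xy by (simp add: compose_eq)
      then show "z \<in> (\<lambda>g. g x) ` N"
        using perm_subgroup_compose[OF NB h(1) perm_subgroup_inv[OF NB g(1)]] by blast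
    qed
  qed
  show "B = B'" if BB: "B \<in> \<B>" "B' \<in> \<B>" and x: "x \<in> B" "x \<in> B'" for B B' x
  proof -
    obtain y y' where y: "y \<in> X" "y' \<in> X" "B = (\<lambda>g. g y) ` N" "B' = (\<lambda>g. g y') ` N"
      using BB unfolding orb by blast
    obtain g where "g \<in> N" "x = g y" using x(1) y(3) by blast
    then have "x \<in> X" using y(1) perm_subgroup_app[OF NB] by simp
    then show ?thesis using eq[of x y] eq[of x y'] y x by simp
  qed
  obtain B0 where B0: "B0 \<subseteq> X" "\<B> = {g ` B0 | g. g \<in> H}"
    using \<B> by (auto simp: normal_block_system_def is_block_system_def is_block_def)
  show "h ` B \<in> \<B>" if h: "h \<in> H" "B \<in> \<B>" for h B
  proof -
    obtain g where g: "g \<in> H" "B = g ` B0" using h(2) B0(2) by blast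
    have "h ` B = compose X h g ` B0" using B0(1) g(2) by (force simp: compose_def image_iff)
    then show ?thesis using perm_subgroup_compose[OF H h(1) g(1)] B0(2) by blast
  qed
qed

context cyclic_labelling
begin

section \<open>The groups of permutations with a given key are \<open>5/2\<close>-closed\<close>

lemma transitive_of_shift:
  assumes "subgroup P (BijGroup X)" "shift 1 \<in> P"
  shows "transitive_perm_grp X P"
  unfolding transitive_perm_grp_iff
proof (intro conjI assms(1) ballI)
  fix x y assume "x \<in> X" "y \<in> X"
  then have "shift (l y - l x) x = y" by (simp add: shift_def disp_def)
  then show "\<exists>g\<in>P. g x = y" using shift_mult_mem[OF assms] by blast
qed

text \<open>The subgroup \<open>H\<close> in the definition of \<open>5/2\<close>-closedness need not contain a regular cyclic group.\<close>

theorem five_halves_closed_key_perms: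
  assumes k: "valid_key k"
  shows "five_halves_closed X (key_perms k)"
proof -
  note sub = subgroup_key_perms[OF k]
  have tr: "transitive_perm_grp X (key_perms k)"
    by (rule transitive_of_shift[OF sub shift_key_perms[OF k]])
  have restr: "perm_restrict X g E \<in> key_perms k"
    if H: "H \<subseteq> key_perms k" "transitive_perm_grp X H" and \<B>: "normal_block_system X H \<B>"
      and E: "E \<in> fixer_block_system X H \<B>" and g: "g \<in> key_perms k"
      and gB: "\<And>B. B \<in> \<B> \<Longrightarrow> B \<subseteq> E \<Longrightarrow> g ` B = B" for H \<B> E g
  proof -
    have Hs: "subgroup H (BijGroup X)" using H(2) by (simp add: transitive_perm_grp_iff)
    note bs = normal_block_systemD[OF Hs \<B>]
    have U: "\<Union>\<B> \<subseteq> X" using bs(1) by simp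
    have gX: "g x \<in> X" if "x \<in> X" for x by (rule perm_subgroup_app[OF sub g that])
    obtain B where B: "B \<in> \<B>" "E = \<Union>{B' \<in> \<B>. WStab X H \<B> B = WStab X H \<B> B'}"
      using E by (auto simp: fixer_block_system_def)
    have EB: "B' \<subseteq> E \<and> WStab X H \<B> B = WStab X H \<B> B'"
      if B': "B' \<in> \<B>" "x \<in> B'" "x \<in> E" for B' x
    proof -
      obtain B'' where "B'' \<in> \<B>" "x \<in> B''" "WStab X H \<B> B = WStab X H \<B> B''"
        using B'(3) B(2) by blast
      moreover from this have "B'' = B'" using bs(2) B' by blast
      ultimately show ?thesis unfolding B(2) by blast
    qed
    \<comment> \<open>The crucial case: if \<open>x\<close> lies in \<open>E\<close> but \<open>y\<close> does not, some subgroup fixes the block of one of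
      the points pointwise and is transitive on the block of the other one. As \<open>x\<close> and \<open>y\<close> agree
      modulo \<open>p\<^bsup>k i\<^esup>\<close>, that block is constant modulo \<open>p\<^sup>i\<close>.\<close>
    have key: "[l (g x) = l x] (mod int p ^ i)"
      if i: "i \<in> {1..n}" and x: "x \<in> X" "x \<in> E" and y: "y \<in> X" "y \<notin> E"
        and c: "[l x = l y] (mod int p ^ k i)" for i x y
    proof -
      obtain Bx By where Bx: "Bx \<in> \<B>" "x \<in> Bx" and By: "By \<in> \<B>" "y \<in> By"
        using bs(1) x(1) y(1) by blast
      have WBx: "WStab X H \<B> B = WStab X H \<B> Bx" and "Bx \<subseteq> E" using EB[OF Bx x(2)] by auto
      have WBy: "WStab X H \<B> B \<noteq> WStab X H \<B> By" using By y(2) unfolding B(2) by blast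
      have gBx: "g x \<in> Bx" using gB[OF Bx(1) \<open>Bx \<subseteq> E\<close>] Bx(2) by blast
      have fix_move: "[l z = l w] (mod int p ^ i)"
        if "\<kappa> \<in> H" "\<kappa> v = v" "\<kappa> w = z" "v \<in> X" "w \<in> X" "[l w = l v] (mod int p ^ k i)" for \<kappa> v w z
      proof -
        have "key_map k \<kappa>" using H(1) that(1) by (auto simp: key_perms_def)
        from key_mapD[OF this i that(5,4,6)] show ?thesis
          using that(2,3) by (simp add: cong_iff_dvd_diff)
      qed
      from WBx WBy have "WStab X H \<B> Bx \<noteq> WStab X H \<B> By" by simp
      then obtain K where K: "wstab_cond X H \<B> Bx K \<noteq> wstab_cond X H \<B> By K"
        unfolding WStab_eq_iff[OF finite_X U Bx(1) By(1)] by blast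
      then consider "wstab_cond X H \<B> Bx K" "\<not> wstab_cond X H \<B> By K"
        | "wstab_cond X H \<B> By K" "\<not> wstab_cond X H \<B> Bx K" by blast
      then show ?thesis
      proof cases
        case 2
        then have KH: "\<kappa> \<in> H" and Ky: "\<kappa> y = y" if "\<kappa> \<in> K" for \<kappa>
          using By(2) that unfolding wstab_cond_iff[OF finite_X U] by (auto simp: fixer_def)
        have "\<exists>\<kappa>\<in>K. \<kappa> x = g x"
          using 2 Bx gBx unfolding wstab_cond_iff[OF finite_X U] by blast
        then obtain \<kappa> where \<kappa>: "\<kappa> \<in> K" "\<kappa> x = g x" by blast
        show ?thesis by (rule fix_move[OF KH[OF \<kappa>(1)] Ky[OF \<kappa>(1)] \<kappa>(2) y(1) x(1) c])
      next
        case 1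
        then have KH: "\<kappa> \<in> H" and Kx: "\<kappa> x = x" if "\<kappa> \<in> K" for \<kappa>
          using Bx(2) that unfolding wstab_cond_iff[OF finite_X U] by (auto simp: fixer_def)
        have tr: "\<exists>\<kappa>\<in>K. \<kappa> y = z" if "z \<in> By" for z
          using 1 By that unfolding wstab_cond_iff[OF finite_X U] by blast
        obtain h where h: "h \<in> H" "h x = y"
          using H(2) x(1) y(1) unfolding transitive_perm_grp_iff by blast
        have "h ` Bx = By" using bs(2)[OF bs(3)[OF h(1) Bx(1)] By(1), of y] h(2) Bx(2) By(2) by blast
        then have "h (g x) \<in> By" using gBx by blast
        then obtain \<kappa> where \<kappa>: "\<kappa> \<in> K" "\<kappa> y = h (g x)" using tr by blast
        have "[l (h (g x)) = l (h x)] (mod int p ^ i)"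
          unfolding h(2)
          by (rule fix_move[OF KH[OF \<kappa>(1)] Kx[OF \<kappa>(1)] \<kappa>(2) x(1) y(1) cong_sym[OF c]])
        moreover have "key_map k h" using H(1) h(1) by (auto simp: key_perms_def)
        ultimately show ?thesis
          using key_map_reflects[OF k _ gX[OF x(1)] x(1), of h i] i by simp
      qed
    qed
    show ?thesis by (rule perm_restrict_key_perms[OF k g key])
  qed
  show ?thesis
    unfolding five_halves_closed_def
  proof (intro conjI allI impI tr)
    fix H \<B> E g
    assume "H \<subseteq> key_perms k \<and> transitive_perm_grp X H \<and> normal_block_system X H \<B> \<and>
        E \<in> fixer_block_system X H \<B> \<and> g \<in> key_perms k \<and> (\<forall>B\<in>\<B>. B \<subseteq> E \<longrightarrow> g ` B = B)"
    then show "perm_restrict X g E \<in> key_perms k" using restr[of H \<B> E g] by simp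
  qed
qed

end

section \<open>The blocks of a \<open>p\<close>-group that contains the cyclic shift\<close>

lemma int_subgroup_prime_power:
  fixes S :: "int set"
  assumes p: "prime (p::nat)" and S: "int p ^ j \<in> S" "\<And>a b. a \<in> S \<Longrightarrow> b \<in> S \<Longrightarrow> a - b \<in> S"
  shows "\<exists>e\<le>j. \<forall>a. a \<in> S \<longleftrightarrow> int p ^ e dvd a"
proof -
  have S0: "0 \<in> S" using S(2)[OF S(1,1)] by simp
  have Sneg: "- a \<in> S" if "a \<in> S" for a using S(2)[OF S0 that] by simp
  have Sadd: "a + b \<in> S" if "a \<in> S" "b \<in> S" for a b using S(2)[OF that(1) Sneg[OF that(2)]] by simp
  have Snat: "int m * a \<in> S" if "a \<in> S" for m a
    by (induction m) (use S0 Sadd that in \<open>auto simp: algebra_simps\<close>)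
  have Smult: "m * a \<in> S" if "a \<in> S" for m a
    using Snat[OF that, of "nat m"] Sneg[OF Snat[OF that, of "nat (- m)"]] by (cases "m \<ge> 0") auto
  define e where "e = (LEAST e. int p ^ e \<in> S)"
  have e: "int p ^ e \<in> S" unfolding e_def by (rule LeastI[of _ j]) (rule S(1))
  have "e \<le> j" unfolding e_def by (rule Least_le) (rule S(1))
  moreover have "a \<in> S \<longleftrightarrow> int p ^ e dvd a" for a
  proof
    assume a: "a \<in> S"
    have "prime (int p)" using p by simp
    moreover have "gcd a (int p ^ j) dvd int p ^ j" by simp
    ultimately obtain f where "normalize (gcd a (int p ^ j)) = normalize (int p ^ f)"
      using divides_primepow_weak by blast
    then have f: "gcd a (int p ^ j) = int p ^ f" by simp
    obtain u v where "u * a + v * int p ^ j = int p ^ f" using bezout_int[of a "int p ^ j"] f by auto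
    then have "int p ^ f \<in> S" using Sadd[OF Smult[OF a, of u] Smult[OF S(1), of v]] by simp
    then have "e \<le> f" unfolding e_def by (rule Least_le)
    then have "int p ^ e dvd gcd a (int p ^ j)" unfolding f by (rule le_imp_power_dvd)
    then show "int p ^ e dvd a" by simp
  next
    assume "int p ^ e dvd a"
    then show "a \<in> S" using Smult[OF e] by (metis dvd_def mult.commute)
  qed
  ultimately show ?thesis by blast
qed

context cyclic_labelling
begin

text \<open>The residue class of \<open>x\<close> modulo \<open>p\<^sup>j\<close>, and the partition into these classes.\<close>

definition cls :: "nat \<Rightarrow> 'a \<Rightarrow> 'a set" where
  "cls j x = {y \<in> X. [l y = l x] (mod int p ^ j)}"

definition blocks :: "nat \<Rightarrow> 'a set set" where
  "blocks j = cls j ` X"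

lemma mem_cls: "y \<in> cls j x \<longleftrightarrow> y \<in> X \<and> [l y = l x] (mod int p ^ j)"
  by (simp add: cls_def)

lemma cls_eq: "[l x = l y] (mod int p ^ j) \<Longrightarrow> cls j x = cls j y"
  unfolding cls_def using cong_sym cong_trans by blast

lemma cls_eqD: "cls j x = cls j y \<Longrightarrow> x \<in> X \<Longrightarrow> [l x = l y] (mod int p ^ j)"
  using mem_cls[of x j x] mem_cls[of x j y] by simp

lemma Union_blocks: "\<Union>(blocks j) = X"
  unfolding blocks_def by (auto simp: mem_cls)

lemma image_cls:
  assumes f: "f \<in> key_perms full_key" and j: "j \<le> n" and x: "x \<in> X"
  shows "f ` cls j x = cls j (f x)"
proof (intro equalityI subsetI)
  have fB: "f \<in> Bij X" and fk: "key_map full_key f" using f by (auto simp: key_perms_def)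
  show "y \<in> cls j (f x)" if y: "y \<in> f ` cls j x" for y
  proof -
    obtain z where z: "y = f z" "z \<in> X" "[l z = l x] (mod int p ^ j)"
      using y by (auto simp: mem_cls)
    then show ?thesis using full_key_preserves[OF f j z(2) x z(3)] Bij_app[OF fB] by (simp add: mem_cls)
  qed
  show "y \<in> f ` cls j x" if y: "y \<in> cls j (f x)" for y
  proof -
    have "y \<in> f ` X" using y Bij_image[OF fB] by (simp add: mem_cls)
    then obtain z where z: "z \<in> X" "y = f z" by blast
    then have "[l z = l x] (mod int p ^ j)"
      using key_map_reflects[OF valid_full_key fk z(1) x j] y by (simp add: mem_cls)
    then show ?thesis using z by (simp add: mem_cls)
  qed
qed

lemma fixer_blocks:
  assumes P: "P \<subseteq> key_perms full_key" and j: "j \<le> n"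
  shows "fixer P (blocks j) = {g \<in> P. \<forall>x\<in>X. [l (g x) = l x] (mod int p ^ j)}"
proof -
  have "g ` cls j x = cls j x \<longleftrightarrow> [l (g x) = l x] (mod int p ^ j)" if "g \<in> P" "x \<in> X" for g x
  proof -
    have g: "g \<in> key_perms full_key" using P that by blast
    have "g x \<in> X" using g that Bij_app[of g X x] by (simp add: key_perms_def)
    then show ?thesis unfolding image_cls[OF g j that(2)] using cls_eq cls_eqD by blast
  qed
  then show ?thesis unfolding fixer_def blocks_def by (simp cong: conj_cong ball_cong)
qed

lemma normal_block_system_blocks:
  assumes P: "subgroup P (BijGroup X)" "P \<subseteq> key_perms full_key" "shift 1 \<in> P" and j: "j \<le> n"
  shows "normal_block_system X P (blocks j)"
proof -
  have sP: "shift a \<in> P" for a by (rule shift_mult_mem[OF P(1,3)])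
  have im: "g ` cls j x = cls j (g x)" if "g \<in> P" "x \<in> X" for g x
    by (rule image_cls[OF subsetD[OF P(2) that(1)] j that(2)])
  have PX: "g x \<in> X" if "g \<in> P" "x \<in> X" for g x by (rule perm_subgroup_app[OF P(1) that])
  define N where "N = fixer P (blocks j)"
  have N: "N = {g \<in> P. \<forall>x\<in>X. [l (g x) = l x] (mod int p ^ j)}"
    unfolding N_def by (rule fixer_blocks[OF P(2) j])
  have "is_block_system X P (blocks j)"
    unfolding is_block_system_def
  proof (intro exI conjI)
    show "cls j (pt 0) \<noteq> {}" using mem_cls[of "pt 0"] by force
    show "is_block X P (cls j (pt 0))"
      unfolding is_block_def
    proof (intro conjI ballI)
      show "cls j (pt 0) \<subseteq> X" by (auto simp: mem_cls)
      fix g assume "g \<in> P"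
      have "cls j (g (pt 0)) \<inter> cls j (pt 0) = {} \<or> cls j (g (pt 0)) = cls j (pt 0)"
      proof (rule disjCI)
        assume "cls j (g (pt 0)) \<noteq> cls j (pt 0)"
        then have "\<not> (x \<in> cls j (g (pt 0)) \<and> x \<in> cls j (pt 0))" for x
          using cls_eq[of x "g (pt 0)" j] cls_eq[of x "pt 0" j] unfolding mem_cls by metis
        then show "cls j (g (pt 0)) \<inter> cls j (pt 0) = {}" by blast
      qed
      then show "g ` cls j (pt 0) \<inter> cls j (pt 0) \<in> {{}, cls j (pt 0)}"
        unfolding im[OF \<open>g \<in> P\<close> pt_in] by auto
    qed
    show "blocks j = {g ` cls j (pt 0) | g. g \<in> P}"
    proof (intro equalityI subsetI)
      fix B assume "B \<in> blocks j"
      then obtain x where x: "x \<in> X" "B = cls j x" by (auto simp: blocks_def)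
      have "B = shift (l x) ` cls j (pt 0)"
        unfolding im[OF sP pt_in] shift_pt using x by simp
      then show "B \<in> {g ` cls j (pt 0) | g. g \<in> P}" using sP by blast
    next
      fix B assume "B \<in> {g ` cls j (pt 0) | g. g \<in> P}"
      then obtain g where g: "g \<in> P" "B = g ` cls j (pt 0)" by blast
      then have "B = cls j (g (pt 0))" by (simp add: im)
      then show "B \<in> blocks j" unfolding blocks_def using PX[OF g(1) pt_in] by (rule image_eqI)
    qed
  qed
  moreover have "N \<lhd> perm_grp X P"
  proof -
    interpret P: group "perm_grp X P" by (rule perm_subgroup_group[OF P(1)])
    have NB: "subgroup N (BijGroup X)"
    proof (rule perm_subgroupI_finite[OF finite_X])
      show "N \<subseteq> Bij X" using perm_subgroup_mem[OF P(1)] by (auto simp: N)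
      show "(\<lambda>x\<in>X. x) \<in> N" using perm_subgroup_id[OF P(1)] by (simp add: N)
      fix f g assume fg: "f \<in> N" "g \<in> N"
      have "[l (f (g x)) = l x] (mod int p ^ j)" if "x \<in> X" for x
        using fg that PX[of g x] unfolding N by (blast intro: cong_trans)
      moreover have "compose X f g \<in> P" using fg by (intro perm_subgroup_compose[OF P(1)]) (auto simp: N)
      ultimately show "compose X f g \<in> N" by (simp add: N compose_eq)
    qed
    have "g \<otimes>\<^bsub>perm_grp X P\<^esub> h \<otimes>\<^bsub>perm_grp X P\<^esub> inv\<^bsub>perm_grp X P\<^esub> g \<in> N"
      if g: "g \<in> P" and h: "h \<in> N" for g h
    proof -
      define g' where "g' = inv\<^bsub>BijGroup X\<^esub> g"
      have gB: "g \<in> Bij X" by (rule perm_subgroup_mem[OF P(1) g])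
      have hP: "h \<in> P" using h by (simp add: N)
      have hB: "h \<in> Bij X" by (rule perm_subgroup_mem[OF P(1) hP])
      have g'P: "g' \<in> P" unfolding g'_def by (rule perm_subgroup_inv[OF P(1) g])
      have g'B: "g' \<in> Bij X" by (rule perm_subgroup_mem[OF P(1) g'P])
      have eq: "g \<otimes>\<^bsub>perm_grp X P\<^esub> h \<otimes>\<^bsub>perm_grp X P\<^esub> inv\<^bsub>perm_grp X P\<^esub> g = compose X (compose X g h) g'"
        using gB hB g'B by (simp add: perm_grp_inv[OF P(1) g] BijGroup_mult compose_Bij flip: g'_def)
      have "[l (compose X (compose X g h) g' x) = l x] (mod int p ^ j)" if x: "x \<in> X" for x
      proof -
        have g'x: "g' x \<in> X" by (rule PX[OF g'P x])
        have "[l (h (g' x)) = l (g' x)] (mod int p ^ j)" using h g'x by (simp add: N)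
        then have "[l (g (h (g' x))) = l (g (g' x))] (mod int p ^ j)"
          by (rule full_key_preserves[OF subsetD[OF P(2) g] j PX[OF hP g'x] g'x])
        then show ?thesis
          using x g'x BijGroup_inv_apply(2)[OF gB x] by (simp add: compose_eq g'_def)
      qed
      moreover have "compose X (compose X g h) g' \<in> P"
        by (rule perm_subgroup_compose[OF P(1) perm_subgroup_compose[OF P(1) g hP] g'P])
      ultimately show ?thesis unfolding eq by (simp add: N)
    qed
    then show ?thesis
      unfolding P.normal_inv_iff using perm_subgroup_mono[OF NB P(1)] by (auto simp: N)
  qed
  moreover have "blocks j = perm_orbits X N"
    unfolding perm_orbits_alt blocks_def
  proof (rule image_cong[OF refl])
    fix x assume x: "x \<in> X"
    show "cls j x = (\<lambda>g. g x) ` N"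
    proof (intro equalityI subsetI)
      fix y assume y: "y \<in> cls j x"
      have "[l (shift (l y - l x) z) = l z] (mod int p ^ j)" if z: "z \<in> X" for z
      proof -
        have "[l (shift (l y - l x) z) = l z + (l y - l x)] (mod int p ^ j)" by (rule l_shift[OF z j])
        also have "[l z + (l y - l x) = l z + 0] (mod int p ^ j)"
          using y by (intro cong_add) (auto simp: mem_cls cong_diff_iff_cong_0)
        finally show ?thesis by simp
      qed
      then have "shift (l y - l x) \<in> N" using sP by (simp add: N)
      moreover have "y = shift (l y - l x) x" using x y by (simp add: shift_def disp_def mem_cls)
      ultimately show "y \<in> (\<lambda>g. g x) ` N" by blast
    next
      fix y assume "y \<in> (\<lambda>g. g x) ` N"
      then show "y \<in> cls j x" using x PX by (auto simp: N mem_cls)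
    qed
  qed
  ultimately show ?thesis unfolding normal_block_system_def by blast
qed

text \<open>
  The residues \<open>a\<close> whose block has the same wreath stabilizer as the block of \<open>0\<close> form a subgroup of
  \<open>\<int>\<close>, because the shifts permute the wreath stabilizers by conjugation.
\<close>

lemma fixer_block_of_zero:
  assumes P: "subgroup P (BijGroup X)" "P \<subseteq> key_perms full_key" "shift 1 \<in> P" and j: "j \<le> n"
  obtains e where "e \<le> j" "{x \<in> X. int p ^ e dvd l x} \<in> fixer_block_system X P (blocks j)"
    "\<And>x. x \<in> X \<Longrightarrow> int p ^ e dvd l x \<Longrightarrow>
      WStab X P (blocks j) (cls j (pt 0)) = WStab X P (blocks j) (cls j x)"
proof -
  have sP: "shift a \<in> P" for a by (rule shift_mult_mem[OF P(1,3)])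
  define W where "W a = WStab X P (blocks j) (cls j (pt a))" for a
  have bl: "cls j (pt a) \<in> blocks j" for a by (simp add: blocks_def)
  have inv: "h ` B \<in> blocks j" if "h \<in> P" "B \<in> blocks j" for h B
  proof -
    obtain x where x: "x \<in> X" "B = cls j x" using \<open>B \<in> blocks j\<close> by (auto simp: blocks_def)
    then show ?thesis
      using image_cls[OF subsetD[OF P(2) that(1)] j x(1)] perm_subgroup_app[OF P(1) that(1) x(1)]
      by (simp add: blocks_def)
  qed
  have shiftW: "W (a + c) = W (b + c)" if "W a = W b" for a b c
  proof -
    have "WStab X P (blocks j) (shift c ` cls j (pt a)) = WStab X P (blocks j) (shift c ` cls j (pt b))"
      by (rule WStab_eq_image[OF finite_X _ P(1) sP inv bl bl])
        (use that Union_blocks in \<open>auto simp: W_def sP\<close>)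
    then show ?thesis
      by (simp add: W_def image_cls[OF subsetD[OF P(2) sP] j pt_in] shift_pt)
  qed
  define S where "S = {a. W a = W 0}"
  have "pt (int p ^ j) \<in> cls j (pt 0)"
    using cong_l_pt[OF j, of "int p ^ j"] cong_l_pt[OF j, of 0] cong_trans cong_sym
    by (simp add: mem_cls cong_def)
  then have "int p ^ j \<in> S"
    using cls_eq[of "pt (int p ^ j)" "pt 0" j] by (simp add: S_def W_def mem_cls)
  moreover have "a - b \<in> S" if "a \<in> S" "b \<in> S" for a b
    using that shiftW[of a 0 "- b"] shiftW[of b 0 "- b"] by (simp add: S_def)
  ultimately obtain e where e: "e \<le> j" "\<And>a. a \<in> S \<longleftrightarrow> int p ^ e dvd a"
    using int_subgroup_prime_power[OF prime_p] by metis
  have W: "WStab X P (blocks j) (cls j (pt 0)) = WStab X P (blocks j) (cls j x) \<longleftrightarrow> int p ^ e dvd l x"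
    if "x \<in> X" for x
    using e(2)[of "l x"] that by (auto simp: S_def W_def)
  have "{x \<in> X. int p ^ e dvd l x} = \<Union>{B' \<in> blocks j.
      WStab X P (blocks j) (cls j (pt 0)) = WStab X P (blocks j) B'}"
  proof (intro equalityI subsetI)
    fix x assume "x \<in> {x \<in> X. int p ^ e dvd l x}"
    moreover from this have "x \<in> cls j x" by (simp add: mem_cls)
    ultimately show "x \<in> \<Union>{B' \<in> blocks j.
        WStab X P (blocks j) (cls j (pt 0)) = WStab X P (blocks j) B'}"
      using W unfolding blocks_def by blast
  next
    fix x assume "x \<in> \<Union>{B' \<in> blocks j.
        WStab X P (blocks j) (cls j (pt 0)) = WStab X P (blocks j) B'}"
    then obtain y where y: "y \<in> X" "x \<in> cls j y"
        "WStab X P (blocks j) (cls j (pt 0)) = WStab X P (blocks j) (cls j y)"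
      by (auto simp: blocks_def)
    have x: "cls j x = cls j y" "x \<in> X" using y(2) cls_eq by (auto simp: mem_cls)
    then have "int p ^ e dvd l x" using iffD1[OF W[OF x(2)]] y(3) by (simp only: x(1))
    then show "x \<in> {x \<in> X. int p ^ e dvd l x}" using x(2) by simp
  qed
  then have "{x \<in> X. int p ^ e dvd l x} \<in> fixer_block_system X P (blocks j)"
    unfolding fixer_block_system_def using bl by blast
  then show thesis using that e(1) W by blast
qed

section \<open>The key of a \<open>5/2\<close>-closed group\<close>

lemma disp_multiples:
  assumes P: "subgroup P (BijGroup X)" "disp d \<in> P" and k: "k \<le> n"
    and d: "\<And>x y. x \<in> X \<Longrightarrow> y \<in> X \<Longrightarrow> [l x = l y] (mod int p ^ k) \<Longrightarrow> d x = d y"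
      "\<And>x. x \<in> X \<Longrightarrow> int p ^ k dvd d x"
  shows "disp (\<lambda>x. int m * d x) \<in> P"
    and "compose X (disp (\<lambda>x. int m * d x)) (disp (\<lambda>x. int m' * d x)) = disp (\<lambda>x. int (m + m') * d x)"
proof -
  have c: "compose X (disp (\<lambda>x. int m * d x)) (disp (\<lambda>x. int m' * d x)) = disp (\<lambda>x. int (m + m') * d x)"
    for m m'
  proof -
    have "compose X (disp (\<lambda>x. int m * d x)) (disp (\<lambda>x. int m' * d x)) = disp (\<lambda>x. int m * d x + int m' * d x)"
    proof (rule compose_disp[OF k])
      show "int m * d x = int m * d y" if "x \<in> X" "y \<in> X" "[l x = l y] (mod int p ^ k)" for x y
        using d(1)[OF that] by simp
      show "int p ^ k dvd int m' * d x" if "x \<in> X" for x using d(2)[OF that] by (rule dvd_mult)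
    qed
    then show ?thesis by (simp add: algebra_simps)
  qed
  then show "compose X (disp (\<lambda>x. int m * d x)) (disp (\<lambda>x. int m' * d x)) = disp (\<lambda>x. int (m + m') * d x)" .
  show "disp (\<lambda>x. int m * d x) \<in> P"
  proof (induction m)
    case 0
    show ?case using perm_subgroup_id[OF P(1)] by (simp only: of_nat_0 mult_zero_left disp_zero)
  next
    case (Suc m)
    have "disp (\<lambda>x. int (Suc m) * d x) = compose X (disp (\<lambda>x. int 1 * d x)) (disp (\<lambda>x. int m * d x))"
      unfolding c by simp
    also have "\<dots> \<in> P" using P(2) by (intro perm_subgroup_compose[OF P(1) _ Suc]) simp
    finally show ?case .
  qed
qed

text \<open>
  The induction step, from the levels above \<open>i\<close> to level \<open>i\<close>. The assumption \<open>minimal\<close> says that no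
  smaller value of \<open>k i\<close> would do, and \<open>closed\<close> is the instance of \<open>5/2\<close>-closedness that is used.
\<close>

lemma level_residue_shift:
  assumes p3: "p \<ge> 3" and P: "subgroup P (BijGroup X)" "P \<subseteq> key_perms full_key" "shift 1 \<in> P"
    and k: "valid_key k" "mono_key k" "P \<subseteq> key_perms k" and i: "i \<in> {1..n}"
    and minimal: "\<And>e. e < k i \<Longrightarrow> \<exists>f\<in>P. \<exists>x\<in>X. \<exists>y\<in>X. [l x = l y] (mod int p ^ e) \<and>
      \<not> [l (f x) - l (f y) = l x - l y] (mod int p ^ i)"
    and closed: "\<And>e g. e \<le> i - 1 \<Longrightarrow> {x \<in> X. int p ^ e dvd l x} \<in> fixer_block_system X P (blocks (i - 1)) \<Longrightarrow>
      g \<in> P \<Longrightarrow> (\<And>x. x \<in> X \<Longrightarrow> int p ^ e dvd l x \<Longrightarrow> [l (g x) = l x] (mod int p ^ (i - 1))) \<Longrightarrow>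
      perm_restrict X g {x \<in> X. int p ^ e dvd l x} \<in> P"
    and higher: "\<And>j r. i < j \<Longrightarrow> j \<le> n \<Longrightarrow> residue_shift j (k j) r \<in> P"
  shows "residue_shift i (k i) r \<in> P"
proof -
  have i1: "i - 1 \<le> n" and i_le: "i \<le> n" using i by auto
  have ki: "k i \<le> i - 1" using valid_keyD[OF k(1) i] by simp
  have pii: "int p ^ i = int p ^ (i - 1) * int p" using i by (simp flip: power_Suc2)
  obtain e where e: "e \<le> i - 1"
    and E: "{x \<in> X. int p ^ e dvd l x} \<in> fixer_block_system X P (blocks (i - 1))"
    and W: "\<And>x. x \<in> X \<Longrightarrow> int p ^ e dvd l x \<Longrightarrow>
      WStab X P (blocks (i - 1)) (cls (i - 1) (pt 0)) = WStab X P (blocks (i - 1)) (cls (i - 1) x)"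
    by (rule fixer_block_of_zero[OF P i1]) blast
  have sP: "shift a \<in> P" for a by (rule shift_mult_mem[OF P(1,3)])
  have "k i \<le> e"
  proof (rule ccontr)
    assume "\<not> k i \<le> e"
    then have ek: "e < k i" by simp
    then have ei: "e < i" "e \<le> n" using e i by auto
    obtain f0 x0 y0 where f0: "f0 \<in> P" "x0 \<in> X" "y0 \<in> X" "[l x0 = l y0] (mod int p ^ e)"
      "\<not> [l (f0 x0) - l (f0 y0) = l x0 - l y0] (mod int p ^ i)" using minimal[OF ek] by blast
    obtain f u where f: "f \<in> P" and u: "\<not> int p dvd u" and fl: "\<And>x. x \<in> X \<Longrightarrow> int p ^ e dvd l x \<Longrightarrow>
        [l (f x) = l x + int p ^ (i - 1) * u * (l x div int p ^ e)] (mod int p ^ i)"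
      using level_multiplier[OF p3 P i ei(1) f0] by blast
    \<comment> \<open>As \<open>f\<close> is trivial modulo \<open>p\<^bsup>i-1\<^esup>\<close> on the multiples of \<open>p\<^sup>e\<close>, it fixes the blocks among them,
      although it may move blocks elsewhere.\<close>
    define f2 where "f2 = perm_restrict X f {x \<in> X. int p ^ e dvd l x}"
    have f2P: "f2 \<in> P" unfolding f2_def
    proof (rule closed[OF e E f])
      fix x assume x: "x \<in> X" "int p ^ e dvd l x"
      have "[l (f x) = l x + int p ^ (i - 1) * u * (l x div int p ^ e)] (mod int p ^ (i - 1))"
        by (rule cong_le[OF fl[OF x]]) simp
      then show "[l (f x) = l x] (mod int p ^ (i - 1))"
        by (simp add: cong_def mult.assoc)
    qed
    \<comment> \<open>The digit of \<open>x\<close> at position \<open>e\<close>, multiplied by the unit \<open>u\<close>.\<close>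
    define w where "w x = (if int p ^ e dvd l x then (u * (l x div int p ^ e)) mod int p else 0)" for x
    define d where "d x = int p ^ (i - 1) * w x" for x
    have wc: "w x = w y" if "[l x = l y] (mod int p ^ Suc e)" for x y
    proof (cases "int p ^ e dvd l x")
      case True
      have "[l x = l y] (mod int p ^ e)" by (rule cong_le[OF that]) simp
      then have y: "int p ^ e dvd l y" using True by (simp add: cong_dvd_iff)
      obtain a b where ab: "l x = int p ^ e * a" "l y = int p ^ e * b" using True y by (auto simp: dvd_def)
      have "l x - l y = int p ^ e * (a - b)" using ab by (simp only: right_diff_distrib)
      then have "int p ^ e * int p dvd int p ^ e * (a - b)"
        using that by (simp only: cong_iff_dvd_diff power_Suc2)
      then have "[a = b] (mod int p)" using pow_pos[of e] by (auto simp: cong_iff_dvd_diff)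
      then have "[u * a = u * b] (mod int p)" by (rule cong_mult[OF cong_refl])
      then show ?thesis using True y ab pow_pos[of e] by (simp add: w_def cong_def)
    next
      case False
      have "[l x = l y] (mod int p ^ e)" by (rule cong_le[OF that]) simp
      then have "\<not> int p ^ e dvd l y" using False by (simp add: cong_dvd_iff)
      then show ?thesis using False by (simp add: w_def)
    qed
    have dc: "d x = d y" if "[l x = l y] (mod int p ^ j)" "Suc e \<le> j" for x y j
      using wc[OF cong_le[OF that]] by (simp add: d_def)
    have dk: "disp d \<in> key_perms k"
      by (rule disp_level_key_perms[OF k(1,2) i]) (use dc ek in \<open>auto simp: d_def\<close>)
    have f2k: "f2 \<in> key_perms k" using f2P k(3) by blast
    have f2B: "f2 \<in> Bij X" by (rule perm_subgroup_mem[OF P(1) f2P])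
    have dB: "disp d \<in> Bij X" using dk by (simp add: key_perms_def)
    have f2d: "[l (f2 x) = l (disp d x)] (mod int p ^ i)" if x: "x \<in> X" for x
    proof -
      have "[l (f2 x) = l x + d x] (mod int p ^ i)"
      proof (cases "int p ^ e dvd l x")
        case True
        have "int p ^ (i - 1) * int p dvd int p ^ (i - 1) *
          (u * (l x div int p ^ e) - (u * (l x div int p ^ e)) mod int p)"
          by (intro mult_dvd_mono dvd_refl) (simp add: minus_mod_eq_mult_div)
        then have "[int p ^ (i - 1) * u * (l x div int p ^ e) = d x] (mod int p ^ i)"
          unfolding pii using True by (simp add: cong_iff_dvd_diff d_def w_def algebra_simps)
        from cong_trans[OF fl[OF x True] cong_add[OF cong_refl this]]
        show ?thesis using x True by (simp add: f2_def perm_restrict_def)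
      next
        case False
        then show ?thesis using x by (simp add: f2_def perm_restrict_def d_def w_def)
      qed
      then show ?thesis using l_disp[OF x i_le] cong_sym cong_trans by blast
    qed
    \<comment> \<open>\<open>f2\<close> and \<open>disp d\<close> have the key \<open>k\<close> and agree modulo \<open>p\<^sup>i\<close>, so they differ by an element
      that the levels above \<open>i\<close> generate.\<close>
    have dP: "disp d \<in> P"
    proof -
      define f2' where "f2' = inv\<^bsub>BijGroup X\<^esub> f2"
      define h where "h = compose X f2' (disp d)"
      have f2'k: "f2' \<in> key_perms k" unfolding f2'_def
        by (rule perm_subgroup_inv[OF subgroup_key_perms[OF k(1)] f2k])
      have hk: "h \<in> key_perms k" unfolding h_def
        by (rule perm_subgroup_compose[OF subgroup_key_perms[OF k(1)] f2'k dk])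
      have hB: "h \<in> Bij X" using hk by (simp add: key_perms_def)
      have f2h: "f2 (h x) = disp d x" if "x \<in> X" for x
        using that BijGroup_inv_apply(2)[OF f2B disp_in[OF that]] by (simp add: h_def f2'_def compose_eq)
      have "h \<in> P"
      proof (rule key_perms_generated[OF k(1,2) P(1) i_le higher hk])
        fix x assume x: "x \<in> X"
        have "[l (f2 (h x)) = l (f2 x)] (mod int p ^ i)"
          unfolding f2h[OF x] by (rule cong_sym[OF f2d[OF x]])
        moreover have "key_map k f2" using f2k by (simp add: key_perms_def)
        ultimately show "[l (h x) = l x] (mod int p ^ i)"
          using key_map_reflects[OF k(1) _ Bij_app[OF hB x] x i_le] by blast
      qed
      then have "compose X f2 h \<in> P" by (rule perm_subgroup_compose[OF P(1) f2P])
      moreover have "compose X f2 h = disp d"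
        by (rule Bij_eqI[OF compose_Bij[OF f2B hB] dB]) (simp add: compose_eq f2h)
      ultimately show ?thesis by simp
    qed
    have dmod: "int p ^ (i - 1) dvd d x" for x by (simp add: d_def)
    have e1: "Suc e \<le> i - 1" using ek ki by simp
    note mult = disp_multiples[OF P(1) dP i1 dc[OF _ e1] dmod]
    \<comment> \<open>The powers of \<open>disp d\<close>. On each block they act as translations by the multiples of a single
      \<open>p\<^bsup>i-1\<^esup> w y\<close>, where \<open>w y\<close> is zero or a unit.\<close>
    define K where "K = range (\<lambda>m. disp (\<lambda>x. int m * d x))"
    have KP: "K \<subseteq> P" using mult(1) by (auto simp: K_def)
    have K: "subgroup K (BijGroup X)"
    proof (rule perm_subgroupI_finite[OF finite_X])
      show "K \<subseteq> Bij X" using KP perm_subgroup_mem[OF P(1)] by blast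
      show "(\<lambda>x\<in>X. x) \<in> K" unfolding K_def
        by (rule range_eqI[where x=0]) (simp only: of_nat_0 mult_zero_left disp_zero)
      fix g h assume "g \<in> K" "h \<in> K"
      then obtain m m' where "g = disp (\<lambda>x. int m * d x)" "h = disp (\<lambda>x. int m' * d x)"
        unfolding K_def by blast
      then have "compose X g h = disp (\<lambda>x. int (m + m') * d x)" by (simp only: mult(2))
      then show "compose X g h \<in> K" unfolding K_def by (rule range_eqI[where x="m + m'"])
    qed
    have U: "\<Union>(blocks (i - 1)) \<subseteq> X" by (simp add: Union_blocks)
    have "wstab_cond X P (blocks (i - 1)) (cls (i - 1) (pt 0)) K"
      unfolding wstab_cond_iff[OF finite_X U]
    proof (intro conjI K ballI)
      show "K \<subseteq> fixer P (blocks (i - 1))"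
        unfolding fixer_blocks[OF P(2) i1]
      proof (intro subsetI CollectI conjI ballI)
        fix \<kappa> assume k: "\<kappa> \<in> K"
        then show "\<kappa> \<in> P" using KP by blast
        fix x assume x: "x \<in> X"
        obtain m where m: "\<kappa> = disp (\<lambda>x. int m * d x)" using k by (auto simp: K_def)
        have "[l (\<kappa> x) = l x + int m * d x] (mod int p ^ (i - 1))" unfolding m by (rule l_disp[OF x i1])
        also have "[l x + int m * d x = l x + 0] (mod int p ^ (i - 1))"
          using dmod[of x] by (intro cong_add) (auto simp: cong_0_iff)
        finally show "[l (\<kappa> x) = l x] (mod int p ^ (i - 1))" by simp
      qed
    next
      fix \<kappa> x assume "\<kappa> \<in> K" and x: "x \<in> cls (i - 1) (pt 0)"
      then obtain m where m: "\<kappa> = disp (\<lambda>x. int m * d x)" by (auto simp: K_def)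
      have "d x = d (pt 0)" using x dc[OF _ e1] by (auto simp: mem_cls)
      also have "d (pt 0) = 0" by (simp add: d_def w_def l_pt)
      finally show "\<kappa> x = x" using x by (simp add: m disp_def mem_cls)
    next
      fix B assume "B \<in> blocks (i - 1)"
      then obtain y where y: "y \<in> X" "B = cls (i - 1) y" by (auto simp: blocks_def)
      have wy: "w x = w y" if "x \<in> B" for x
        using that wc[OF cong_le[OF _ e1]] by (auto simp: y(2) mem_cls)
      show "(\<forall>\<kappa>\<in>K. \<forall>x\<in>B. \<kappa> x = x) \<or> (\<forall>x\<in>B. \<forall>x'\<in>B. \<exists>\<kappa>\<in>K. \<kappa> x = x')"
      proof (cases "w y = 0")
        case True
        then have "\<kappa> x = x" if "\<kappa> \<in> K" "x \<in> B" for \<kappa> x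
          using that wy[OF that(2)] by (auto simp: K_def disp_def d_def y(2) mem_cls)
        then show ?thesis by blast
      next
        case False
        have "w y < int p" "w y \<ge> 0" using p_pos by (auto simp: w_def)
        with False have "\<not> int p dvd w y" by (auto dest: zdvd_imp_le)
        then have "coprime (int p) (w y)" using prime_p by (simp add: prime_imp_coprime)
        then have "coprime (w y) (int p ^ n)" by (simp add: coprime_commute)
        then obtain v where v: "[w y * v = 1] (mod int p ^ n)" using cong_solve_coprime_int by blast
        have "\<exists>\<kappa>\<in>K. \<kappa> x = x'" if x: "x \<in> B" "x' \<in> B" for x x'
        proof -
          have xX: "x \<in> X" "x' \<in> X" using x by (auto simp: y(2) mem_cls)
          have "[l x' = l x] (mod int p ^ (i - 1))"
            using x cong_sym cong_trans by (auto simp: y(2) mem_cls) blast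
          then obtain z where z: "l x' - l x = int p ^ (i - 1) * z" by (auto simp: cong_iff_dvd_diff)
          define m where "m = nat ((z * v) mod int p ^ n)"
          have "int m = (z * v) mod int p ^ n" using pow_pos[of n] by (simp add: m_def)
          then have "[int m = z * v] (mod int p ^ n)" by (simp add: cong_def)
          then have "[int m * w y = (z * v) * w y] (mod int p ^ n)" by (rule cong_mult[OF _ cong_refl])
          also have "(z * v) * w y = z * (w y * v)" by simp
          also have "[z * (w y * v) = z * 1] (mod int p ^ n)" by (rule cong_mult[OF cong_refl v])
          finally have "[int p ^ (i - 1) * (int m * w y) = int p ^ (i - 1) * z] (mod int p ^ n)"
            by (intro cong_mult) auto
          from cong_add[OF cong_refl[of "l x"] this]
          have "[l x + int m * d x = l x'] (mod int p ^ n)"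
            using z wy[OF x(1)] by (simp add: d_def algebra_simps)
          then have "pt (l x + int m * d x) = pt (l x')" by (simp add: pt_eq_iff)
          then have "disp (\<lambda>x. int m * d x) x = x'" using xX by (simp add: disp_def)
          then show ?thesis unfolding K_def by blast
        qed
        then show ?thesis by blast
      qed
    qed
    moreover define x1 where "x1 = pt (int p ^ e)"
    have "e < n" using ek ki i by auto
    have lx1: "l x1 = int p ^ e"
      using \<open>e < n\<close> p3 pow_pos[of e] by (simp add: x1_def l_pt power_strict_increasing)
    then have "WStab X P (blocks (i - 1)) (cls (i - 1) (pt 0)) = WStab X P (blocks (i - 1)) (cls (i - 1) x1)"
      by (intro W) (auto simp: x1_def)
    ultimately have "wstab_cond X P (blocks (i - 1)) (cls (i - 1) x1) K"
      by (subst (asm) WStab_eq_iff[OF finite_X U]) (auto simp: blocks_def x1_def)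
    moreover have "disp (\<lambda>x. int 1 * d x) \<in> K" unfolding K_def by blast
    ultimately have "disp (\<lambda>x. int 1 * d x) x1 = x1"
      unfolding wstab_cond_iff[OF finite_X U] by (auto simp: mem_cls x1_def)
    then have "pt (l x1 + d x1) = pt (l x1)" by (simp add: disp_def x1_def)
    then have "int p ^ n dvd int p ^ (i - 1) * w x1"
      by (simp add: pt_eq_iff cong_iff_dvd_diff d_def)
    then have "int p ^ i dvd int p ^ (i - 1) * w x1"
      using dvd_trans[OF le_imp_power_dvd[OF i_le]] by blast
    then have "int p dvd w x1" unfolding pii using pow_pos[of "i - 1"] by auto
    moreover have "w x1 = u mod int p" using lx1 pow_pos[of e] by (simp add: w_def)
    ultimately show False using u by (simp add: dvd_mod_iff)
  qed
  have gen: "residue_shift i e r \<in> P" for r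
  proof -
    have "perm_restrict X (shift (int p ^ (i - 1))) {x \<in> X. int p ^ e dvd l x} \<in> P"
    proof (rule closed[OF e E sP])
      fix x assume "x \<in> X"
      then show "[l (shift (int p ^ (i - 1)) x) = l x] (mod int p ^ (i - 1))"
        using l_shift[OF _ i1, of x "int p ^ (i - 1)"] by (simp add: cong_def)
    qed
    moreover have "perm_restrict X (shift (int p ^ (i - 1))) {x \<in> X. int p ^ e dvd l x} = residue_shift i e 0"
      by (auto simp: perm_restrict_def shift_def disp_def residue_shift_def fun_eq_iff dvd_eq_mod_eq_0)
    ultimately have r0: "residue_shift i e 0 \<in> P" by simp
    show ?thesis
    proof (cases "0 \<le> r \<and> r < int p ^ e")
      case True
      have en: "e \<le> n" using e i1 by (rule le_trans)
      have "compose X (shift r) (compose X (residue_shift i e 0) (shift (- r))) = residue_shift i e r"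
      proof
        fix x
        show "compose X (shift r) (compose X (residue_shift i e 0) (shift (- r))) x = residue_shift i e r x"
        proof (cases "x \<in> X")
          case x: True
          have "[l (shift (- r) x) = l x + - r] (mod int p ^ e)" by (rule l_shift[OF x en])
          then have m: "l (shift (- r) x) mod int p ^ e = 0 \<longleftrightarrow> l x mod int p ^ e = r"
            using True by (metis (no_types, lifting) add.right_inverse add_uminus_conv_diff cong_def
              cong_diff_iff_cong_0 cong_sym mod_0 mod_pos_pos_trivial)
          have "[l (shift (- r) x) = l x + - r] (mod int p ^ n)" by (rule l_shift[OF x order_refl])
          then have "pt (l (shift (- r) x) + c + r) = pt (l x + c)" for c
            unfolding pt_eq_iff by (simp add: cong_iff_dvd_diff algebra_simps)
          then show ?thesis
            using x m by (simp add: compose_eq residue_shift_def disp_def shift_pt)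
        qed (simp add: compose_def residue_shift_def disp_def)
      qed
      then show ?thesis
        using perm_subgroup_compose[OF P(1) sP perm_subgroup_compose[OF P(1) r0 sP]] by metis
    next
      case False
      then have "residue_shift i e r = (\<lambda>x\<in>X. x)" by (rule residue_shift_out_of_range)
      then show ?thesis using perm_subgroup_id[OF P(1)] by (simp only:)
    qed
  qed
  define c :: "int \<Rightarrow> nat" where "c a = (if a mod int p ^ k i = r then 1 else 0)" for a
  have cm: "c (l x mod int p ^ e) = (if l x mod int p ^ k i = r then 1 else 0)" for x
    unfolding c_def by (simp add: mod_mod_cancel[OF le_imp_power_dvd[OF \<open>k i \<le> e\<close>]])
  have "disp (\<lambda>x. int p ^ (i - 1) * int (c (l x mod int p ^ e))) \<in> P"
    by (rule residue_shifts_generate[OF P(1) e i_le gen])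
  moreover have "disp (\<lambda>x. int p ^ (i - 1) * int (c (l x mod int p ^ e))) = residue_shift i (k i) r"
    unfolding residue_shift_def cm by (rule arg_cong[where f=disp]) auto
  ultimately show ?thesis by simp
qed


text \<open>The group \<open>G \<inter> key_perms full_key\<close> is a \<open>p\<close>-group that contains the Sylow subgroup \<open>P\<close>.\<close>

lemma sylow_eq_Int:
  assumes G: "subgroup G (BijGroup X)" and P: "subgroup P (BijGroup X)" "P \<subseteq> G"
    "card P = p ^ multiplicity p (card G)" "shift 1 \<in> P"
  shows "P = G \<inter> key_perms full_key"
proof -
  let ?Q = "G \<inter> key_perms full_key"
  have finG: "finite G" using perm_subgroup_mem[OF G] finite_Bij[OF finite_X] by (meson finite_subset subsetI)
  have PQ: "P \<subseteq> ?Q" using p_group_full_key[OF P(1,4,3)] P(2) by blast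
  have Q: "subgroup ?Q (BijGroup X)"
    by (rule group.subgroups_Inter_pair[OF group_BijGroup G subgroup_key_perms[OF valid_full_key]])
  then obtain t where t: "card ?Q = p ^ t" using subgroup_full_key_prime_power by blast
  have p1: "p > 1" using prime_p prime_gt_1_nat by blast
  interpret G: group "perm_grp X G" by (rule perm_subgroup_group[OF G])
  have "card ?Q dvd card G"
    using G.lagrange[OF perm_subgroup_mono[OF Q G]] by (metis Int_lower1 dvd_triv_right order_def
        partial_object.select_convs(1) partial_object.surjective partial_object.update_convs(1))
  moreover have "card G \<noteq> 0" using finG perm_subgroup_id[OF G] by auto
  ultimately have "t \<le> multiplicity p (card G)"
    unfolding t using p1 by (subst (asm) power_dvd_iff_le_multiplicity) auto
  then have "card ?Q \<le> card P" unfolding t P(3) using p1 by (simp add: power_increasing)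
  then show ?thesis using PQ finG by (intro card_seteq) auto
qed

text \<open>
  For each \<open>i\<close>, the key of the Sylow subgroup \<open>P\<close> is the least \<open>k\<close> such that the displacement modulo
  \<open>p\<^sup>i\<close> of every element of \<open>P\<close> only depends on the point modulo \<open>p\<^sup>k\<close>.
\<close>

theorem sylow_eq_key_perms:
  assumes p3: "p \<ge> 3" and G: "subgroup G (BijGroup X)" "five_halves_closed X G"
    and P: "subgroup P (BijGroup X)" "P \<subseteq> G"
      "card P = p ^ multiplicity p (card G)" "shift 1 \<in> P"
  obtains k where "k \<in> primary_keys n" "valid_key k" "mono_key k" "P = key_perms k"
proof -
  note PG = sylow_eq_Int[OF G(1) P]
  have PW: "P \<subseteq> key_perms full_key" using PG by blast
  define adm where "adm i k \<longleftrightarrow> (\<forall>f\<in>P. \<forall>x\<in>X. \<forall>y\<in>X. [l x = l y] (mod int p ^ k) \<longrightarrow>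
    [l (f x) - l (f y) = l x - l y] (mod int p ^ i))" for i k
  define k where "k = (\<lambda>i\<in>{1..n}. LEAST k. adm i k)"
  have adm0: "adm i (i - 1)" if "i \<in> {1..n}" for i
    unfolding adm_def
  proof (intro ballI impI)
    fix f x y assume f: "f \<in> P" and x: "x \<in> X" "y \<in> X" "[l x = l y] (mod int p ^ (i - 1))"
    have "key_map full_key f" using f PW by (auto simp: key_perms_def)
    from key_mapD[OF this that x(1,2)] x(3)
    show "[l (f x) - l (f y) = l x - l y] (mod int p ^ i)" by (simp add: full_key_def)
  qed
  have k: "adm i (k i)" "k i \<le> i - 1" if "i \<in> {1..n}" for i
    using that LeastI[of "adm i", OF adm0[OF that]] Least_le[of "adm i", OF adm0[OF that]]
    by (auto simp: k_def)
  have least: "\<not> adm i e" if "i \<in> {1..n}" "e < k i" for i e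
    using that not_less_Least[of e "adm i"] by (simp add: k_def)
  have "k i \<le> k j" if ij: "i \<in> {1..n}" "j \<in> {1..n}" "i \<le> j" for i j
  proof (rule ccontr)
    assume "\<not> k i \<le> k j"
    moreover have "adm i (k j)" using k(1)[OF ij(2)] cong_le[OF _ ij(3)] unfolding adm_def by blast
    ultimately show False using least[OF ij(1), of "k j"] by simp
  qed
  then have mk: "mono_key k" by (simp add: mono_key_def)
  have vk: "valid_key k" unfolding valid_key_def
  proof
    fix i assume "i \<in> {1..n}"
    then show "k i < i" using k(2)[of i] by auto
  qed
  have pk: "k \<in> primary_keys n"
    using vk mk by (auto simp: primary_keys_def valid_key_def mono_key_def k_def)
  have Pk: "P \<subseteq> key_perms k"
  proof
    fix f assume f: "f \<in> P"
    have fB: "f \<in> Bij X" by (rule perm_subgroup_mem[OF P(1) f])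
    then show "f \<in> key_perms k"
      using k(1) f Bij_image[OF fB] by (auto simp: key_perms_def key_map_def adm_def)
  qed
  have "residue_shift i (k i) r \<in> P" if i: "i \<in> {1..n}"
    and higher: "\<And>j r. i < j \<Longrightarrow> j \<le> n \<Longrightarrow> residue_shift j (k j) r \<in> P" for i r
  proof (rule level_residue_shift[OF p3 P(1) PW P(4) vk mk Pk i _ _ higher])
    show "\<exists>f\<in>P. \<exists>x\<in>X. \<exists>y\<in>X. [l x = l y] (mod int p ^ e) \<and>
        \<not> [l (f x) - l (f y) = l x - l y] (mod int p ^ i)" if "e < k i" for e
      using least[OF i that] unfolding adm_def by blast
    fix e g assume e: "e \<le> i - 1"
      and E: "{x \<in> X. int p ^ e dvd l x} \<in> fixer_block_system X P (blocks (i - 1))"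
      and g: "g \<in> P"
      and gl: "\<And>x. x \<in> X \<Longrightarrow> int p ^ e dvd l x \<Longrightarrow> [l (g x) = l x] (mod int p ^ (i - 1))"
    let ?E = "{x \<in> X. int p ^ e dvd l x}"
    have i1: "i - 1 \<le> n" using i by auto
    have "g ` B = B" if B: "B \<in> blocks (i - 1)" "B \<subseteq> ?E" for B
    proof -
      obtain x where x: "x \<in> X" "B = cls (i - 1) x" using B(1) by (auto simp: blocks_def)
      then have "x \<in> ?E" using B(2) by (auto simp: mem_cls)
      then show ?thesis
        using image_cls[OF subsetD[OF PW g] i1 x(1)] cls_eq[OF gl[OF x(1)]] x(2) by simp
    qed
    then have "perm_restrict X g ?E \<in> G"
      using G(2) P(2) transitive_of_shift[OF P(1,4)] normal_block_system_blocks[OF P(1) PW P(4) i1] E g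
      unfolding five_halves_closed_def by blast
    moreover have "perm_restrict X g ?E \<in> key_perms full_key"
    proof (rule perm_restrict_key_perms[OF valid_full_key subsetD[OF PW g]])
      fix j x y assume x: "x \<in> X" "x \<in> ?E" and y: "y \<in> X" "y \<notin> ?E"
        and c: "[l x = l y] (mod int p ^ full_key j)"
      have "j - 1 < e"
      proof (rule ccontr)
        assume "\<not> j - 1 < e"
        then have "[l x = l y] (mod int p ^ e)" using cong_le[OF c, of e] by (simp add: full_key_def)
        then show False using x y by (simp add: cong_dvd_iff)
      qed
      then show "[l (g x) = l x] (mod int p ^ j)"
        using e x by (intro cong_le[OF gl[OF x(1)]]) auto
    qed
    ultimately show "perm_restrict X g ?E \<in> P" using PG by blast
  qed
  then have step: "\<forall>r. residue_shift i (k i) r \<in> P" if "i \<in> {1..n}"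
      "\<forall>j r. i < j \<longrightarrow> j \<le> n \<longrightarrow> residue_shift j (k j) r \<in> P" for i
    using that by blast
  have "\<forall>j r. i < j \<longrightarrow> j \<le> n \<longrightarrow> residue_shift j (k j) r \<in> P" if "i \<le> n" for i
    using that
  proof (induction rule: inc_induct)
    case (step i)
    have "\<forall>r. residue_shift (Suc i) (k (Suc i)) r \<in> P"
      by (rule \<open>\<And>i. i \<in> {1..n} \<Longrightarrow> _ \<Longrightarrow> \<forall>r. residue_shift i (k i) r \<in> P\<close>) (use step in auto)
    then show ?case using step.IH by (metis Suc_lessI)
  qed simp
  then have all: "residue_shift j (k j) r \<in> P" if "0 < j" "j \<le> n" for j r using that by blast
  have "key_perms k \<subseteq> P"
  proof
    fix h assume h: "h \<in> key_perms k"
    show "h \<in> P" by (rule key_perms_generated[OF vk mk P(1) le0 all h]) auto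
  qed
  then show thesis using that[OF pk vk mk] Pk by blast
qed

section \<open>The groups \<open>\<Pi>(k)\<close>\<close>

lemma compose_shift: "compose X (shift a) (shift b) = shift (a + b)"
  unfolding shift_def by (subst compose_disp[of 0]) (auto simp: add.commute)

lemma shift_zero: "shift 0 = (\<lambda>x\<in>X. x)"
  unfolding shift_def by (rule disp_zero)

lemma shift_Bij: "shift a \<in> Bij X"
  using shift_key_perms[OF valid_full_key] by (auto simp: key_perms_def)

lemma shift_pow: "shift a [^]\<^bsub>BijGroup X\<^esub> (m::nat) = shift (int m * a)"
proof (induction m)
  case 0
  show ?case by (simp only: nat_pow_0 BijGroup_one shift_zero of_nat_0 mult_zero_left)
next
  case (Suc m)
  have "shift a [^]\<^bsub>BijGroup X\<^esub> Suc m = compose X (shift (int m * a)) (shift a)"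
    by (simp only: nat_pow_Suc Suc BijGroup_mult[OF shift_Bij shift_Bij])
  then show ?case by (simp add: compose_shift algebra_simps)
qed

lemma orbits_shift_pow:
  assumes j: "j \<le> n"
  shows "perm_orbits X (generate (BijGroup X) {shift 1 [^]\<^bsub>BijGroup X\<^esub> (p ^ j)}) = blocks j"
proof -
  define q where "q = int p ^ j"
  define A where "A = generate (BijGroup X) {shift q}"
  interpret B: group "BijGroup X" by (rule group_BijGroup)
  have A: "subgroup A (BijGroup X)" unfolding A_def by (rule B.generate_is_subgroup) (simp add: shift_Bij)
  have mem: "shift (int m * q) \<in> A" for m
    using perm_subgroup_pow[OF A, of "shift q" m] unfolding shift_pow
    by (simp add: A_def generate.incl)
  define T where "T = range (\<lambda>z. shift (z * q))"
  have "subgroup T (BijGroup X)"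
  proof (rule perm_subgroupI_finite[OF finite_X])
    show "T \<subseteq> Bij X" by (auto simp: T_def shift_Bij)
    show "(\<lambda>x\<in>X. x) \<in> T"
      unfolding T_def by (rule range_eqI[where x=0]) (simp only: mult_zero_left shift_zero)
    fix f g assume "f \<in> T" "g \<in> T"
    then obtain z z' where "f = shift (z * q)" "g = shift (z' * q)" unfolding T_def by blast
    then have "compose X f g = shift ((z + z') * q)" by (simp add: compose_shift distrib_right)
    then show "compose X f g \<in> T" unfolding T_def by (rule range_eqI)
  qed
  moreover have "shift q \<in> T" unfolding T_def by (rule range_eqI[where x=1]) simp
  ultimately have AT: "A \<subseteq> T" unfolding A_def by (intro B.generate_subgroup_incl) auto
  have "(\<lambda>g. g x) ` A = cls j x" if x: "x \<in> X" for x
  proof (intro equalityI subsetI)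
    fix y assume "y \<in> (\<lambda>g. g x) ` A"
    then obtain z where y: "y = shift (z * q) x" using AT unfolding T_def by blast
    have "[l y = l x + z * q] (mod int p ^ j)" unfolding y by (rule l_shift[OF x j])
    also have "[l x + z * q = l x + 0] (mod int p ^ j)"
      by (intro cong_add) (auto simp: cong_0_iff q_def)
    finally show "y \<in> cls j x" using x by (simp add: mem_cls y)
  next
    fix y assume y: "y \<in> cls j x"
    then obtain z where z: "l y - l x = q * z" by (auto simp: mem_cls cong_iff_dvd_diff q_def)
    define m where "m = nat (z mod int p ^ n)"
    have "int m = z mod int p ^ n" using pow_pos[of n] by (simp add: m_def)
    then have "[int m = z] (mod int p ^ n)" by (simp add: cong_def)
    then have "[l x + int m * q = l x + z * q] (mod int p ^ n)"
      by (intro cong_add cong_mult cong_refl)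
    also have "l x + z * q = l y" using z by (simp add: algebra_simps)
    finally have "pt (l x + int m * q) = pt (l y)" by (simp only: pt_eq_iff)
    then have "y = shift (int m * q) x" using x y by (simp add: shift_def disp_def mem_cls)
    then show "y \<in> (\<lambda>g. g x) ` A" using mem by blast
  qed
  then have "perm_orbits X A = blocks j" unfolding perm_orbits_alt blocks_def by (simp cong: image_cong)
  moreover have "shift 1 [^]\<^bsub>BijGroup X\<^esub> (p ^ j) = shift q" unfolding shift_pow q_def by simp
  ultimately show ?thesis unfolding A_def by simp
qed

lemma perm_restrict_shift_cls:
  "perm_restrict X (shift (int p ^ (i - 1))) (cls j x) = residue_shift i j (l x mod int p ^ j)"
  by (auto simp: perm_restrict_def shift_def disp_def residue_shift_def fun_eq_iff mem_cls cong_def)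

lemma residue_shift_key_perms:
  assumes "valid_key k" "mono_key k" "i \<in> {1..n}"
  shows "residue_shift i (k i) r \<in> key_perms k"
  unfolding residue_shift_def by (rule disp_level_key_perms[OF assms]) (auto simp: cong_def)

lemma generate_restricted_shifts:
  assumes k: "valid_key k" "mono_key k"
  shows "generate (BijGroup X) (\<Union>i\<in>{1..n}. generate (BijGroup X)
    {perm_restrict X (shift 1 [^]\<^bsub>BijGroup X\<^esub> (p ^ (i - 1))) B | B. B \<in> blocks (k i)}) = key_perms k"
    (is "generate _ (\<Union>i\<in>_. ?P i) = _")
proof -
  interpret B: group "BijGroup X" by (rule group_BijGroup)
  have gens: "{perm_restrict X (shift 1 [^]\<^bsub>BijGroup X\<^esub> (p ^ (i - 1))) B | B. B \<in> blocks (k i)}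
      = (\<lambda>x. residue_shift i (k i) (l x mod int p ^ k i)) ` X" for i
  proof -
    have "{perm_restrict X (shift (int p ^ (i - 1))) B | B. B \<in> blocks (k i)}
        = (\<lambda>x. perm_restrict X (shift (int p ^ (i - 1))) (cls (k i) x)) ` X"
      unfolding blocks_def by blast
    also have "\<dots> = (\<lambda>x. residue_shift i (k i) (l x mod int p ^ k i)) ` X"
      by (rule image_cong[OF refl]) (rule perm_restrict_shift_cls)
    finally show ?thesis unfolding shift_pow by simp
  qed
  have Pk: "?P i \<subseteq> key_perms k" if "i \<in> {1..n}" for i
    unfolding gens using residue_shift_key_perms[OF k that]
    by (intro B.generate_subgroup_incl subgroup_key_perms k) auto
  have UP: "(\<Union>i\<in>{1..n}. ?P i) \<subseteq> key_perms k" by (rule UN_least[OF Pk])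
  have sub: "key_perms k \<subseteq> Bij X" by (auto simp: key_perms_def)
  define Q where "Q = generate (BijGroup X) (\<Union>i\<in>{1..n}. ?P i)"
  have Q: "subgroup Q (BijGroup X)"
    unfolding Q_def by (rule B.generate_is_subgroup) (simp only: carrier_BijGroup subset_trans[OF UP sub])
  have "residue_shift j (k j) r \<in> Q" if j: "0 < j" "j \<le> n" for j r
  proof (cases "0 \<le> r \<and> r < int p ^ k j")
    case True
    have j': "j \<in> {1..n}" using j by simp
    then have kj: "k j \<le> n" using valid_keyD[OF k(1) j'] by simp
    have "l (pt r) mod int p ^ k j = r"
      using cong_l_pt[OF kj, of r] True by (simp add: cong_def)
    then have "residue_shift j (k j) r \<in> (\<lambda>x. residue_shift j (k j) (l x mod int p ^ k j)) ` X"
      by (intro image_eqI[OF _ pt_in[of r]]) simp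
    then have "residue_shift j (k j) r \<in> ?P j" unfolding gens by (rule generate.incl)
    then show ?thesis unfolding Q_def using j' by (intro generate.incl) blast
  next
    case False
    then have "residue_shift j (k j) r = (\<lambda>x\<in>X. x)" by (rule residue_shift_out_of_range)
    then show ?thesis using perm_subgroup_id[OF Q] by (simp only:)
  qed
  note all = this
  have "key_perms k \<subseteq> Q"
  proof
    fix h assume h: "h \<in> key_perms k"
    show "h \<in> Q" by (rule key_perms_generated[OF k Q le0 all h]) auto
  qed
  moreover have "Q \<subseteq> key_perms k"
    unfolding Q_def by (rule B.generate_subgroup_incl[OF UP subgroup_key_perms[OF k(1)]])
  ultimately show ?thesis unfolding Q_def by blast
qed

text \<open>Up to permutation isomorphism, \<open>key_perms k\<close> does not depend on the labelled set.\<close>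

lemma perm_isomorphic_key_perms:
  fixes Y :: "'b set"
  assumes Y: "cyclic_labelling p n Y l'" and k: "valid_key k"
  shows "perm_isomorphic X (key_perms k) Y (cyclic_labelling.key_perms p n Y l' k)"
proof -
  interpret Y: cyclic_labelling p n Y l' by (rule Y)
  have vk': "Y.valid_key k" using k by (simp add: valid_key_def Y.valid_key_def)
  define to where "to x = Y.pt (l x)" for x
  define ret where "ret y = pt (l' y)" for y
  have l_to: "l' (to x) = l x" if "x \<in> X" for x using l_range[OF that] by (simp add: to_def Y.l_pt)
  have l_ret: "l (ret y) = l' y" if "y \<in> Y" for y using Y.l_range[OF that] by (simp add: ret_def l_pt)
  have to_in: "to x \<in> Y" and ret_in: "ret y \<in> X" for x y by (simp_all add: to_def ret_def)
  have ret_to: "ret (to x) = x" if "x \<in> X" for x using that l_to[OF that] by (simp add: ret_def)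
  have to_ret: "to (ret y) = y" if "y \<in> Y" for y using that l_ret[OF that] by (simp add: to_def)
  define \<phi> where "\<phi> f = (\<lambda>y\<in>Y. to (f (ret y)))" for f
  define \<psi> where "\<psi> f = (\<lambda>x\<in>X. ret (f (to x)))" for f
  have \<phi>: "\<phi> f \<in> Y.key_perms k" if f: "f \<in> key_perms k" for f
  proof (rule Y.key_map_Bij[OF vk'])
    have fk: "key_map k f" using f by (simp add: key_perms_def)
    show "\<phi> f \<in> extensional Y" by (simp add: \<phi>_def)
    show "Y.key_map k (\<phi> f)"
      unfolding Y.key_map_def
    proof (intro conjI ballI impI)
      show "\<phi> f ` Y \<subseteq> Y" by (auto simp: \<phi>_def to_in)
      fix i y z assume i: "i \<in> {1..n}" and yz: "y \<in> Y" "z \<in> Y" "[l' y = l' z] (mod int p ^ k i)"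
      show "[l' (\<phi> f y) - l' (\<phi> f z) = l' y - l' z] (mod int p ^ i)"
        using key_mapD[OF fk i ret_in[of y] ret_in[of z]] yz key_map_in[OF fk ret_in]
        by (simp add: \<phi>_def l_ret l_to)
    qed
  qed
  have \<psi>: "\<psi> f \<in> key_perms k" if f: "f \<in> Y.key_perms k" for f
  proof (rule key_map_Bij[OF k])
    have fk: "Y.key_map k f" using f by (simp add: Y.key_perms_def)
    show "\<psi> f \<in> extensional X" by (simp add: \<psi>_def)
    show "key_map k (\<psi> f)"
      unfolding key_map_def
    proof (intro conjI ballI impI)
      show "\<psi> f ` X \<subseteq> X" by (auto simp: \<psi>_def ret_in)
      fix i x z assume i: "i \<in> {1..n}" and xz: "x \<in> X" "z \<in> X" "[l x = l z] (mod int p ^ k i)"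
      show "[l (\<psi> f x) - l (\<psi> f z) = l x - l z] (mod int p ^ i)"
        using Y.key_mapD[OF fk i to_in[of x] to_in[of z]] xz Y.key_map_in[OF fk to_in]
        by (simp add: \<psi>_def l_ret l_to)
    qed
  qed
  have KB: "f \<in> Bij X" if "f \<in> key_perms k" for f using that by (simp add: key_perms_def)
  have KB': "f \<in> Bij Y" if "f \<in> Y.key_perms k" for f using that by (simp add: Y.key_perms_def)
  have \<psi>\<phi>: "\<psi> (\<phi> f) = f" if f: "f \<in> key_perms k" for f
    by (rule Bij_eqI[OF KB[OF \<psi>[OF \<phi>[OF f]]] KB[OF f]])
      (simp add: \<psi>_def \<phi>_def to_in ret_to Bij_app[OF KB[OF f]])
  have \<phi>\<psi>: "\<phi> (\<psi> f) = f" if f: "f \<in> Y.key_perms k" for f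
    by (rule Bij_eqI[OF KB'[OF \<phi>[OF \<psi>[OF f]]] KB'[OF f]])
      (simp add: \<psi>_def \<phi>_def ret_in to_ret Bij_app[OF KB'[OF f]])
  have bij: "bij_betw \<phi> (key_perms k) (Y.key_perms k)"
    by (rule bij_betw_byWitness[where f'=\<psi>]) (use \<phi> \<psi> \<phi>\<psi> \<psi>\<phi> in auto)
  have hom: "\<phi> (compose X f g) = compose Y (\<phi> f) (\<phi> g)" if "f \<in> key_perms k" "g \<in> key_perms k" for f g
    by (rule ext) (simp add: compose_def \<phi>_def ret_in to_in ret_to Bij_app[OF KB[OF that(2)]])
  have "\<phi> \<in> iso (perm_grp X (key_perms k)) (perm_grp Y (Y.key_perms k))"
    using bij hom \<phi> KB KB' by (simp add: iso_def hom_def BijGroup_mult)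
  moreover have "bij_betw to X Y"
    by (rule bij_betw_byWitness[where f'=ret]) (use to_in ret_in to_ret ret_to in auto)
  moreover have "to (f x) = \<phi> f (to x)" if "x \<in> X" for f x
    using that by (simp add: \<phi>_def to_in ret_to)
  ultimately show ?thesis unfolding perm_isomorphic_def by blast
qed

end

lemma Zmod_eq:
  assumes "prime p"
  shows "Zmod (p ^ n) = {0..<int p ^ n}"
  using assms prime_gt_0_nat[of p] by (simp add: carrier_integer_mod_group)

lemma cyclic_labelling_Zmod:
  assumes "prime p"
  shows "cyclic_labelling p n (Zmod (p ^ n)) (\<lambda>x. x)"
  by unfold_locales (simp_all add: assms Zmod_eq bij_betw_def)

lemma Pi_key_eq_key_perms:
  assumes p: "prime p" and k: "k \<in> primary_keys n"
  shows "Pi_key p n k = cyclic_labelling.key_perms p n (Zmod (p ^ n)) (\<lambda>x. x) k"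
proof -
  interpret Z: cyclic_labelling p n "Zmod (p ^ n)" "\<lambda>x. x" by (rule cyclic_labelling_Zmod[OF p])
  have kn: "k i < i" if "i \<in> {1..n}" for i using k that by (simp add: primary_keys_def)
  have vk: "Z.valid_key k" using kn by (simp add: Z.valid_key_def)
  have "k i \<le> k j" if "1 \<le> i" "i \<le> j" "j \<le> n" for i j
    using that(2,3)
  proof (induction rule: dec_induct)
    case (step j)
    have "Suc j \<in> {2..n}" using step that(1) by simp
    then have "k (Suc j - 1) \<le> k (Suc j)" using k unfolding primary_keys_def by blast
    then show ?case using step by simp
  qed simp
  then have mk: "Z.mono_key k" by (simp add: Z.mono_key_def)
  have tau: "tau (p ^ n) = Z.shift 1"
    using Z.l_pt by (simp add: tau_def Z.shift_def Z.disp_def)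
  have "coset_blocks p n (n - j) = Z.blocks j" if "j \<le> n" for j
    using Z.orbits_shift_pow[OF that] that by (simp add: coset_blocks_def tau)
  then have "P_key p n i (k i) = generate (BijGroup (Zmod (p ^ n)))
      {perm_restrict (Zmod (p ^ n)) (Z.shift 1 [^]\<^bsub>BijGroup (Zmod (p ^ n))\<^esub> (p ^ (i - 1))) B | B.
        B \<in> Z.blocks (k i)}" if "i \<in> {1..n}" for i
    using kn[OF that] that by (simp add: P_key_def tau)
  then show ?thesis
    unfolding Pi_key_def using Z.generate_restricted_shifts[OF vk mk] by simp
qed

section \<open>Regular cyclic groups\<close>

text \<open>A regular cyclic group of prime power degree gives a labelling for which a generator is
  the shift by one.\<close>

lemma regular_cyclic_labelling:
  assumes p: "prime p" and X: "finite X" "card X = p ^ n"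
    and C: "regular_perm_grp X C" "cyclic_group (perm_grp X C)"
  obtains c l where "c \<in> C" "c [^]\<^bsub>BijGroup X\<^esub> (p ^ n) = \<one>\<^bsub>BijGroup X\<^esub>"
    "cyclic_labelling p n X l" "\<forall>x\<in>X. l (c x) = (l x + 1) mod int p ^ n"
proof -
  have CB: "subgroup C (BijGroup X)" and tr: "\<And>x y. x \<in> X \<Longrightarrow> y \<in> X \<Longrightarrow> \<exists>g\<in>C. g x = y"
    using C(1) by (auto simp: regular_perm_grp_def transitive_perm_grp_iff)
  interpret C: group "perm_grp X C" by (rule perm_subgroup_group[OF CB])
  have N0: "p ^ n > 0" using p prime_gt_0_nat by simp
  then obtain x0 where x0: "x0 \<in> X" using X by fastforce
  have CX: "g x \<in> X" if "g \<in> C" "x \<in> X" for g x by (rule perm_subgroup_app[OF CB that])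
  have st: "g = (\<lambda>x\<in>X. x)" if "g \<in> C" "g x0 = x0" for g
  proof -
    have "stabilizer (perm_grp X C) (\<lambda>g. g) x0 = {\<one>\<^bsub>BijGroup X\<^esub>}"
      using C(1) x0 by (auto simp: regular_perm_grp_def)
    then show ?thesis using that unfolding stabilizer_def BijGroup_one by auto
  qed
  have "inj_on (\<lambda>g. g x0) C"
  proof (rule inj_onI)
    fix g h assume g: "g \<in> C" "h \<in> C" "g x0 = h x0"
    have gB: "g \<in> Bij X" "h \<in> Bij X" using g perm_subgroup_mem[OF CB] by auto
    define h' where "h' = inv\<^bsub>BijGroup X\<^esub> h"
    have h': "h' \<in> C" unfolding h'_def by (rule perm_subgroup_inv[OF CB g(2)])
    have "compose X h' g x0 = x0"
      using x0 BijGroup_inv_apply(1)[OF gB(2) x0] g(3) by (simp add: compose_eq h'_def)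
    then have id: "compose X h' g = (\<lambda>x\<in>X. x)" by (rule st[OF perm_subgroup_compose[OF CB h' g(1)]])
    show "g = h"
    proof (rule Bij_eqI[OF gB])
      fix x assume x: "x \<in> X"
      have "h' (g x) = x" using fun_cong[OF id, of x] x by (simp add: compose_eq)
      then show "g x = h x" using BijGroup_inv_apply(2)[OF gB(2) CX[OF g(1) x]] by (simp add: h'_def)
    qed
  qed
  moreover have "(\<lambda>g. g x0) ` C = X" using tr[OF x0] CX x0 by blast
  ultimately have cardC: "card C = p ^ n" using card_image X(2) by metis
  obtain c where c: "c \<in> C" and Cc: "C = range (\<lambda>z::int. c [^]\<^bsub>perm_grp X C\<^esub> z)"
    using C(2) unfolding C.cyclic_group by auto
  have cB: "c \<in> Bij X" by (rule perm_subgroup_mem[OF CB c])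
  have cN: "c [^]\<^bsub>perm_grp X C\<^esub> (p ^ n) = \<one>\<^bsub>perm_grp X C\<^esub>"
    using C.pow_order_eq_1[of c] c cardC by (simp add: order_def)
  then have cN': "c [^]\<^bsub>BijGroup X\<^esub> (p ^ n) = \<one>\<^bsub>BijGroup X\<^esub>" by (simp add: perm_grp_pow)
  have cNx: "(c ^^ (p ^ n)) x = x" if "x \<in> X" for x
    using BijGroup_pow_apply[OF cB that, of "p ^ n"] that by (simp add: cN' BijGroup_one)
  define h where "h m = (c ^^ m) x0" for m
  have "h ` {..<p ^ n} = X"
  proof (intro equalityI subsetI)
    fix y assume "y \<in> h ` {..<p ^ n}"
    moreover have "(c ^^ m) x0 \<in> X" for m by (induction m) (auto intro: x0 CX[OF c])
    ultimately show "y \<in> X" by (auto simp: h_def)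
  next
    fix y assume y: "y \<in> X"
    obtain g where "g \<in> C" "g x0 = y" using tr[OF x0 y] by blast
    moreover from this(1) obtain z :: int where "g = c [^]\<^bsub>perm_grp X C\<^esub> z" by (subst (asm) Cc) blast
    ultimately have z: "(c [^]\<^bsub>perm_grp X C\<^esub> z) x0 = y" by simp
    define m where "m = nat (z mod int (p ^ n))"
    have m: "z = int (p ^ n) * (z div int (p ^ n)) + int m" using N0 by (simp add: m_def)
    have "c [^]\<^bsub>perm_grp X C\<^esub> (int (p ^ n) * (z div int (p ^ n))) = \<one>\<^bsub>perm_grp X C\<^esub>"
      using C.int_pow_pow[of c "int (p ^ n)" "z div int (p ^ n)", symmetric] c cN
        C.int_pow_one[of "z div int (p ^ n)"]
      by (simp add: int_pow_int del: of_nat_power)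
    then have "c [^]\<^bsub>perm_grp X C\<^esub> z = c [^]\<^bsub>perm_grp X C\<^esub> m"
      using C.int_pow_mult[of c "int (p ^ n) * (z div int (p ^ n))" "int m"] c m
        C.l_one[OF C.nat_pow_closed[of c m]]
      by (simp add: int_pow_int del: of_nat_power)
    then have "y = h m" using z BijGroup_pow_apply[OF cB x0, of m] by (simp add: h_def perm_grp_pow)
    moreover have "m < p ^ n" using N0 by (simp add: m_def nat_less_iff del: of_nat_power)
    ultimately show "y \<in> h ` {..<p ^ n}" by blast
  qed
  moreover from this have "inj_on h {..<p ^ n}" using X(2) by (intro eq_card_imp_inj_on) simp_all
  ultimately have h: "bij_betw h {..<p ^ n} X" by (simp add: bij_betw_def)
  define l where "l x = int (the_inv_into {..<p ^ n} h x)" for x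
  have lh: "l (h m) = int m" if "m < p ^ n" for m
    using the_inv_into_f_f[OF bij_betw_imp_inj_on[OF h], of m] that by (simp add: l_def)
  have "bij_betw (\<lambda>m. int m) {..<p ^ n} {0..<int p ^ n}"
  proof (rule bij_betw_byWitness[where f'=nat])
    show "nat ` {0..<int p ^ n} \<subseteq> {..<p ^ n}" by (auto simp: nat_less_iff)
  qed (auto simp flip: of_nat_power)
  then have "bij_betw l X {0..<int p ^ n}"
    using bij_betw_trans[OF bij_betw_the_inv_into[OF h]] unfolding l_def o_def by blast
  then have lab: "cyclic_labelling p n X l" using p by (simp add: cyclic_labelling_def)
  have "l (c x) = (l x + 1) mod int p ^ n" if "x \<in> X" for x
  proof -
    obtain m where m: "m < p ^ n" "x = h m" using h \<open>x \<in> X\<close> by (auto simp: bij_betw_def)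
    show ?thesis
    proof (cases "Suc m < p ^ n")
      case True
      then have "l (c x) = int (Suc m)" using lh[OF True] m by (simp add: h_def)
      then show ?thesis using True lh[OF m(1)] m(2) by (simp flip: of_nat_power of_nat_Suc)
    next
      case False
      then have e: "Suc m = p ^ n" using m(1) by simp
      then have "c x = h 0" using m(2) cNx[OF x0] by (simp add: h_def flip: e)
      then have "l (c x) = 0" using lh[OF N0] by simp
      moreover have "l x + 1 = int (p ^ n)" using lh[OF m(1)] m(2) by (simp flip: e)
      ultimately show ?thesis by simp
    qed
  qed
  then show thesis using that c cN' lab by blast
qed

theorem theorem5p11:
  fixes p n :: nat and G P :: "(int \<Rightarrow> int) set"
  assumes "prime p" and "p \<ge> 3" and "n \<ge> 1"
    and "subgroup G (BijGroup (Zmod (p ^ n)))"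
    and "five_halves_closed (Zmod (p ^ n)) G"
    and "\<exists>C\<subseteq>G. regular_perm_grp (Zmod (p ^ n)) C \<and> cyclic_group (perm_grp (Zmod (p ^ n)) C)"
    and "sylow_subgroup p P (perm_grp (Zmod (p ^ n)) G)"
  shows "(\<exists>k\<in>primary_keys n.
            perm_isomorphic (Zmod (p ^ n)) P (Zmod (p ^ n)) (Pi_key p n k)) \<and>
         five_halves_closed (Zmod (p ^ n)) P"
proof -
  define X where "X = Zmod (p ^ n)"
  note p = assms(1) and G = assms(4)[folded X_def] and Gc = assms(5)[folded X_def]
  obtain C where C: "C \<subseteq> G" "regular_perm_grp X C" "cyclic_group (perm_grp X C)"
    using assms(6) unfolding X_def by blast
  have finX: "finite X" and cardX: "card X = p ^ n"
    unfolding X_def Zmod_eq[OF p] by (simp_all flip: of_nat_power)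
  obtain c l where c: "c \<in> C" "c [^]\<^bsub>BijGroup X\<^esub> (p ^ n) = \<one>\<^bsub>BijGroup X\<^esub>"
    and l: "cyclic_labelling p n X l" "\<forall>x\<in>X. l (c x) = (l x + 1) mod int p ^ n"
    by (rule regular_cyclic_labelling[OF p finX cardX C(2,3)])
  have cG: "c \<in> G" using c C by blast
  have P: "subgroup P (perm_grp X G)" "card P = p ^ multiplicity p (card G)"
    using assms(7) by (simp_all add: sylow_subgroup_def X_def order_def)
  have PB: "subgroup P (BijGroup X)" by (rule subgroup_of_perm_grp[OF G P(1)])
  have PG: "P \<subseteq> G" using subgroup.subset[OF P(1)] by simp
  have finG: "finite G"
    using perm_subgroup_mem[OF G] finite_Bij[OF finX] by (meson finite_subset subsetI)
  interpret G: group "perm_grp X G" by (rule perm_subgroup_group[OF G])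
  have idx: "\<not> p dvd card (rcosets\<^bsub>perm_grp X G\<^esub> P)"
  proof
    assume "p dvd card (rcosets\<^bsub>perm_grp X G\<^esub> P)"
    then have "p * card P dvd card (rcosets\<^bsub>perm_grp X G\<^esub> P) * card P" by (rule mult_dvd_mono) simp
    also have "card (rcosets\<^bsub>perm_grp X G\<^esub> P) * card P = card G"
      using G.lagrange[OF P(1)] by (simp add: order_def)
    finally have "p ^ Suc (multiplicity p (card G)) dvd card G" by (simp only: P(2) power_Suc)
    moreover have "card G \<noteq> 0" using finG cG by auto
    ultimately have "Suc (multiplicity p (card G)) \<le> multiplicity p (card G)"
      using prime_gt_1_nat[OF p] by (subst (asm) power_dvd_iff_le_multiplicity) auto
    then show False by simp
  qed
  \<comment> \<open>Some conjugate of the generator \<open>c\<close> of the regular cyclic subgroup lies in \<open>P\<close>.\<close>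
  obtain g where g: "g \<in> carrier (perm_grp X G)"
      "g \<otimes>\<^bsub>perm_grp X G\<^esub> c \<otimes>\<^bsub>perm_grp X G\<^esub> inv\<^bsub>perm_grp X G\<^esub> g \<in> P"
    by (rule G.conj_in_of_index_coprime[OF _ p P(1) idx, of c n])
      (use finG cG c(2) in \<open>auto simp: perm_grp_pow\<close>)
  define g' where "g' = inv\<^bsub>BijGroup X\<^esub> g"
  define c' where "c' = g \<otimes>\<^bsub>BijGroup X\<^esub> c \<otimes>\<^bsub>BijGroup X\<^esub> g'"
  have gG: "g \<in> G" using g(1) by simp
  have c'P: "c' \<in> P" using g(2) by (simp add: perm_grp_inv[OF G gG] c'_def g'_def)
  have gB: "g \<in> Bij X" and cB: "c \<in> Bij X" and c'B: "c' \<in> Bij X"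
    using perm_subgroup_mem[OF G] perm_subgroup_mem[OF PB] gG cG c'P by auto
  have g'B: "g' \<in> Bij X" unfolding g'_def by (rule BijGroup_inv_Bij[OF gB])
  \<comment> \<open>The labelling that turns the conjugate of \<open>c\<close> in \<open>P\<close> into the shift by one.\<close>
  define l' where "l' x = l (g' x)" for x
  have "bij_betw g' X X" using g'B by (simp add: Bij_def)
  moreover have "bij_betw l X {0..<int p ^ n}" using l(1) by (simp add: cyclic_labelling_def)
  ultimately have "bij_betw l' X {0..<int p ^ n}"
    unfolding l'_def using bij_betw_trans[of g' X X l] by (simp add: o_def)
  then interpret L: cyclic_labelling p n X l' using p by unfold_locales
  have "c' = L.shift 1"
    unfolding L.shift_def
  proof (rule L.disp_eqI[OF c'B])
    fix x assume x: "x \<in> X"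
    have g'x: "g' x \<in> X" by (rule Bij_app[OF g'B x])
    have cg: "c (g' x) \<in> X" by (rule Bij_app[OF cB g'x])
    have "g \<otimes>\<^bsub>BijGroup X\<^esub> c \<in> Bij X" using gB cB by (simp add: BijGroup_mult compose_Bij)
    then have "c' x = g (c (g' x))"
      unfolding c'_def using BijGroup_mult_apply g'B gB cB x g'x by metis
    then have "g' (c' x) = c (g' x)" using BijGroup_inv_apply(1)[OF gB cg] by (simp add: g'_def)
    then have "l' (c' x) = (l' x + 1) mod int p ^ n" using bspec[OF l(2) g'x] by (simp add: l'_def)
    then show "[l' (c' x) = l' x + 1] (mod int p ^ n)" by (simp add: cong_def)
  qed
  then have sP: "L.shift 1 \<in> P" using c'P by simp
  obtain k where k: "k \<in> primary_keys n" "L.valid_key k" "P = L.key_perms k"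
    by (rule L.sylow_eq_key_perms[OF assms(2) G Gc PB PG P(2) sP])
  have "perm_isomorphic X P X (Pi_key p n k)"
    unfolding k(3) Pi_key_eq_key_perms[OF p k(1)]
    using L.perm_isomorphic_key_perms[OF cyclic_labelling_Zmod[OF p] k(2)] by (simp add: X_def)
  moreover have "five_halves_closed X P"
    unfolding k(3) by (rule L.five_halves_closed_key_perms[OF k(2)])
  ultimately show ?thesis using k(1) unfolding X_def by blast
qed

end
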